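(* Let $\{(\mathbf{y}^k,t_k)\}$ be the sequence generated by the two-phase inexact dual path-following proximal Newton scheme (described in the context) to approximate a solution of the dual problem $\min_{\mathbf{y}}\{g^*(\mathbf{y})+\langle\mathbf{b},\mathbf{y}\rangle\mid L^*\mathbf{y}-\mathbf{c}\in\mathcal{K}^*\}$. Then, the point $(\mathbf{x}^k,\mathbf{s}^k)$ computed by $$\mathbf{x}^k:=\nabla f^*\big(t_k^{-1}(\mathbf{c}-L^*\mathbf{y}^k)\big)\in\mathrm{int}(\mathcal{K})\quad\text{and}\quad\mathbf{s}^k:=\pi_{\partial g^*(\mathbf{y}^k)}(L\mathbf{x}^k-\mathbf{b}),$$ together with $\mathbf{y}^k$, satisfies $$\left\{\begin{array}{ll}\mathbf{y}^k&\in\partial g(\mathbf{s}^k),\\ \|L^*\mathbf{y}^k-\mathbf{c}\|^*_{\mathbf{x}^k}&\le\sqrt\nu\,t_k,\\ \|L\mathbf{x}^k-\mathbf{s}^k-\mathbf{b}\|^*_{\mathbf{y}^k}&\le\theta(c,\beta)\,t_k,\end{array}\right.$$ where $$\theta(c,\beta):=\frac{(1-c^2)\beta}{(1+c\sqrt\beta)^2\big[3c\sqrt\beta+c^2\beta+(1+c\sqrt\beta)^3\big]-(1-c^2)\beta}+\left(\frac{(1-c^2)\beta+c\sqrt\beta(1+c\sqrt\beta)^2\big[3c\sqrt\beta+c^2\beta+(1+c\sqrt\beta)^3\big]}{(1+c\sqrt\beta)^2\big[3c\sqrt\beta+c^2\beta+(1+c\sqrt\beta)^3\big]-(1-c^2)\beta}\right)^2\le1$$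 is a constant for fixed $c\in(0,1]$ and $0<\beta<0.5(1+2c^2-\sqrt{1+4c^2})$. Consequently, if $\max\{\sqrt\nu,\theta(c,\beta)\}t_k=\sqrt\nu\,t_k\le\varepsilon$, then $(\mathbf{x}^k,\mathbf{s}^k)$ is an $\varepsilon$-solution of the primal problem $\max_{\mathbf{x},\mathbf{s}}\{\langle\mathbf{c},\mathbf{x}\rangle-g(\mathbf{s})\mid L\mathbf{x}-\mathbf{s}=\mathbf{b},\ \mathbf{x}\in\mathcal{K}\}$ associated with the $\varepsilon$-dual solution $\mathbf{y}^k$ of the dual problem.
   Context: Problem and assumptions. $\mathbf{c}\in\mathbb{R}^n$ (a vector, distinct from the scalar parameter $c$), $\mathbf{b}\in\mathbb{R}^p$; $L:\mathbb{R}^n\to\mathbb{R}^p$ is linear and full-row rank with $n\le p$, with adjoint $L^*$; $g:\mathbb{R}^p\to\mathbb{R}\cup\{+\infty\}$ is proper, closed, convex, with conjugate $g^*(\mathbf{u})=\sup_{\mathbf{s}}\{\langle\mathbf{u},\mathbf{s}\rangle-g(\mathbf{s})\}$. $\mathcal{K}\subset\mathbb{R}^n$ is a nonempty, closed, pointed convex cone with nonempty interior, endowed with a $\nu$-self-concordant logarithmically homogeneous barrier $f$ with $\mathrm{cl}(\mathrm{dom} f)=\mathcal{K}$; $\mathcal{K}^*=\{\mathbf{u}\mid\langle\mathbf{x},\mathbf{u}\rangle\ge0\ \forall\mathbf{x}\in\mathcal{K}\}$; $f^*(\mathbf{w})=\sup_{\mathbf{x}\in\mathcal{K}}\{\langle\mathbf{w},\mathbf{x}\rangle-f(\mathbf{x})\}$.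 The Slater condition $(\mathrm{int}(\mathcal{K})\times\mathrm{ri}(\mathrm{dom}\,g))\cap\{(\mathbf{x},\mathbf{s})\mid L\mathbf{x}-\mathbf{s}=\mathbf{b}\}\ne\emptyset$ holds and the primal solution set is nonempty. Self-concordance: $f$ is standard self-concordant if each restriction $\phi(\tau)=f(\mathbf{x}+\tau\mathbf{v})$ is convex, $\mathcal{C}^3$ with $|\phi'''|\le2(\phi'')^{3/2}$; it is a $\nu$-self-concordant barrier of $\mathcal{K}$ ($\nu>0$) if in addition $\mathrm{dom} f=\mathrm{int}(\mathcal{K})$, $\sup_{\mathbf{u}}\{2\langle\nabla f(\mathbf{x}),\mathbf{u}\rangle-\langle\nabla^2f(\mathbf{x})\mathbf{u},\mathbf{u}\rangle\}\le\nu$ on $\mathrm{int}(\mathcal{K})$ and $f\to+\infty$ at the boundary; logarithmically homogeneous: $f(\tau\mathbf{x})=f(\mathbf{x})-\nu\log\tau$ for $\tau>0$. Notation: $\varphi(\mathbf{y}):=f^*(\mathbf{c}-L^*\mathbf{y})$, a $\nu$-self-concordant barrier of the dual feasible set $\{\mathbf{y}\mid L^*\mathbf{y}-\mathbf{c}\in\mathcal{K}^*\}$ with $\nabla^2\varphi\succ0$; $\psi(\mathbf{y}):=g^*(\mathbf{y})+\langle\mathbf{b},\mathbf{y}\rangle$. Local norms: $\|\mathbf{v}\|^*_{\mathbf{x}}=\langle\nabla^2f(\mathbf{x})^{-1}\mathbf{v},\mathbf{v}\rangle^{1/2}$ for $\mathbf{x}\in\mathrm{int}(\mathcal{K})$;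 $\|\mathbf{u}\|_{\mathbf{y}}=\langle\nabla^2\varphi(\mathbf{y})\mathbf{u},\mathbf{u}\rangle^{1/2}$, $\|\mathbf{v}\|^*_{\mathbf{y}}=\langle\nabla^2\varphi(\mathbf{y})^{-1}\mathbf{v},\mathbf{v}\rangle^{1/2}$ for $\mathbf{y}\in\mathrm{dom}\,\varphi$. $\mathrm{dist}_{\mathbf{y}}(0,S)=\min\{\|\mathbf{e}\|^*_{\mathbf{y}}\mid\mathbf{e}\in S\}$. $\pi_{\partial g^*(\mathbf{y}^k)}(L\mathbf{x}^k-\mathbf{b})$ stands for the projection of $L\mathbf{x}^k-\mathbf{b}$ onto $\partial g^*(\mathbf{y}^k)$, which is a nonempty, closed and convex set. Proximal Newton decrement: $\lambda_t(\mathbf{y}):=\|\mathbf{y}-\mathbf{y}_+\|_{\mathbf{y}}$, where $\mathbf{y}_+$ is the unique minimizer over $\mathbf{u}\in\mathbb{R}^p$ of $\langle\nabla\varphi(\mathbf{y}),\mathbf{u}-\mathbf{y}\rangle+\frac12\langle\nabla^2\varphi(\mathbf{y})(\mathbf{u}-\mathbf{y}),\mathbf{u}-\mathbf{y}\rangle+t^{-1}\psi(\mathbf{u})$. Scheme. Parameters $c\in(0,1]$, $0<\beta<0.5(1+2c^2-\sqrt{1+4c^2})$. Phase 1 produces, for a given $t_0>0$, a starting point $\mathbf{y}^0\in\mathrm{dom}\,\varphi$ with $\lambda_{t_0}(\mathbf{y}^0)\le\beta$, by inexact proximal Newton steps following the path in $\tau$, decreasing from $\tau=1$ towards $0$, of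 the auxiliary problems $\min_{\mathbf{y}}\{\varphi(\mathbf{y})-\tau\langle\hat\zeta^0,\mathbf{y}\rangle+t_0^{-1}\psi(\mathbf{y})\}$, with $\hat\zeta^0=\nabla\varphi(\hat{\mathbf{y}}^0)+t_0^{-1}\hat\xi_0$, $\hat\xi_0\in\partial\psi(\hat{\mathbf{y}}^0)$, starting from an arbitrary $\hat{\mathbf{y}}^0$ in the interior of the dual feasible set. Phase 2: for $k\ge0$, $t_{k+1}:=(1-\sigma_\beta)t_k$ and $\mathbf{y}^{k+1}$ is an approximate minimizer of $\langle\nabla\varphi(\mathbf{y}^k),\mathbf{y}-\mathbf{y}^k\rangle+\frac12\langle\nabla^2\varphi(\mathbf{y}^k)(\mathbf{y}-\mathbf{y}^k),\mathbf{y}-\mathbf{y}^k\rangle+t_{k+1}^{-1}\psi(\mathbf{y})$ in the sense that $\mathrm{dist}_{\mathbf{y}^k}\big(0,\,t_{k+1}[\nabla\varphi(\mathbf{y}^k)+\nabla^2\varphi(\mathbf{y}^k)(\mathbf{y}^{k+1}-\mathbf{y}^k)]+\partial\psi(\mathbf{y}^{k+1})\big)\le t_{k+1}\delta_k$, where $$0<\sigma_\beta\le\frac{c\sqrt\beta-\beta(1+c\sqrt\beta)}{(1+c\sqrt\beta)\sqrt\nu+c\sqrt\beta},\qquad0\le\delta_k\le\frac{(1-c^2)\beta}{(1+c\sqrt\beta)^3[3c\sqrt\beta+c^2\beta+(1+c\sqrt\beta)^3]}.$$ $\varepsilon$-solution: given $\varepsilon>0$, $(\mathbf{x},\mathbf{s})$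 is an $\varepsilon$-solution of the primal problem associated with a dual solution $\mathbf{y}\in\mathbb{R}^p$ if $\mathbf{x}\in\mathrm{int}(\mathcal{K})$, $\mathbf{y}\in\partial g(\mathbf{s})$, $\|L^*\mathbf{y}-\mathbf{c}\|^*_{\mathbf{x}}\le\varepsilon$ and $\|L\mathbf{x}-\mathbf{s}-\mathbf{b}\|^*_{\mathbf{y}}\le\varepsilon$.
   Formalization: The third estimate and the ε-solution claim are stated for k ≥ 1 only, as both can fail at the Phase 1 output y^0; the projection defining s^k is taken in the local dual norm at y^k, and f is taken jointly C^3 on int(K). *)

theory Defs
  imports "HOL-Analysis.Analysis"
begin

subsection \<open>Extended-valued convex functions\<close>

definition edom :: "('a \<Rightarrow> ereal) \<Rightarrow> 'a set" where
  "edom F = {x. F x < \<infinity>}"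

definition proper_fun :: "('a \<Rightarrow> ereal) \<Rightarrow> bool" where
  "proper_fun F \<longleftrightarrow> (\<forall>x. F x \<noteq> -\<infinity>) \<and> edom F \<noteq> {}"

definition epi :: "('a \<Rightarrow> ereal) \<Rightarrow> ('a \<times> real) set" where
  "epi F = {(x, r). F x \<le> ereal r}"

definition closed_fun :: "('a::topological_space \<Rightarrow> ereal) \<Rightarrow> bool" where
  "closed_fun F \<longleftrightarrow> closed (epi F)"

definition convex_fun :: "('a::real_vector \<Rightarrow> ereal) \<Rightarrow> bool" where
  "convex_fun F \<longleftrightarrow> convex (epi F)"

definition conjugate_over :: "'a::real_inner set \<Rightarrow> ('a \<Rightarrow> ereal) \<Rightarrow> 'a \<Rightarrow> ereal" where
  "conjugate_over S F w = (SUP x\<in>S. ereal (w \<bullet> x) - F x)"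

definition subdiff :: "('a::real_inner \<Rightarrow> ereal) \<Rightarrow> 'a \<Rightarrow> 'a set" where
  "subdiff F x = {v. \<bar>F x\<bar> \<noteq> \<infinity> \<and> (\<forall>z. F x + ereal (v \<bullet> (z - x)) \<le> F z)}"

subsection \<open>Derivatives and local norms\<close>

(* Functions are extended-valued, so derivatives are those of their real part; they are
   used only at interior points of the domain. *)

definition grad :: "('a::euclidean_space \<Rightarrow> ereal) \<Rightarrow> 'a \<Rightarrow> 'a" where
  "grad F x = (THE D. GDERIV (\<lambda>z. real_of_ereal (F z)) x :> D)"

definition hess :: "('a::euclidean_space \<Rightarrow> ereal) \<Rightarrow> 'a \<Rightarrow> 'a \<Rightarrow> 'a" where
  "hess F x = frechet_derivative (grad F) (at x)"

definition local_norm :: "('a::euclidean_space \<Rightarrow> ereal) \<Rightarrow> 'a \<Rightarrow> 'a \<Rightarrow> real" where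
  "local_norm F x u = sqrt (hess F x u \<bullet> u)"

definition local_dual_norm :: "('a::euclidean_space \<Rightarrow> ereal) \<Rightarrow> 'a \<Rightarrow> 'a \<Rightarrow> real" where
  "local_dual_norm F x v = sqrt (inv (hess F x) v \<bullet> v)"

(* The value is \<infinity> for the empty set. *)
definition local_dist :: "('a::euclidean_space \<Rightarrow> ereal) \<Rightarrow> 'a \<Rightarrow> 'a set \<Rightarrow> ereal" where
  "local_dist F x S = (INF e\<in>S. ereal (local_dual_norm F x e))"

(* The projection is taken in the local dual metric at x, not in the Euclidean one: the
   residual v - s then realizes the local distance from v to S. *)
definition local_proj :: "('a::euclidean_space \<Rightarrow> ereal) \<Rightarrow> 'a \<Rightarrow> 'a set \<Rightarrow> 'a \<Rightarrow> 'a" where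
  "local_proj F x S v = arg_min_on (\<lambda>s. local_dual_norm F x (v - s)) S"

subsection \<open>Self-concordant barriers\<close>

definition C3_on :: "'a::euclidean_space set \<Rightarrow> ('a \<Rightarrow> real) \<Rightarrow> bool" where
  "C3_on S F \<longleftrightarrow>
     (\<exists>(D1 :: 'a \<Rightarrow> 'a \<Rightarrow>\<^sub>L real) (D2 :: 'a \<Rightarrow> 'a \<Rightarrow>\<^sub>L 'a \<Rightarrow>\<^sub>L real)
       (D3 :: 'a \<Rightarrow> 'a \<Rightarrow>\<^sub>L 'a \<Rightarrow>\<^sub>L 'a \<Rightarrow>\<^sub>L real).
        (\<forall>x\<in>S. (F has_derivative blinfun_apply (D1 x)) (at x)) \<and>
        (\<forall>x\<in>S. (D1 has_derivative blinfun_apply (D2 x)) (at x)) \<and>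
        (\<forall>x\<in>S. (D2 has_derivative blinfun_apply (D3 x)) (at x)) \<and>
        continuous_on S D3)"

definition std_self_concordant_line :: "real set \<Rightarrow> (real \<Rightarrow> real) \<Rightarrow> bool" where
  "std_self_concordant_line I p \<longleftrightarrow>
     convex_on I p \<and> C3_on I p \<and>
     (\<forall>\<tau>\<in>I. \<bar>(deriv ^^ 3) p \<tau>\<bar> \<le> 2 * (deriv ^^ 2) p \<tau> powr (3 / 2))"

(* The joint C3 requirement is the usual convention for multivariate self-concordant
   functions; it gives a meaning to the gradient and the Hessian. *)
definition std_self_concordant :: "('a::euclidean_space \<Rightarrow> ereal) \<Rightarrow> bool" where
  "std_self_concordant F \<longleftrightarrow>
     C3_on (edom F) (\<lambda>x. real_of_ereal (F x)) \<and>
     (\<forall>x\<in>edom F. \<forall>v. std_self_concordant_line {\<tau>. x + \<tau> *\<^sub>R v \<in> edom F}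
                             (\<lambda>\<tau>. real_of_ereal (F (x + \<tau> *\<^sub>R v))))"

definition self_concordant_barrier ::
    "real \<Rightarrow> 'a::euclidean_space set \<Rightarrow> ('a \<Rightarrow> ereal) \<Rightarrow> bool" where
  "self_concordant_barrier \<nu> K F \<longleftrightarrow>
     \<nu> > 0 \<and> (\<forall>x. F x \<noteq> -\<infinity>) \<and> edom F = interior K \<and> std_self_concordant F \<and>
     (\<forall>x\<in>interior K. (SUP u. ereal (2 * (grad F x \<bullet> u) - hess F x u \<bullet> u)) \<le> ereal \<nu>) \<and>
     (\<forall>z\<in>frontier K. (F \<longlongrightarrow> \<infinity>) (at z within interior K))"

definition log_homogeneous :: "real \<Rightarrow> ('a::real_vector \<Rightarrow> ereal) \<Rightarrow> bool" where
  "log_homogeneous \<nu> F \<longleftrightarrow>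
     (\<forall>x\<in>edom F. \<forall>\<tau>>0. F (\<tau> *\<^sub>R x) = F x - ereal (\<nu> * ln \<tau>))"

subsection \<open>The primal and dual problems\<close>

definition dual_cone :: "'a::real_inner set \<Rightarrow> 'a set" where
  "dual_cone K = {u. \<forall>x\<in>K. 0 \<le> x \<bullet> u}"

definition primal_feasible ::
    "'a::euclidean_space set \<Rightarrow> ('a \<Rightarrow> 'b::euclidean_space) \<Rightarrow> 'b \<Rightarrow> ('a \<times> 'b) set" where
  "primal_feasible K L b = {(x, s). L x - s = b \<and> x \<in> K}"

definition primal_solutions ::
    "'a::euclidean_space set \<Rightarrow> ('b \<Rightarrow> ereal) \<Rightarrow> ('a \<Rightarrow> 'b::euclidean_space) \<Rightarrow> 'b \<Rightarrow> 'a
      \<Rightarrow> ('a \<times> 'b) set" where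
  "primal_solutions K g L b q =
     {(x, s) \<in> primal_feasible K L b.
        \<forall>(x', s') \<in> primal_feasible K L b. ereal (q \<bullet> x') - g s' \<le> ereal (q \<bullet> x) - g s}"

definition slater ::
    "'a::euclidean_space set \<Rightarrow> ('b \<Rightarrow> ereal) \<Rightarrow> ('a \<Rightarrow> 'b::euclidean_space) \<Rightarrow> 'b \<Rightarrow> bool" where
  "slater K g L b \<longleftrightarrow>
     (interior K \<times> rel_interior (edom g)) \<inter> {(x, s). L x - s = b} \<noteq> {}"

definition dual_feasible ::
    "'a::euclidean_space set \<Rightarrow> ('a \<Rightarrow> 'b::euclidean_space) \<Rightarrow> 'a \<Rightarrow> 'b set" where
  "dual_feasible K L q = {y. adjoint L y - q \<in> dual_cone K}"

definition dual_barrier ::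
    "'a::euclidean_space set \<Rightarrow> ('a \<Rightarrow> ereal) \<Rightarrow> ('a \<Rightarrow> 'b::euclidean_space) \<Rightarrow> 'a
      \<Rightarrow> 'b \<Rightarrow> ereal" where
  "dual_barrier K f L q y = conjugate_over K f (q - adjoint L y)"

definition dual_nonsmooth :: "('b::euclidean_space \<Rightarrow> ereal) \<Rightarrow> 'b \<Rightarrow> 'b \<Rightarrow> ereal" where
  "dual_nonsmooth g b y = conjugate_over UNIV g y + ereal (b \<bullet> y)"

(* "y \<in> edom \<phi>" is implicit in the use of the local norm at y. *)
definition eps_solution ::
    "'a::euclidean_space set \<Rightarrow> ('a \<Rightarrow> ereal) \<Rightarrow> ('b::euclidean_space \<Rightarrow> ereal) \<Rightarrow> ('b \<Rightarrow> ereal)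
      \<Rightarrow> ('a \<Rightarrow> 'b) \<Rightarrow> 'b \<Rightarrow> 'a \<Rightarrow> real \<Rightarrow> 'a \<times> 'b \<Rightarrow> 'b \<Rightarrow> bool" where
  "eps_solution K f \<phi> g L b q \<epsilon> = (\<lambda>(x, s) y.
     x \<in> interior K \<and> y \<in> edom \<phi> \<and> y \<in> subdiff g s \<and>
     local_dual_norm f x (adjoint L y - q) \<le> \<epsilon> \<and>
     local_dual_norm \<phi> y (L x - s - b) \<le> \<epsilon>)"

subsection \<open>The two-phase inexact proximal Newton scheme\<close>

definition prox_newton_model ::
    "('b::euclidean_space \<Rightarrow> ereal) \<Rightarrow> ('b \<Rightarrow> ereal) \<Rightarrow> real \<Rightarrow> 'b \<Rightarrow> 'b \<Rightarrow> ereal" where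
  "prox_newton_model \<phi> \<psi> t y u =
     ereal (grad \<phi> y \<bullet> (u - y) + 1 / 2 * (hess \<phi> y (u - y) \<bullet> (u - y))) + ereal (1 / t) * \<psi> u"

definition newton_decrement ::
    "('b::euclidean_space \<Rightarrow> ereal) \<Rightarrow> ('b \<Rightarrow> ereal) \<Rightarrow> real \<Rightarrow> 'b \<Rightarrow> real" where
  "newton_decrement \<phi> \<psi> t y =
     local_norm \<phi> y (y - (ARG_MIN (prox_newton_model \<phi> \<psi> t y) u. True))"

(* Residuals, at the trial point y', of the optimality condition for the minimization over u
   of w \<bullet> (u - y) + 1/2 * (hess \<phi> y (u - y) \<bullet> (u - y)) + \<psi> u / t, multiplied by t. *)
definition newton_residuals ::
    "('b::euclidean_space \<Rightarrow> ereal) \<Rightarrow> ('b \<Rightarrow> ereal) \<Rightarrow> real \<Rightarrow> 'b \<Rightarrow> 'b \<Rightarrow> 'b \<Rightarrow> 'b set" where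
  "newton_residuals \<phi> \<psi> t w y y' =
     (\<lambda>\<xi>. t *\<^sub>R (w + hess \<phi> y (y' - y)) + \<xi>) ` subdiff \<psi> y'"

definition inexact_newton_step ::
    "('b::euclidean_space \<Rightarrow> ereal) \<Rightarrow> ('b \<Rightarrow> ereal) \<Rightarrow> real \<Rightarrow> 'b \<Rightarrow> real \<Rightarrow> 'b \<Rightarrow> 'b \<Rightarrow> bool" where
  "inexact_newton_step \<phi> \<psi> t w \<delta> y y' \<longleftrightarrow>
     local_dist \<phi> y (newton_residuals \<phi> \<psi> t w y y') \<le> ereal (t * \<delta>)"

(* The first phase runs m \<ge> 0 inexact steps on the auxiliary problems, whose smooth part
   \<phi> u - \<tau> * (\<zeta> \<bullet> u) has gradient grad \<phi> u - \<tau> *\<^sub>R \<zeta> and the Hessian of \<phi>. The step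
   lengths in \<tau> and the tolerances \<eta> are arbitrary. *)
definition phase1_output ::
    "('b::euclidean_space \<Rightarrow> ereal) \<Rightarrow> ('b \<Rightarrow> ereal) \<Rightarrow> 'b set \<Rightarrow> real \<Rightarrow> real \<Rightarrow> 'b \<Rightarrow> bool" where
  "phase1_output \<phi> \<psi> Y t0 \<beta> y0 \<longleftrightarrow>
     (\<exists>(m::nat) (z :: nat \<Rightarrow> 'b) (\<tau> :: nat \<Rightarrow> real) (\<eta> :: nat \<Rightarrow> real) \<xi> \<zeta>.
        z 0 \<in> interior Y \<and> \<xi> \<in> subdiff \<psi> (z 0) \<and> \<zeta> = grad \<phi> (z 0) + (1 / t0) *\<^sub>R \<xi> \<and>
        \<tau> 0 = 1 \<and>
        (\<forall>j<m. 0 \<le> \<tau> (Suc j) \<and> \<tau> (Suc j) \<le> \<tau> j \<and> z (Suc j) \<in> edom \<phi> \<and>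
           inexact_newton_step \<phi> \<psi> t0 (grad \<phi> (z j) - \<tau> (Suc j) *\<^sub>R \<zeta>) (\<eta> j) (z j) (z (Suc j))) \<and>
        y0 = z m \<and> y0 \<in> edom \<phi> \<and> newton_decrement \<phi> \<psi> t0 y0 \<le> \<beta>)"

definition \<sigma>_bound :: "real \<Rightarrow> real \<Rightarrow> real \<Rightarrow> real" where
  "\<sigma>_bound \<nu> c \<beta> =
     (c * sqrt \<beta> - \<beta> * (1 + c * sqrt \<beta>)) / ((1 + c * sqrt \<beta>) * sqrt \<nu> + c * sqrt \<beta>)"

definition \<delta>_bound :: "real \<Rightarrow> real \<Rightarrow> real" where
  "\<delta>_bound c \<beta> =
     ((1 - c\<^sup>2) * \<beta>) /
     ((1 + c * sqrt \<beta>) ^ 3 * (3 * c * sqrt \<beta> + c\<^sup>2 * \<beta> + (1 + c * sqrt \<beta>) ^ 3))"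

definition two_phase_scheme ::
    "('b::euclidean_space \<Rightarrow> ereal) \<Rightarrow> ('b \<Rightarrow> ereal) \<Rightarrow> 'b set \<Rightarrow> real \<Rightarrow> real \<Rightarrow> real
      \<Rightarrow> real \<Rightarrow> (nat \<Rightarrow> real) \<Rightarrow> (nat \<Rightarrow> real) \<Rightarrow> (nat \<Rightarrow> 'b) \<Rightarrow> bool" where
  "two_phase_scheme \<phi> \<psi> Y \<nu> c \<beta> \<sigma> \<delta> t y \<longleftrightarrow>
     0 < t 0 \<and> phase1_output \<phi> \<psi> Y (t 0) \<beta> (y 0) \<and>
     0 < \<sigma> \<and> \<sigma> \<le> \<sigma>_bound \<nu> c \<beta> \<and>
     (\<forall>k. 0 \<le> \<delta> k \<and> \<delta> k \<le> \<delta>_bound c \<beta> \<and> t (Suc k) = (1 - \<sigma>) * t k \<and>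
          inexact_newton_step \<phi> \<psi> (t (Suc k)) (grad \<phi> (y k)) (\<delta> k) (y k) (y (Suc k)))"

definition \<theta> :: "real \<Rightarrow> real \<Rightarrow> real" where
  "\<theta> c \<beta> =
     ((1 - c\<^sup>2) * \<beta>) /
       ((1 + c * sqrt \<beta>)\<^sup>2 * (3 * c * sqrt \<beta> + c\<^sup>2 * \<beta> + (1 + c * sqrt \<beta>) ^ 3) - (1 - c\<^sup>2) * \<beta>)
     + (((1 - c\<^sup>2) * \<beta> +
           c * sqrt \<beta> * (1 + c * sqrt \<beta>)\<^sup>2 *
             (3 * c * sqrt \<beta> + c\<^sup>2 * \<beta> + (1 + c * sqrt \<beta>) ^ 3)) /
        ((1 + c * sqrt \<beta>)\<^sup>2 * (3 * c * sqrt \<beta> + c\<^sup>2 * \<beta> + (1 + c * sqrt \<beta>) ^ 3) - (1 - c\<^sup>2) * \<beta>))\<^sup>2"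

end

theory Submission
  imports Defs
begin

text \<open>
  Write \<open>\<phi> y = f\<^sup>* (q - L\<^sup>* y)\<close> and \<open>\<psi> y = g\<^sup>* y + \<langle>b, y\<rangle>\<close>. The proof has three ingredients.

  \<^item> The conjugate of a self-concordant logarithmically homogeneous barrier inherits
  self-concordance. The gradient \<open>G\<close> of \<open>f\<close> is a diffeomorphism from the interior of \<open>K\<close> onto the
  domain of \<open>f\<^sup>*\<close>: it is strictly monotone because \<open>K\<close> contains no line, and a point \<open>w\<close> at which
  \<open>f\<^sup>*\<close> is finite is a gradient because \<open>f - \<langle>w, \<cdot>\<rangle>\<close> has bounded sublevel sets
  (\<open>gradient_attained_of_bounded_below\<close>). Differentiating the inverse of \<open>G\<close> and of its derivative
  at once (\<open>joint_inverse_deriv\<close>) expresses the second and third derivatives of \<open>f\<^sup>*\<close> through those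
  of \<open>f\<close>. Together with Banach's theorem on symmetric trilinear forms
  (\<open>trilinear_bound_of_diagonal\<close>) this gives the usual estimates in the Dikin ellipsoid, first for
  \<open>f\<^sup>*\<close> and then, composing with \<open>y \<mapsto> q - L\<^sup>* y\<close>, for \<open>\<phi>\<close> (\<open>dual_barrier_self_concordant\<close>): if
  \<open>r = \<parallel>d\<parallel>\<^sub>y < 1\<close>, then \<open>y + d\<close> stays in the domain, the local norm there is at least \<open>1 - r\<close> times
  the one at \<open>y\<close>, and the error of linearizing \<open>\<nabla>\<phi>\<close> has dual norm at most \<open>r\<^sup>2 / (1 - r)\<close>.

  \<^item> Logarithmic homogeneity, differentiated along rays, gives \<open>\<nabla>\<^sup>2f(x) x = - \<nabla>f(x)\<close> and
  \<open>\<langle>\<nabla>f(x), x\<rangle> = - \<nu>\<close>. Therefore \<open>x\<close> has local norm \<open>sqrt \<nu>\<close>, which is the bound on dual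
  infeasibility; self-concordance along a ray gives \<open>\<nu> \<ge> 1\<close>; and the primal point \<open>x\<^sup>k\<close> satisfies
  \<open>L x\<^sup>k = - t\<^sub>k \<nabla>\<phi>(y\<^sup>k)\<close> (\<open>primal_point\<close>).

  \<^item> The proximal Newton decrement stays below \<open>\<beta>\<close>. Monotonicity of \<open>\<partial>\<psi>\<close> shows that reducing \<open>t\<close>
  raises the decrement at \<open>y\<^sup>k\<close> to at most \<open>a / (1 + a)\<close> with \<open>a = c * sqrt \<beta>\<close>
  (\<open>predictor_bound\<close>), and that the inexact step has local length at most
  \<open>r = \<delta> + a / (1 + a)\<close> (\<open>inexact_step_radius\<close>). Replacing the linearized gradient in the
  approximate optimality condition by the gradient at \<open>y\<^sup>k\<^sup>+\<^sup>1\<close> then yields some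
  \<open>\<xi> \<in> \<partial>\<psi>(y\<^sup>k\<^sup>+\<^sup>1)\<close> for which \<open>\<nabla>\<phi>(y\<^sup>k\<^sup>+\<^sup>1) + \<xi> / t\<close> has dual norm at most
  \<open>\<delta> / (1 - r) + (r / (1 - r))\<^sup>2\<close>. For the largest admissible \<open>\<delta>\<close> this number is exactly
  \<open>\<theta> c \<beta>\<close>, and \<open>\<theta> c \<beta> \<le> \<beta> < 1\<close> (\<open>theta_facts\<close>). The same number bounds the next decrement,
  which closes the induction, and multiplied by \<open>t\<^sub>k\<close> it bounds the distance from \<open>L x\<^sup>k - b\<close> to
  \<open>\<partial>g\<^sup>*(y\<^sup>k)\<close>, which the projection \<open>s\<^sup>k\<close> attains.

  The inclusion \<open>y\<^sup>k \<in> \<partial>g(s\<^sup>k)\<close> is conjugate duality for the closed convex function \<open>g\<close>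
  (\<open>subdiff_conjugate_imp_subdiff\<close>).
\<close>

section \<open>Self-concordance on the real line and symmetry of second derivatives\<close>

lemma field_bound_convex:
  fixes f :: "real \<Rightarrow> real"
  assumes "convex I" "\<And>t. t \<in> I \<Longrightarrow> (f has_real_derivative f' t) (at t within I)"
    "\<And>t. t \<in> I \<Longrightarrow> \<bar>f' t\<bar> \<le> B" "s \<in> I" "t \<in> I"
  shows "\<bar>f t - f s\<bar> \<le> B * \<bar>t - s\<bar>"
  using field_differentiable_bound[of I f f' B t s] assms by auto

text \<open>The derivative of \<open>h\<^sup>-\<^sup>1\<^sup>/\<^sup>2\<close> is \<open>- h' / (2 h\<^sup>3\<^sup>/\<^sup>2)\<close>, which self-concordance bounds by 1. Adding
  \<open>e > 0\<close> under the root keeps the argument valid where \<open>h\<close> vanishes.\<close>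

lemma self_concordant_line_lipschitz:
  fixes h h' :: "real \<Rightarrow> real"
  assumes I: "convex I"
    and h: "\<And>t. t \<in> I \<Longrightarrow> (h has_real_derivative h' t) (at t within I)"
    and nonneg: "\<And>t. t \<in> I \<Longrightarrow> 0 \<le> h t"
    and sc: "\<And>t. t \<in> I \<Longrightarrow> \<bar>h' t\<bar> \<le> 2 * (h t * sqrt (h t))"
    and st: "s \<in> I" "t \<in> I" and e: "0 < e"
  shows "\<bar>1 / sqrt (h t + e) - 1 / sqrt (h s + e)\<bar> \<le> \<bar>t - s\<bar>"
proof -
  have "\<bar>1 / sqrt (h t + e) - 1 / sqrt (h s + e)\<bar> \<le> 1 * \<bar>t - s\<bar>"
  proof (rule field_bound_convex[OF I _ _ st])
    fix r assume r: "r \<in> I"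
    have pos: "0 < h r + e" using nonneg[OF r] e by simp
    show "((\<lambda>t. 1 / sqrt (h t + e)) has_real_derivative
        - (h' r / (2 * ((h r + e) * sqrt (h r + e))))) (at r within I)"
      using pos by (auto intro!: derivative_eq_intros h[OF r] simp: field_simps real_sqrt_mult_self)
    have "h r * sqrt (h r) \<le> (h r + e) * sqrt (h r + e)"
      using nonneg[OF r] e by (intro mult_mono) auto
    with sc[OF r] pos show "\<bar>- (h' r / (2 * ((h r + e) * sqrt (h r + e))))\<bar> \<le> 1"
      by (simp add: abs_mult)
  qed
  then show ?thesis by simp
qed

text \<open>At a zero of \<open>h\<close> the regularized root is \<open>e\<^sup>-\<^sup>1\<^sup>/\<^sup>2\<close>, which is unbounded as \<open>e\<close> tends to 0 and
  so contradicts the Lipschitz bound as soon as \<open>h\<close> is positive somewhere.\<close>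

lemma self_concordant_line:
  fixes h h' :: "real \<Rightarrow> real"
  assumes I: "convex I"
    and h: "\<And>t. t \<in> I \<Longrightarrow> (h has_real_derivative h' t) (at t within I)"
    and nonneg: "\<And>t. t \<in> I \<Longrightarrow> 0 \<le> h t"
    and sc: "\<And>t. t \<in> I \<Longrightarrow> \<bar>h' t\<bar> \<le> 2 * (h t * sqrt (h t))"
    and st: "s \<in> I" "t \<in> I" and hs: "0 < h s"
  shows "0 < h t" "\<bar>1 / sqrt (h t) - 1 / sqrt (h s)\<bar> \<le> \<bar>t - s\<bar>"
proof -
  have lip: "\<bar>1 / sqrt (h t + e) - 1 / sqrt (h s + e)\<bar> \<le> \<bar>t - s\<bar>" if "0 < e" for e
    using self_concordant_line_lipschitz[OF I h nonneg sc st that] by simp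
  show ht: "0 < h t"
  proof (rule ccontr)
    assume "\<not> 0 < h t"
    then have ht: "h t = 0" using nonneg st by force
    \<comment> \<open>The regularization for which the root at t exceeds the Lipschitz bound C by 1.\<close>
    define C where "C = 1 / sqrt (h s) + \<bar>t - s\<bar>"
    have C: "0 < C" using hs by (simp add: C_def add_pos_nonneg)
    define e where "e = 1 / (C + 1)\<^sup>2"
    have e: "0 < e" using C by (simp add: e_def)
    have "sqrt e = 1 / (C + 1)" using C by (simp add: e_def real_sqrt_divide)
    then have "1 / sqrt (h t + e) = C + 1" by (simp add: ht)
    moreover have "1 / sqrt (h s + e) \<le> 1 / sqrt (h s)"
      using hs e by (intro divide_left_mono mult_pos_pos) auto
    ultimately show False using lip[OF e] by (simp add: C_def)
  qed
  have lim: "((\<lambda>e. \<bar>1 / sqrt (h t + e) - 1 / sqrt (h s + e)\<bar>) \<longlongrightarrow>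
      \<bar>1 / sqrt (h t + 0) - 1 / sqrt (h s + 0)\<bar>) (at_right 0)"
    using ht hs by (intro tendsto_intros) auto
  have "\<bar>1 / sqrt (h t + 0) - 1 / sqrt (h s + 0)\<bar> \<le> \<bar>t - s\<bar>"
    using lip by (intro tendsto_upperbound[OF lim] eventually_at_rightI[of 0 1]) auto
  then show "\<bar>1 / sqrt (h t) - 1 / sqrt (h s)\<bar> \<le> \<bar>t - s\<bar>" by simp
qed

text \<open>Schwarz's theorem. The second difference of \<open>F\<close> over a parallelogram with sides \<open>s u\<close> and
  \<open>s v\<close>, divided by \<open>s\<^sup>2\<close>, tends to \<open>B v u\<close> by the mean value theorem in direction \<open>u\<close>, and it is
  symmetric in \<open>u\<close> and \<open>v\<close>.\<close>

lemma second_derivative_symmetric: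
  fixes F :: "'a::real_normed_vector \<Rightarrow> real" and G :: "'a \<Rightarrow> 'a \<Rightarrow> real"
    and B :: "'a \<Rightarrow> 'a \<Rightarrow> real"
  assumes S: "open S" "x \<in> S"
    and F: "\<And>z. z \<in> S \<Longrightarrow> (F has_derivative G z) (at z)"
    and G: "\<And>u. ((\<lambda>z. G z u) has_derivative (\<lambda>h. B h u)) (at x)"
  shows "B u v = B v u"
proof -
  have half: "\<exists>d>0. \<forall>s. 0 < s \<and> s < d \<longrightarrow>
      \<bar>(F (x + s *\<^sub>R u + s *\<^sub>R v) - F (x + s *\<^sub>R u) - F (x + s *\<^sub>R v) + F x) - s\<^sup>2 * B v u\<bar> \<le> e * s\<^sup>2"
    if e: "0 < e" for e :: real and u v
  proof -
    define N where "N = 2 * norm u + 2 * norm v + 1"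
    have N: "0 < N" by (simp add: N_def add_nonneg_pos)
    obtain d1 where d1: "0 < d1" "ball x d1 \<subseteq> S" using S by (meson openE)
    have lin: "linear (\<lambda>h. B h u)" using G[of u] has_derivative_linear by blast
    obtain d2 where d2: "0 < d2"
      "\<And>z. norm (z - x) < d2 \<Longrightarrow> \<bar>G z u - G x u - B (z - x) u\<bar> \<le> e / (2 * N) * norm (z - x)"
    proof -
      have "0 < e / (2 * N)" using e N by simp
      then show ?thesis using G[of u, unfolded has_derivative_at_alt] that by (metis real_norm_def)
    qed
    define d where "d = min d1 d2 / N"
    have d: "0 < d" using d1 d2 N by (simp add: d_def)
    show ?thesis
    proof (intro exI[of _ d] conjI allI impI d)
      fix s assume s: "0 < s \<and> s < d"
      then have sN: "s * N < min d1 d2" using N by (simp add: d_def field_simps)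
      have small: "norm (r *\<^sub>R u + q *\<^sub>R v) < min d1 d2 \<and> norm (r *\<^sub>R u + q *\<^sub>R v) \<le> s * N"
        if "0 \<le> r" "r \<le> s" "0 \<le> q" "q \<le> s" for r q
      proof -
        have "norm (r *\<^sub>R u + q *\<^sub>R v) \<le> r * norm u + q * norm v"
          using norm_triangle_ineq[of "r *\<^sub>R u" "q *\<^sub>R v"] that by simp
        also have "\<dots> \<le> s * norm u + s * norm v" using that
          by (intro add_mono mult_right_mono) auto
        also have "\<dots> \<le> s * N"
        proof -
          have "0 \<le> s * norm u" "0 \<le> s * norm v" using s by auto
          then show ?thesis using s by (simp add: N_def algebra_simps)
        qed
        finally show ?thesis using sN by linarith
      qed
      have inS: "x + r *\<^sub>R u + q *\<^sub>R v \<in> S" if "0 \<le> r" "r \<le> s" "0 \<le> q" "q \<le> s" for r q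
        using small[OF that] d1(2) by (auto simp: subset_iff dist_norm norm_minus_commute algebra_simps)
      have der: "((\<lambda>r. F (x + r *\<^sub>R u + q *\<^sub>R v)) has_real_derivative G (x + r *\<^sub>R u + q *\<^sub>R v) u)
          (at r)" if "0 \<le> r" "r \<le> s" "0 \<le> q" "q \<le> s" for r q
      proof -
        have "((\<lambda>r. F (x + r *\<^sub>R u + q *\<^sub>R v)) has_derivative
            (\<lambda>h. G (x + r *\<^sub>R u + q *\<^sub>R v) (h *\<^sub>R u))) (at r)"
          by (rule has_derivative_compose[of "\<lambda>r. x + r *\<^sub>R u + q *\<^sub>R v" "\<lambda>h. h *\<^sub>R u" r UNIV F,
                OF _ F[OF inS[OF that]]]) (auto intro!: derivative_eq_intros)
        moreover have "linear (G (x + r *\<^sub>R u + q *\<^sub>R v))"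
          using F[OF inS[OF that]] has_derivative_linear by blast
        ultimately show ?thesis
          by (simp add: has_field_derivative_def linear_cmul mult.commute[of _ "G _ _"])
      qed
      define g where "g r = F (x + r *\<^sub>R u + s *\<^sub>R v) - F (x + r *\<^sub>R u + 0 *\<^sub>R v)" for r
      have "\<exists>z. 0 < z \<and> z < s \<and> g s - g 0 = (s - 0) *
          (G (x + z *\<^sub>R u + s *\<^sub>R v) u - G (x + z *\<^sub>R u + 0 *\<^sub>R v) u)"
        unfolding g_def using s by (intro MVT2 DERIV_diff der) auto
      then obtain z where z: "0 < z" "z < s"
        "g s - g 0 = s * (G (x + z *\<^sub>R u + s *\<^sub>R v) u - G (x + z *\<^sub>R u + 0 *\<^sub>R v) u)" by auto
      have b: "\<bar>G (x + z *\<^sub>R u + q *\<^sub>R v) u - G x u - B (z *\<^sub>R u + q *\<^sub>R v) u\<bar> \<le> e / 2 * s"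
        if "0 \<le> q" "q \<le> s" for q
      proof -
        have sm: "norm (z *\<^sub>R u + q *\<^sub>R v) < min d1 d2 \<and> norm (z *\<^sub>R u + q *\<^sub>R v) \<le> s * N"
          using small[of z q] z that by auto
        have "\<bar>G (x + z *\<^sub>R u + q *\<^sub>R v) u - G x u - B (z *\<^sub>R u + q *\<^sub>R v) u\<bar>
            \<le> e / (2 * N) * norm (z *\<^sub>R u + q *\<^sub>R v)"
          using d2(2)[of "x + z *\<^sub>R u + q *\<^sub>R v"] sm by (simp add: algebra_simps)
        also have "\<dots> \<le> e / (2 * N) * (s * N)" using sm e N by (intro mult_left_mono) auto
        also have "\<dots> = e / 2 * s" using N by simp
        finally show ?thesis .
      qed
      have Bv: "B (z *\<^sub>R u + q *\<^sub>R v) u = z * B u u + q * B v u" for q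
        using linear_add[OF lin] linear_cmul[OF lin] by simp
      have key: "\<bar>(G (x + z *\<^sub>R u + s *\<^sub>R v) u - G (x + z *\<^sub>R u + 0 *\<^sub>R v) u) - s * B v u\<bar> \<le> e * s"
      proof -
        have "\<bar>p - q\<bar> \<le> k / 2 * s \<Longrightarrow> \<bar>p' - q'\<bar> \<le> k / 2 * s \<Longrightarrow> \<bar>(p - p') - (q - q')\<bar> \<le> k * s"
          for p p' q q' k :: real by linarith
        from this[OF b[of s, unfolded Bv diff_diff_eq] b[of 0, unfolded Bv diff_diff_eq]]
        show ?thesis using s by (simp add: algebra_simps)
      qed
      have eq: "F (x + s *\<^sub>R u + s *\<^sub>R v) - F (x + s *\<^sub>R u) - F (x + s *\<^sub>R v) + F x = g s - g 0"
        by (simp add: g_def)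
      have "\<bar>(g s - g 0) - s\<^sup>2 * B v u\<bar> =
          s * \<bar>(G (x + z *\<^sub>R u + s *\<^sub>R v) u - G (x + z *\<^sub>R u + 0 *\<^sub>R v) u) - s * B v u\<bar>"
      proof -
        have "\<bar>s * p - s\<^sup>2 * k\<bar> = s * \<bar>p - s * k\<bar>" for p k
          using abs_mult[of s "p - s * k"] s by (simp add: right_diff_distrib power2_eq_square)
        then show ?thesis unfolding z(3) .
      qed
      also have "\<dots> \<le> s * (e * s)" using key s by (intro mult_left_mono) auto
      finally show "\<bar>(F (x + s *\<^sub>R u + s *\<^sub>R v) - F (x + s *\<^sub>R u) - F (x + s *\<^sub>R v) + F x) - s\<^sup>2 * B v u\<bar>
          \<le> e * s\<^sup>2" unfolding eq by (simp add: power2_eq_square algebra_simps)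
    qed
  qed
  have "\<bar>B u v - B v u\<bar> \<le> 0"
  proof (rule field_le_epsilon)
    fix e :: real assume "0 < e"
    then have e: "0 < e / 2" by simp
    obtain d1 where d1: "0 < d1" "\<And>s. 0 < s \<and> s < d1 \<Longrightarrow>
      \<bar>(F (x + s *\<^sub>R u + s *\<^sub>R v) - F (x + s *\<^sub>R u) - F (x + s *\<^sub>R v) + F x) - s\<^sup>2 * B v u\<bar> \<le> e / 2 * s\<^sup>2"
      using half[OF e, of u v] by blast
    obtain d2 where d2: "0 < d2" "\<And>s. 0 < s \<and> s < d2 \<Longrightarrow>
      \<bar>(F (x + s *\<^sub>R v + s *\<^sub>R u) - F (x + s *\<^sub>R v) - F (x + s *\<^sub>R u) + F x) - s\<^sup>2 * B u v\<bar> \<le> e / 2 * s\<^sup>2"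
      using half[OF e, of v u] by blast
    define s where "s = min d1 d2 / 2"
    have s: "0 < s" "s < d1" "s < d2" using d1 d2 by (auto simp: s_def)
    have comm: "x + s *\<^sub>R v + s *\<^sub>R u = x + s *\<^sub>R u + s *\<^sub>R v" by (simp add: algebra_simps)
    have arith: "\<bar>(p - q - r + t) - k\<bar> \<le> e' \<Longrightarrow> \<bar>(p - r - q + t) - k'\<bar> \<le> e' \<Longrightarrow> \<bar>k' - k\<bar> \<le> 2 * e'"
      for p q r t k k' e' :: real by linarith
    have "\<bar>s\<^sup>2 * B u v - s\<^sup>2 * B v u\<bar> \<le> 2 * (e / 2 * s\<^sup>2)"
      using arith[OF d1(2)[of s] d2(2)[of s, unfolded comm]] s by blast
    then have "s\<^sup>2 * \<bar>B u v - B v u\<bar> \<le> s\<^sup>2 * e"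
      using abs_mult[of "s\<^sup>2" "B u v - B v u"] by (simp add: right_diff_distrib mult.commute)
    then show "\<bar>B u v - B v u\<bar> \<le> 0 + e" using s by simp
  qed
  then show ?thesis by simp
qed

section \<open>Positive definite operators and their norms\<close>

definition pd_op :: "('a::euclidean_space \<Rightarrow> 'a) \<Rightarrow> bool" where
  "pd_op P \<longleftrightarrow> linear P \<and> (\<forall>u v. P u \<bullet> v = P v \<bullet> u) \<and> (\<forall>u. u \<noteq> 0 \<longrightarrow> 0 < P u \<bullet> u)"

text \<open>The local norms at a point, as norms attached to an arbitrary operator in place of the
  Hessian.\<close>

definition op_norm :: "('a::euclidean_space \<Rightarrow> 'a) \<Rightarrow> 'a \<Rightarrow> real" where
  "op_norm P u = sqrt (P u \<bullet> u)"

definition op_dual_norm :: "('a::euclidean_space \<Rightarrow> 'a) \<Rightarrow> 'a \<Rightarrow> real" where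
  "op_dual_norm P v = sqrt (inv P v \<bullet> v)"

lemma attains_min_of_bounded_sublevel:
  fixes F :: "'a::heine_borel \<Rightarrow> real"
  assumes "x0 \<in> S" "closed {x\<in>S. F x \<le> F x0}" "bounded {x\<in>S. F x \<le> F x0}" "continuous_on S F"
  obtains x where "x \<in> S" "\<And>z. z \<in> S \<Longrightarrow> F x \<le> F z"
proof -
  have "compact {x\<in>S. F x \<le> F x0}" using assms(2,3) by (simp add: compact_eq_bounded_closed)
  moreover have "continuous_on {x\<in>S. F x \<le> F x0} F" by (rule continuous_on_subset[OF assms(4)]) auto
  ultimately obtain x where x: "x \<in> S" "F x \<le> F x0" "\<And>z. z \<in> S \<Longrightarrow> F z \<le> F x0 \<Longrightarrow> F x \<le> F z"
    using continuous_attains_inf[of "{x\<in>S. F x \<le> F x0}" F] assms(1) by blast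
  have "F x \<le> F z" if "z \<in> S" for z using x(2) x(3)[OF that] by linarith
  with x(1) show ?thesis by (rule that)
qed

context
  fixes P :: "'a::euclidean_space \<Rightarrow> 'a"
  assumes P: "pd_op P"
begin

lemma pd_linear: "linear P" and pd_sym: "P u \<bullet> v = P v \<bullet> u" and pd_pos: "u \<noteq> 0 \<Longrightarrow> 0 < P u \<bullet> u"
  using P by (auto simp: pd_op_def)

lemma pd_nonneg: "0 \<le> P u \<bullet> u"
  using pd_pos[of u] by (cases "u = 0") auto

lemma pd_bij: "bij P"
proof -
  have "inj P" using pd_linear linear_injective_0[of P] pd_pos by (metis inner_zero_left less_irrefl)
  then show ?thesis using pd_linear linear_injective_imp_surjective by (auto simp: bij_def)
qed

lemma pd_inv: "P (inv P v) = v" "inv P (P v) = v"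
  using pd_bij by (auto simp: bij_def surj_f_inv_f)

lemma pd_op_inv: "pd_op (inv P)"
proof -
  have lin: "linear (inv P)"
  proof (rule linearI)
    show "inv P (u + v) = inv P u + inv P v" for u v
      using linear_add[OF pd_linear, of "inv P u" "inv P v"] pd_inv by metis
    show "inv P (r *\<^sub>R u) = r *\<^sub>R inv P u" for r u
      using linear_cmul[OF pd_linear, of r "inv P u"] pd_inv by metis
  qed
  have sym: "inv P u \<bullet> v = inv P v \<bullet> u" for u v
    using pd_sym[of "inv P u" "inv P v"] by (simp add: pd_inv inner_commute)
  have pos: "0 < inv P u \<bullet> u" if "u \<noteq> 0" for u
  proof -
    have "inv P u \<noteq> 0" using that pd_linear by (metis pd_inv(1) linear_0)
    then show ?thesis using pd_pos[of "inv P u"] by (simp add: pd_inv inner_commute)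
  qed
  show ?thesis using lin sym pos by (simp add: pd_op_def)
qed

lemma op_norm_sq: "(op_norm P u)\<^sup>2 = P u \<bullet> u" and op_norm_nonneg: "0 \<le> op_norm P u"
  using pd_nonneg by (simp_all add: op_norm_def)

lemma op_norm_pos: "u \<noteq> 0 \<Longrightarrow> 0 < op_norm P u"
  using pd_pos by (simp add: op_norm_def)

lemma op_norm_scale: "op_norm P (r *\<^sub>R u) = \<bar>r\<bar> * op_norm P u"
  using pd_linear by (simp add: op_norm_def linear_cmul real_sqrt_mult flip: mult.assoc)

lemma op_norm_minus: "op_norm P (- u) = op_norm P u"
  using op_norm_scale[of "-1" u] by simp

lemma op_norm_minus_commute: "op_norm P (u - v) = op_norm P (v - u)"
  using op_norm_minus[of "u - v"] by simp

lemma pd_expand: "P (u + r *\<^sub>R v) \<bullet> (u + r *\<^sub>R v) = P u \<bullet> u + 2 * r * (P u \<bullet> v) + r\<^sup>2 * (P v \<bullet> v)"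
  using pd_sym[of v u] pd_linear
  by (simp add: linear_add linear_cmul inner_add_left inner_add_right power2_eq_square algebra_simps)

lemma pd_Cauchy_Schwarz: "\<bar>P u \<bullet> v\<bar> \<le> op_norm P u * op_norm P v"
proof (cases "v = 0")
  case False
  then have v: "0 < P v \<bullet> v" by (rule pd_pos)
  have "0 \<le> P (u + (- (P u \<bullet> v) / (P v \<bullet> v)) *\<^sub>R v) \<bullet> (u + (- (P u \<bullet> v) / (P v \<bullet> v)) *\<^sub>R v)"
    by (rule pd_nonneg)
  also have "\<dots> = P u \<bullet> u - (P u \<bullet> v)\<^sup>2 / (P v \<bullet> v)"
    unfolding pd_expand using v by (simp add: power2_eq_square field_simps)
  finally have "(P u \<bullet> v)\<^sup>2 \<le> (P u \<bullet> u) * (P v \<bullet> v)" using v by (simp add: field_simps)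
  then have "sqrt ((P u \<bullet> v)\<^sup>2) \<le> sqrt ((P u \<bullet> u) * (P v \<bullet> v))" by (rule real_sqrt_le_mono)
  then show ?thesis by (simp add: op_norm_def real_sqrt_mult)
qed (simp add: op_norm_def)

lemma op_norm_triangle: "op_norm P (u + v) \<le> op_norm P u + op_norm P v"
proof (rule power2_le_imp_le)
  have "(op_norm P (u + v))\<^sup>2 = (op_norm P u)\<^sup>2 + 2 * (P u \<bullet> v) + (op_norm P v)\<^sup>2"
    using pd_expand[of u 1 v] by (simp add: op_norm_sq)
  also have "\<dots> \<le> (op_norm P u + op_norm P v)\<^sup>2"
    using pd_Cauchy_Schwarz[of u v] by (simp add: power2_sum)
  finally show "(op_norm P (u + v))\<^sup>2 \<le> (op_norm P u + op_norm P v)\<^sup>2" .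
qed (simp add: op_norm_nonneg)

lemma continuous_on_op_norm [continuous_intros]:
  fixes k :: "'b::topological_space \<Rightarrow> 'a"
  assumes "continuous_on S k"
  shows "continuous_on S (\<lambda>x. op_norm P (k x))"
proof -
  have "continuous_on S (\<lambda>x. P (k x))"
    using linear_continuous_on[OF linear_conv_bounded_linear[THEN iffD1, OF pd_linear], of UNIV]
      continuous_on_compose2[OF _ assms] by blast
  then show ?thesis unfolding op_norm_def using assms by (intro continuous_intros)
qed

end

lemma op_dual_norm_eq: "op_dual_norm P = op_norm (inv P)"
  by (rule ext) (simp add: op_dual_norm_def op_norm_def)

context
  fixes P :: "'a::euclidean_space \<Rightarrow> 'a"
  assumes P: "pd_op P"
begin

lemma op_norm_inv: "op_norm P (inv P v) = op_dual_norm P v"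
  by (simp add: op_norm_def op_dual_norm_def inner_commute pd_inv[OF P])

lemma dual_pairing_le: "\<bar>v \<bullet> u\<bar> \<le> op_dual_norm P v * op_norm P u"
  using pd_Cauchy_Schwarz[OF P, of "inv P v" u] by (simp add: op_norm_inv pd_inv[OF P])

text \<open>With \<open>dual_pairing_le\<close> this characterizes the dual norm as the least constant in the
  pairing inequality. Dual norms at different points are compared through it, by testing with
  vectors, without ever comparing inverse operators.\<close>

lemma op_dual_norm_leI:
  assumes "\<And>u. \<bar>v \<bullet> u\<bar> \<le> C * op_norm P u" "0 \<le> C"
  shows "op_dual_norm P v \<le> C"
proof -
  have "(op_dual_norm P v)\<^sup>2 = v \<bullet> inv P v"
    using op_norm_sq[OF pd_op_inv[OF P]] by (simp add: op_dual_norm_eq inner_commute)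
  also have "\<dots> \<le> C * op_dual_norm P v" using assms(1)[of "inv P v"] by (simp add: op_norm_inv)
  finally have "op_dual_norm P v * op_dual_norm P v \<le> C * op_dual_norm P v"
    by (simp add: power2_eq_square)
  moreover have "0 \<le> op_dual_norm P v"
    using op_norm_nonneg[OF pd_op_inv[OF P]] by (simp add: op_dual_norm_eq)
  ultimately show ?thesis using assms(2)
    by (metis mult_right_le_imp_le order_le_less)
qed

lemma norm_le_op_norm: obtains C where "0 < C" "\<And>u. norm u \<le> C * op_norm P u"
proof -
  obtain B where B: "0 < B" "\<And>u. norm (inv P u) \<le> B * norm u"
    using pd_linear[OF pd_op_inv[OF P]] linear_bounded_pos by blast
  have "norm u \<le> sqrt B * op_norm P u" for u
  proof (cases "u = 0")
    case False
    have "inv P u \<bullet> u \<le> B * (norm u)\<^sup>2"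
      using norm_cauchy_schwarz[of "inv P u" u] mult_right_mono[OF B(2), of "norm u" u]
      by (simp add: power2_eq_square mult.assoc)
    then have "op_dual_norm P u \<le> sqrt (B * (norm u)\<^sup>2)"
      unfolding op_dual_norm_def by (rule real_sqrt_le_mono)
    then have "op_dual_norm P u \<le> sqrt B * norm u" by (simp add: real_sqrt_mult)
    then have "norm u * norm u \<le> sqrt B * norm u * op_norm P u"
      using dual_pairing_le[of u u] mult_right_mono[of "op_dual_norm P u" "sqrt B * norm u" "op_norm P u"]
        op_norm_nonneg[OF P, of u]
      by (simp add: power2_eq_square flip: power2_norm_eq_inner)
    then show ?thesis using False by (simp add: mult.assoc mult.left_commute[of "sqrt B"])
  qed (simp add: op_norm_nonneg[OF P] B less_imp_le)
  then show ?thesis using that[of "sqrt B"] B(1) real_sqrt_gt_zero by blast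
qed

lemma op_norm_ball_bounded: "bounded {u. op_norm P (u - v) \<le> r}"
proof -
  obtain C where C: "0 < C" "\<And>u. norm u \<le> C * op_norm P u" using norm_le_op_norm by metis
  have "norm u \<le> C * r + norm v" if "op_norm P (u - v) \<le> r" for u
    using C(2)[of "u - v"] norm_triangle_ineq2[of u v] mult_left_mono[OF that, of C] C(1) by linarith
  then show ?thesis unfolding bounded_iff mem_Collect_eq by blast
qed

text \<open>Applied to the inverse Hessian, this makes the projection in the definition of the scheme
  a genuine one, and it makes local distances to subdifferentials attained.\<close>

lemma op_norm_projection_exists:
  assumes "closed S" "S \<noteq> {}"
  obtains p where "p \<in> S" "\<And>z. z \<in> S \<Longrightarrow> op_norm P (v - p) \<le> op_norm P (v - z)"
proof -
  obtain s0 where s0: "s0 \<in> S" using assms by auto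
  have cont: "continuous_on T (\<lambda>z. op_norm P (v - z))" for T
    by (intro continuous_on_op_norm[OF P] continuous_intros)
  have "closed {z\<in>S. op_norm P (v - z) \<le> op_norm P (v - s0)}"
    unfolding Collect_conj_eq Collect_mem_eq
    using assms(1) cont by (intro closed_Int closed_Collect_le continuous_on_const) auto
  moreover have "bounded {z\<in>S. op_norm P (v - z) \<le> op_norm P (v - s0)}"
    by (rule bounded_subset[OF op_norm_ball_bounded[of v "op_norm P (v - s0)"]])
      (auto simp: op_norm_minus_commute[OF P, of v])
  ultimately show ?thesis using attains_min_of_bounded_sublevel[OF s0 _ _ cont] that by blast
qed

end

section \<open>Symmetric trilinear forms\<close>

text \<open>The first-order condition at a maximum, for a function dominated by a parabola: it
  replaces differentiation in the next proof.\<close>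

lemma first_order_condition:
  fixes a b :: real
  assumes "\<And>t. a * t \<le> b * t\<^sup>2"
  shows "a = 0"
proof (rule ccontr)
  assume a: "a \<noteq> 0"
  define t where "t = a / (\<bar>b\<bar> + 1)"
  have "a * t \<le> \<bar>b\<bar> * t\<^sup>2" using assms[of t] by (meson abs_ge_self mult_right_mono order_trans zero_le_power2)
  moreover have "a = (\<bar>b\<bar> + 1) * t" by (simp add: t_def)
  then have "a * t = (\<bar>b\<bar> + 1) * t\<^sup>2" by (simp add: power2_eq_square)
  moreover have "0 < t\<^sup>2" using a by (simp add: t_def add_nonneg_eq_0_iff)
  ultimately show False by (simp add: algebra_simps)
qed

text \<open>Banach's theorem for cubic forms: on the unit sphere of an inner product, the supremum of
  \<open>T d u u\<close> is attained on the diagonal. Among the maximizers \<open>(d, u)\<close> of \<open>T d u u\<close> take one whose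
  inner product \<open>k\<close> is largest. Stationarity in each argument shows that \<open>u\<close>, paired with the
  normalized sum of \<open>d\<close> and \<open>u\<close>, is a maximizer as well, of inner product
  \<open>sqrt ((1 + k) / 2)\<close>. Maximality of \<open>k\<close> forces \<open>k = 1\<close>, so \<open>d = u\<close>.\<close>

lemma trilinear_bound_of_diagonal:
  fixes T :: "'a::euclidean_space \<Rightarrow> 'a \<Rightarrow> 'a \<Rightarrow> real"
  assumes P: "pd_op P"
    and lin: "\<And>d u. linear (T d u)"
    and sym: "\<And>d u v. T d u v = T u d v" "\<And>d u v. T d u v = T d v u"
    and cont: "continuous_on UNIV (\<lambda>z. T (fst z) (snd z) (snd z))"
    and diag: "\<And>v. \<bar>T v v v\<bar> \<le> M * (op_norm P v) ^ 3"
  shows "\<bar>T d u u\<bar> \<le> M * op_norm P d * (op_norm P u)\<^sup>2"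
proof (cases "d = 0 \<or> u = 0")
  case True
  have "T 0 u u = 0" "T d 0 0 = 0" for d u
    using linear_0[OF lin, of d 0] linear_0[OF lin, of u u] sym by metis+
  then show ?thesis using True by (auto simp: op_norm_def)
next
  case False
  let ?N = "op_norm P"
  note add = linear_add[OF lin] and scale = linear_cmul[OF lin]
  have add1: "T (a + b) u v = T a u v + T b u v" for a b u v using add sym by metis
  have add2: "T u (a + b) v = T u a v + T u b v" for a b u v using add sym by metis
  have sc1: "T (r *\<^sub>R a) u v = r * T a u v" for r a u v using scale[of u v r a] sym by (metis real_scaleR_def)
  have sc2: "T u (r *\<^sub>R a) v = r * T u a v" for r a u v using scale[of u v r a] sym by (metis real_scaleR_def)
  have sc3: "T u v (r *\<^sub>R a) = r * T u v a" for r a u v using scale[of u v r a] by simp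
  define U where "U = {v. ?N v = 1}"
  have contN: "continuous_on A ?N" for A
    using continuous_on_op_norm[OF P continuous_on_id] by simp
  have "closed U" unfolding U_def by (intro closed_Collect_eq contN continuous_on_const)
  moreover have "bounded U"
    by (rule bounded_subset[OF op_norm_ball_bounded[OF P, of 0 1]]) (auto simp: U_def)
  ultimately have cU: "compact U" by (simp add: compact_eq_bounded_closed)
  define n where "n v = (1 / ?N v) *\<^sub>R v" for v
  have nU: "n v \<in> U" if "v \<noteq> 0" for v
    using op_norm_pos[OF P that] by (simp add: U_def n_def op_norm_scale[OF P])
  have n: "v = ?N v *\<^sub>R n v" if "v \<noteq> 0" for v
    using op_norm_pos[OF P that] by (simp add: n_def)
  have mU: "- v \<in> U" if "v \<in> U" for v using that by (simp add: U_def op_norm_minus[OF P])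
  let ?\<Phi> = "\<lambda>z. T (fst z) (snd z) (snd z)"
  have "compact (U \<times> U)" "U \<times> U \<noteq> {}" using cU compact_Times nU False by auto
  moreover have contT: "continuous_on A ?\<Phi>" for A by (rule continuous_on_subset[OF cont]) simp
  ultimately obtain z0 where z0: "z0 \<in> U \<times> U" "\<And>z. z \<in> U \<times> U \<Longrightarrow> ?\<Phi> z \<le> ?\<Phi> z0"
    using continuous_attains_sup[of "U \<times> U" ?\<Phi>] by blast
  define m where "m = ?\<Phi> z0"
  have unit_le: "T a b b \<le> m" if "a \<in> U" "b \<in> U" for a b
    using z0(2)[of "(a, b)"] that by (simp add: m_def)
  have neg: "T (- a) b b = - T a b b" for a b using sc1[of "-1" a b b] by simp
  have m0: "0 \<le> m"
    using unit_le[of "fst z0" "snd z0"] unit_le[of "- fst z0" "snd z0"] mU z0(1) neg by auto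
  have le: "T a b b \<le> m * ?N a * (?N b)\<^sup>2" for a b
  proof (cases "a = 0 \<or> b = 0")
    case True
    then show ?thesis
      using m0 sc1[of 0 a b b] sc2[of a 0 b b] op_norm_nonneg[OF P, of a] by auto
  next
    case False
    have "T a b b = T (?N a *\<^sub>R n a) (?N b *\<^sub>R n b) (?N b *\<^sub>R n b)" using n False by metis
    also have "\<dots> = ?N a * (?N b)\<^sup>2 * T (n a) (n b) (n b)"
      by (simp add: sc1 sc2 sc3 power2_eq_square)
    also have "\<dots> \<le> ?N a * (?N b)\<^sup>2 * m"
      using nU False op_norm_nonneg[OF P] by (intro mult_left_mono unit_le) auto
    finally show ?thesis by (simp add: mult_ac)
  qed
  have abs_le: "\<bar>T a b b\<bar> \<le> m * ?N a * (?N b)\<^sup>2" for a b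
    using le[of a b] le[of "- a" b] by (simp add: neg op_norm_minus[OF P])
  define C where "C = {z \<in> U \<times> U. ?\<Phi> z = m}"
  have "closed C" unfolding C_def Collect_conj_eq Collect_mem_eq
    by (intro closed_Int closed_Collect_eq contT continuous_on_const compact_imp_closed compact_Times cU)
  then have "compact C"
    using compact_Int_closed[OF compact_Times[OF cU cU], of C] by (simp add: C_def Int_absorb1 subset_eq)
  moreover have "continuous_on C (\<lambda>z. P (fst z) \<bullet> snd z)"
  proof -
    have "continuous_on UNIV P" using pd_linear[OF P] by (simp add: linear_continuous_on linear_conv_bounded_linear)
    then have "continuous_on C (\<lambda>z. P (fst z))"
      by (rule continuous_on_compose2) (auto intro!: continuous_intros)
    then show ?thesis by (intro continuous_intros)
  qed
  moreover have "z0 \<in> C" using z0(1) by (simp add: C_def m_def)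
  then have "C \<noteq> {}" by blast
  ultimately obtain z where z: "z \<in> C" "\<And>z'. z' \<in> C \<Longrightarrow> P (fst z') \<bullet> snd z' \<le> P (fst z) \<bullet> snd z"
    using continuous_attains_sup[of C "\<lambda>z. P (fst z) \<bullet> snd z"] by blast
  obtain e v where ev: "z = (e, v)" by (cases z)
  define k where "k = P e \<bullet> v"
  have eU: "?N e = 1" "?N v = 1" and Tm: "T e v v = m" using z(1) by (auto simp: C_def U_def ev)
  have PU: "P e \<bullet> e = 1" "P v \<bullet> v = 1" using op_norm_sq[OF P] eU by (metis one_power2)+
  have maxk: "P a \<bullet> b \<le> k" if "a \<in> U" "b \<in> U" "T a b b = m" for a b
    using z(2)[of "(a, b)"] that by (simp add: C_def ev k_def)
  \<comment> \<open>The pair of e and - v is a maximizer as well.\<close>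
  have k0: "0 \<le> k"
  proof -
    have "T e (- v) (- v) = m" using sc2[of e "-1" v "-v"] sc3[of e v "-1" v] Tm by simp
    then have "P e \<bullet> (- v) \<le> k" using eU mU by (intro maxk) (auto simp: U_def)
    then show ?thesis by (simp add: k_def)
  qed
  \<comment> \<open>Stationarity of the maximizer in its second argument.\<close>
  have stat2: "T e v a = m * (P v \<bullet> a)" for a
  proof -
    have "2 * (T e v a - m * (P v \<bullet> a)) * t \<le> (m * (P a \<bullet> a) - T e a a) * t\<^sup>2" for t
    proof -
      have "T e (v + t *\<^sub>R a) (v + t *\<^sub>R a) = m + 2 * t * T e v a + t\<^sup>2 * T e a a"
        using sym(2)[of e a v]
        by (simp add: add add2 sc2 sc3 Tm power2_eq_square algebra_simps)
      moreover have "(?N (v + t *\<^sub>R a))\<^sup>2 = 1 + 2 * t * (P v \<bullet> a) + t\<^sup>2 * (P a \<bullet> a)"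
        unfolding op_norm_sq[OF P] pd_expand[OF P] PU ..
      ultimately show ?thesis using le[of e "v + t *\<^sub>R a"] eU by (simp add: algebra_simps)
    qed
    from first_order_condition[OF this] show ?thesis by simp
  qed
  \<comment> \<open>Stationarity of the maximizer in its first argument.\<close>
  have stat1: "T a v v = m * (P e \<bullet> a)" for a
  proof (cases "m = 0")
    case True
    then show ?thesis using abs_le[of a v] by simp
  next
    case False
    have "(2 * m * (T a v v - m * (P e \<bullet> a))) * t \<le> (m\<^sup>2 * (P a \<bullet> a) - (T a v v)\<^sup>2) * t\<^sup>2" for t
    proof -
      have "\<bar>T (e + t *\<^sub>R a) v v\<bar>\<^sup>2 \<le> (m * ?N (e + t *\<^sub>R a))\<^sup>2"
        using abs_le[of "e + t *\<^sub>R a" v] eU by (intro power_mono) auto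
      also have "\<dots> = m\<^sup>2 * (1 + 2 * t * (P e \<bullet> a) + t\<^sup>2 * (P a \<bullet> a))"
        unfolding power_mult_distrib op_norm_sq[OF P] pd_expand[OF P] PU ..
      finally show ?thesis by (simp add: add1 sc1 Tm power2_eq_square algebra_simps)
    qed
    from first_order_condition[OF this] show ?thesis using False by simp
  qed
  define w where "w = e + v"
  have Nw: "(?N w)\<^sup>2 = 2 + 2 * k"
    using pd_expand[OF P, of e 1 v] by (simp add: op_norm_sq[OF P] w_def PU k_def)
  have w0: "w \<noteq> 0" using Nw k0 by (auto simp: op_norm_def)
  have Nwp: "0 < ?N w" using w0 by (rule op_norm_pos[OF P])
  have k': "P v \<bullet> e = k" using pd_sym[OF P, of v e] by (simp add: k_def)
  have "T v w w = T v e e + 2 * T v e v + T v v v"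
    using sym(2)[of v v e] by (simp add: w_def add add2)
  also have "\<dots> = m * (?N w)\<^sup>2"
    using stat2[of e] stat1[of v] sym(1)[of v e e] sym(1)[of v e v] Tm k'
    unfolding Nw by (simp add: k_def algebra_simps)
  finally have "T v (n w) (n w) = m"
    using Nwp by (simp add: n_def sc2 sc3 power2_eq_square field_simps)
  then have "P v \<bullet> n w \<le> k" using nU[OF w0] eU by (intro maxk) (auto simp: U_def)
  moreover have "P v \<bullet> n w = (k + 1) / ?N w"
    by (simp add: n_def w_def inner_add_right k' PU)
  ultimately have "k + 1 \<le> k * ?N w" using Nwp by (simp add: field_simps)
  then have "(k + 1)\<^sup>2 \<le> (k * ?N w)\<^sup>2" using k0 by (intro power_mono) auto
  then have "(k + 1) * (k + 1) \<le> (2 * k\<^sup>2) * (k + 1)"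
    unfolding power_mult_distrib Nw by (simp add: power2_eq_square algebra_simps)
  then have "k + 1 \<le> 2 * k\<^sup>2" using k0 by (subst (asm) mult_le_cancel_right) auto
  then have "0 \<le> (2 * k + 1) * (k - 1)" by (simp add: power2_eq_square algebra_simps)
  then have k1: "1 \<le> k" using k0 by (simp add: zero_le_mult_iff)
  have "P (e - v) \<bullet> (e - v) = 2 - 2 * k"
    using pd_expand[OF P, of e "-1" v] by (simp add: PU k_def)
  then have "\<not> 0 < P (e - v) \<bullet> (e - v)" using k1 by simp
  then have "e = v" using pd_pos[OF P, of "e - v"] by auto
  then have "m \<le> M" using diag[of v] Tm eU by simp
  then have "m * (?N d * (?N u)\<^sup>2) \<le> M * (?N d * (?N u)\<^sup>2)"
    using op_norm_nonneg[OF P] by (intro mult_right_mono) auto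
  then show ?thesis using abs_le[of d u] by (simp add: mult.assoc)
qed

section \<open>The constants of the scheme\<close>

text \<open>The bound on the local length of an inexact step.\<close>

definition step_radius :: "real \<Rightarrow> real \<Rightarrow> real" where
  "step_radius c \<beta> = \<delta>_bound c \<beta> + c * sqrt \<beta> / (1 + c * sqrt \<beta>)"

context
  fixes c \<beta> :: real
  assumes c: "0 < c" "c \<le> 1"
    and \<beta>: "0 < \<beta>" "\<beta> < 0.5 * (1 + 2 * c\<^sup>2 - sqrt (1 + 4 * c\<^sup>2))"
begin

text \<open>The assumed upper bound on \<open>\<beta>\<close> is \<open>p\<^sup>2\<close>, where \<open>p\<close> is the positive root of \<open>p + p\<^sup>2 = c\<^sup>2\<close>; the
  claim amounts to \<open>sqrt \<beta> + c * \<beta> < c\<close>.\<close>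

lemma beta_less: "\<beta> * (1 + c * sqrt \<beta>) < c * sqrt \<beta>"
proof -
  define p where "p = (sqrt (1 + 4 * c\<^sup>2) - 1) / 2"
  have S: "(sqrt (1 + 4 * c\<^sup>2))\<^sup>2 = 1 + 4 * c\<^sup>2" by simp
  have p2: "p\<^sup>2 = 0.5 * (1 + 2 * c\<^sup>2 - sqrt (1 + 4 * c\<^sup>2))"
    using S unfolding p_def power_divide power2_diff by simp
  have pc: "p + p\<^sup>2 = c\<^sup>2" unfolding p2 by (simp add: p_def field_simps)
  have "1 \<le> sqrt (1 + 4 * c\<^sup>2)" by simp
  then have p0: "0 \<le> p" by (simp add: p_def)
  have bp: "\<beta> < p\<^sup>2" using \<beta> p2 by simp
  then have "sqrt \<beta> < p" using p0 real_less_lsqrt \<beta>(1) by (metis less_eq_real_def)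
  moreover have "c * sqrt \<beta> \<le> 1 * sqrt \<beta>" using c \<beta> by (intro mult_right_mono) auto
  moreover have "c\<^sup>2 * \<beta> \<le> 1 * \<beta>" using c \<beta> by (intro mult_right_mono) (auto simp: power_le_one)
  ultimately have "c * sqrt \<beta> + c\<^sup>2 * \<beta> < c * c"
    using pc bp by (simp add: power2_eq_square)
  then have "c * (sqrt \<beta> + c * \<beta>) < c * c" by (simp add: power2_eq_square algebra_simps)
  then have "sqrt \<beta> + c * \<beta> < c" using c by simp
  then have "sqrt \<beta> * (sqrt \<beta> + c * \<beta>) < sqrt \<beta> * c" using \<beta> by simp
  moreover have "sqrt \<beta> * sqrt \<beta> = \<beta>" using \<beta> by simp
  ultimately show ?thesis by (simp add: algebra_simps)
qed

lemma beta_less_a: "\<beta> < c * sqrt \<beta>" and beta_less_1: "\<beta> < 1"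
proof -
  have "0 \<le> \<beta> * (c * sqrt \<beta>)" using c \<beta> by simp
  then show 1: "\<beta> < c * sqrt \<beta>" using beta_less by (simp add: distrib_left)
  have "c * sqrt \<beta> \<le> 1 * sqrt \<beta>" using c \<beta> by (intro mult_right_mono) auto
  moreover have "sqrt \<beta> * sqrt \<beta> = \<beta>" using \<beta> by simp
  ultimately have "sqrt \<beta> * sqrt \<beta> < 1 * sqrt \<beta>" using 1 by linarith
  then have "sqrt \<beta> < 1" using \<beta> by (subst (asm) mult_less_cancel_right) auto
  then show "\<beta> < 1" by simp
qed

text \<open>With \<open>a = c * sqrt \<beta>\<close> and \<open>D = (1 - c\<^sup>2) * \<beta> / ((1 + a)\<^sup>2 * M)\<close>, where \<open>M\<close> is the bracket in
  the definitions, one has \<open>\<delta>_bound c \<beta> = D / (1 + a)\<close>, \<open>step_radius = (D + a) / (1 + a)\<close> and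
  \<open>\<theta> c \<beta> = D / (1 - D) + ((D + a) / (1 - D))\<^sup>2\<close>. Since \<open>a\<^sup>2 = c\<^sup>2 * \<beta>\<close>, the inequality
  \<open>\<theta> c \<beta> \<le> \<beta>\<close> follows from \<open>1 + 2 * a + 2 * \<beta> \<le> (1 + a)\<^sup>2 * M\<close>, and this from \<open>\<beta> < a\<close>.\<close>

lemma theta_facts:
  shows step_radius_less_1: "step_radius c \<beta> < 1"
    and theta_step_radius: "\<theta> c \<beta> = \<delta>_bound c \<beta> / (1 - step_radius c \<beta>) + (step_radius c \<beta> / (1 - step_radius c \<beta>))\<^sup>2"
    and theta_le_beta: "\<theta> c \<beta> \<le> \<beta>"
    and delta_bound_nonneg: "0 \<le> \<delta>_bound c \<beta>"
proof -
  define a where "a = c * sqrt \<beta>"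
  define M where "M = 3 * c * sqrt \<beta> + a\<^sup>2 + (1 + a) ^ 3"
  define E where "E = (1 - c\<^sup>2) * \<beta>"
  define D where "D = E / ((1 + a)\<^sup>2 * M)"
  have a2: "a\<^sup>2 = c\<^sup>2 * \<beta>" using \<beta> by (simp add: a_def power_mult_distrib)
  have a0: "0 < a" using c \<beta> by (simp add: a_def)
  have c2: "c\<^sup>2 \<le> 1" using c by (simp add: power_le_one)
  have E0: "0 \<le> E" using c2 \<beta> by (simp add: E_def)
  have "E \<le> 1 * \<beta>" unfolding E_def using \<beta> by (intro mult_right_mono) auto
  then have E1: "E < 1" using beta_less_1 by linarith
  have M1: "1 + 6 * a \<le> M" proof -
    have "M = 3 * a + a\<^sup>2 + (1 + a) ^ 3" by (simp add: M_def a_def)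
    then show ?thesis using a0 by (simp add: power3_eq_cube power2_eq_square algebra_simps)
  qed
  have aM: "1 + 2 * a + 2 * \<beta> \<le> (1 + a)\<^sup>2 * M"
  proof -
    have "1 + 2 * a + 2 * \<beta> \<le> 1 * (1 + 6 * a)" using beta_less_a a0 by (simp add: a_def)
    also have "\<dots> \<le> (1 + a)\<^sup>2 * M" using M1 a0 by (intro mult_mono) (auto simp: one_le_power)
    finally show ?thesis .
  qed
  have aM1: "1 \<le> (1 + a)\<^sup>2 * M" using aM a0 \<beta> by simp
  have M0: "0 < M" using M1 a0 by simp
  have D0: "0 \<le> D" using E0 M0 by (simp add: D_def)
  have DE: "D \<le> E" using E0 aM1 unfolding D_def by (simp add: divide_le_eq mult_le_cancel_left1)
  then have D1: "D < 1" using E1 by simp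
  have \<delta>: "\<delta>_bound c \<beta> = D / (1 + a)"
    unfolding \<delta>_bound_def a2[symmetric] a_def[symmetric] M_def[symmetric] E_def[symmetric] D_def
    using a0 M0 by (simp add: power3_eq_cube power2_eq_square mult_ac)
  have r: "step_radius c \<beta> = (D + a) / (1 + a)"
    unfolding step_radius_def \<delta> a_def[symmetric] by (simp add: add_divide_distrib)
  have r1: "1 - step_radius c \<beta> = (1 - D) / (1 + a)" using a0 by (simp add: r field_simps)
  show "step_radius c \<beta> < 1" using D1 a0 by (simp add: r)
  show "0 \<le> \<delta>_bound c \<beta>" using D0 a0 by (simp add: \<delta>)
  have "E = D * ((1 + a)\<^sup>2 * M)" using a0 M0 by (simp add: D_def)
  then have \<theta>: "\<theta> c \<beta> = D / (1 - D) + ((D + a) / (1 - D))\<^sup>2"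
    unfolding \<theta>_def a2[symmetric] a_def[symmetric] M_def[symmetric] E_def[symmetric]
  proof -
    assume E: "E = D * ((1 + a)\<^sup>2 * M)"
    let ?X = "(1 + a)\<^sup>2 * M"
    have X: "?X \<noteq> 0" using aM1 by linarith
    have 1: "E / (?X - E) = D / (1 - D)"
      unfolding E using nonzero_mult_divide_mult_cancel_left[OF X, of D "1 - D"] by (simp add: algebra_simps)
    have 2: "(E + a * (1 + a)\<^sup>2 * M) / (?X - E) = (D + a) / (1 - D)"
      unfolding E using nonzero_mult_divide_mult_cancel_left[OF X, of "D + a" "1 - D"] by (simp add: algebra_simps)
    show "E / (?X - E) + ((E + a * (1 + a)\<^sup>2 * M) / (?X - E))\<^sup>2 = D / (1 - D) + ((D + a) / (1 - D))\<^sup>2"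
      unfolding 1 2 ..
  qed
  show "\<theta> c \<beta> = \<delta>_bound c \<beta> / (1 - step_radius c \<beta>) + (step_radius c \<beta> / (1 - step_radius c \<beta>))\<^sup>2"
    unfolding r1 unfolding \<theta> \<delta> r using a0 by simp
  have "D * (1 + 2 * a + 2 * \<beta>) \<le> E"
    using mult_left_mono[OF aM D0] M0 a0 by (simp add: D_def)
  moreover have "E + a\<^sup>2 = \<beta>" by (simp add: E_def a2 algebra_simps)
  ultimately have "D * (1 - D) + (D + a)\<^sup>2 \<le> \<beta> * (1 - D)\<^sup>2"
  proof -
    assume 1: "D * (1 + 2 * a + 2 * \<beta>) \<le> E" and 2: "E + a\<^sup>2 = \<beta>"
    have "0 \<le> \<beta> * D\<^sup>2" using \<beta> by simp
    then show ?thesis using 1 2 by (simp add: power2_eq_square algebra_simps)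
  qed
  then have "(D * (1 - D) + (D + a)\<^sup>2) / (1 - D)\<^sup>2 \<le> \<beta>" using D1 by (simp add: divide_le_eq)
  moreover have "\<theta> c \<beta> = (D * (1 - D) + (D + a)\<^sup>2) / (1 - D)\<^sup>2"
  proof -
    have "D / (1 - D) = D * (1 - D) / (1 - D)\<^sup>2" using D1 by (simp add: power2_eq_square)
    then show ?thesis unfolding \<theta> power_divide by (simp only: add_divide_distrib)
  qed
  ultimately show "\<theta> c \<beta> \<le> \<beta>" by simp
qed

text \<open>The bound on \<open>\<sigma>\<close> is the solution of the second inequality with equality.\<close>

lemma sigma_bound_step:
  assumes \<nu>: "1 \<le> \<nu>" and \<sigma>: "0 < \<sigma>" "\<sigma> \<le> \<sigma>_bound \<nu> c \<beta>"
  shows "\<sigma> < 1" "\<beta> + \<sigma> / (1 - \<sigma>) * (sqrt \<nu> + \<beta>) \<le> c * sqrt \<beta> / (1 + c * sqrt \<beta>)"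
proof -
  define a where "a = c * sqrt \<beta>"
  have a0: "0 < a" using c \<beta> by (simp add: a_def)
  have n1: "1 \<le> sqrt \<nu>" using \<nu> by simp
  define X where "X = (1 + a) * sqrt \<nu> + a"
  have X: "0 < X" using a0 n1 by (simp add: X_def add_pos_pos)
  have "\<sigma> * X \<le> a - \<beta> * (1 + a)"
    using \<sigma>(2) X unfolding \<sigma>_bound_def a_def[symmetric] X_def[symmetric] by (simp add: le_divide_eq)
  then have key: "\<sigma> * ((1 + a) * (sqrt \<nu> + \<beta>)) \<le> (a - \<beta> * (1 + a)) * (1 - \<sigma>)"
    by (simp add: X_def algebra_simps)
  have "0 < \<beta> * (1 + a)" "0 < (1 + a) * sqrt \<nu>" using \<beta> a0 n1 by auto
  then have "\<sigma> * X < 1 * X" using \<open>\<sigma> * X \<le> a - \<beta> * (1 + a)\<close>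
    unfolding X_def by argo
  then show s1: "\<sigma> < 1" using X by (subst (asm) mult_less_cancel_right) auto
  have "\<sigma> * ((1 + a) * (sqrt \<nu> + \<beta>)) / (1 - \<sigma>) \<le> a - \<beta> * (1 + a)"
    using key s1 by (simp add: divide_le_eq)
  then have "\<sigma> / (1 - \<sigma>) * (sqrt \<nu> + \<beta>) * (1 + a) \<le> a - \<beta> * (1 + a)"
    by (simp add: mult_ac)
  then have "(\<beta> + \<sigma> / (1 - \<sigma>) * (sqrt \<nu> + \<beta>)) * (1 + a) \<le> a" by (simp add: algebra_simps)
  then show "\<beta> + \<sigma> / (1 - \<sigma>) * (sqrt \<nu> + \<beta>) \<le> c * sqrt \<beta> / (1 + c * sqrt \<beta>)"
    using a0 unfolding a_def[symmetric] by (simp add: le_divide_eq)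
qed

end

section \<open>One-dimensional facts on convex functions\<close>

lemma has_real_derivative_iff_scaled:
  "(p has_real_derivative c) (at t) \<longleftrightarrow> (p has_derivative (\<lambda>h. h * c)) (at t)"
  by (simp add: has_field_derivative_def mult_commute_abs)

lemma higher_deriv_of_derivatives:
  fixes p :: "real \<Rightarrow> real"
  assumes I: "open I" "t \<in> I"
    and p: "\<And>t. t \<in> I \<Longrightarrow> (p has_real_derivative p1 t) (at t)"
    and p1: "\<And>t. t \<in> I \<Longrightarrow> (p1 has_real_derivative p2 t) (at t)"
    and p2: "\<And>t. t \<in> I \<Longrightarrow> (p2 has_real_derivative p3 t) (at t)"
  shows "(deriv ^^ 2) p t = p2 t" "(deriv ^^ 3) p t = p3 t"
proof -
  have 1: "deriv p t = p1 t" if "t \<in> I" for t using p[OF that] by (rule DERIV_imp_deriv)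
  have 2: "deriv (deriv p) t = p2 t" if "t \<in> I" for t
    using has_field_derivative_transform_within_open[OF p1[OF that] I(1) that] 1
    by (intro DERIV_imp_deriv) auto
  have 3: "deriv (deriv (deriv p)) t = p3 t" if "t \<in> I" for t
    using has_field_derivative_transform_within_open[OF p2[OF that] I(1) that] 2
    by (intro DERIV_imp_deriv) auto
  show "(deriv ^^ 2) p t = p2 t" "(deriv ^^ 3) p t = p3 t"
    using 2[OF I(2)] 3[OF I(2)] by (simp_all add: eval_nat_numeral)
qed

text \<open>Needed to read \<open>powr (3 / 2)\<close> in the definition of self-concordance as
  \<open>h * sqrt h\<close>, which is its meaning for \<open>h \<ge> 0\<close> only.\<close>

lemma convex_on_second_derivative_nonneg:
  fixes p :: "real \<Rightarrow> real"
  assumes I: "open I" "convex I" "t \<in> I" and convex: "convex_on I p"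
    and p: "\<And>t. t \<in> I \<Longrightarrow> (p has_real_derivative p1 t) (at t)"
    and p1: "(p1 has_real_derivative p2) (at t)"
  shows "0 \<le> p2"
proof (rule ccontr)
  assume "\<not> 0 \<le> p2"
  then obtain d where d: "0 < d" "\<And>h. 0 < h \<Longrightarrow> h < d \<Longrightarrow> p1 (t + h) < p1 t"
    using DERIV_neg_dec_right[OF p1] by auto
  obtain e where e: "0 < e" "ball t e \<subseteq> I" using I by (meson openE)
  define h where "h = min d e / 2"
  have h: "0 < h" "h < d" "h < e" using d e by (auto simp: h_def)
  then have tI: "t + h \<in> I" using e by (auto simp: subset_iff dist_norm)
  have tangent: "p1 a * (b - a) \<le> p b - p a" if "a \<in> I" "b \<in> I" for a b
    using convex_on_imp_above_tangent[OF convex convex_connected[OF I(2)], of a b "p1 a"] that I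
      has_field_derivative_at_within[OF p[OF that(1)]] by (simp add: interior_open)
  have "p1 t * h \<le> p1 (t + h) * h" using tangent[OF I(3) tI] tangent[OF tI I(3)] by simp
  then show False using d(2)[OF h(1,2)] h(1) by simp
qed

text \<open>The self-concordance estimate bounds the second derivative on a ray from below by
  \<open>1 / (A + t)\<^sup>2\<close>. A function with such a second derivative that stays bounded above must decrease at
  least as fast as \<open>- ln (A + t)\<close>.\<close>

lemma no_bounded_log_ray:
  fixes p p1 h :: "real \<Rightarrow> real"
  assumes p: "\<And>t. 0 \<le> t \<Longrightarrow> (p has_real_derivative p1 t) (at t)"
    and p1: "\<And>t. 0 \<le> t \<Longrightarrow> (p1 has_real_derivative h t) (at t)"
    and A: "0 < A" and h: "\<And>t. 0 \<le> t \<Longrightarrow> 1 / (A + t)\<^sup>2 \<le> h t"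
    and bounded: "\<And>t. 0 \<le> t \<Longrightarrow> \<bar>p t\<bar> \<le> B"
  shows False
proof -
  have h0: "0 \<le> h t" if "0 \<le> t" for t using h[OF that] by (rule order_trans[rotated]) simp
  have mono1: "p1 s \<le> p1 t" if "0 \<le> s" "s \<le> t" for s t
  proof (rule DERIV_nonneg_imp_nondecreasing[OF that(2)])
    show "\<exists>y. (p1 has_real_derivative y) (at r) \<and> 0 \<le> y" if "s \<le> r" for r
      using p1[of r] h0[of r] that \<open>0 \<le> s\<close> by auto
  qed
  have B0: "0 \<le> B" using bounded[of 0] by simp
  \<comment> \<open>A convex function that is bounded above on a ray decreases along it.\<close>
  have neg: "p1 s \<le> 0" if s: "0 \<le> s" for s
  proof (rule ccontr)
    assume "\<not> p1 s \<le> 0"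
    then have pos: "0 < p1 s" by simp
    \<comment> \<open>Far enough for the slope at s to raise p by more than the bounds allow.\<close>
    define t where "t = s + (2 * B + 1) / p1 s"
    have st: "s < t" using pos B0 by (simp add: t_def)
    obtain z where z: "s < z" "z < t" "p t - p s = (t - s) * p1 z"
      using MVT2[OF st, of p p1] p s by auto
    have "2 * B + 1 = (t - s) * p1 s" using pos by (simp add: t_def)
    also have "\<dots> \<le> (t - s) * p1 z" using st z s mono1[of s z] by (intro mult_left_mono) auto
    finally show False using z bounded[of t] bounded[of s] s st by (simp add: abs_le_iff)
  qed
  \<comment> \<open>Its slope tends to a limit that is at most 0, so the slope lies below -1/(A+t).\<close>
  have slope: "p1 s \<le> - (1 / (A + s))" if s: "0 \<le> s" for s
  proof -
    have "p1 s + 1 / (A + s) \<le> 1 / (A + t)" if t: "s \<le> t" for t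
    proof -
      have "p1 s + 1 / (A + s) \<le> p1 t + 1 / (A + t)"
      proof (rule DERIV_nonneg_imp_nondecreasing[OF t])
        fix r assume r: "s \<le> r" "r \<le> t"
        have "((\<lambda>t. p1 t + 1 / (A + t)) has_real_derivative h r - 1 / (A + r)\<^sup>2) (at r)"
          using A s r by (auto intro!: derivative_eq_intros p1 simp: power2_eq_square)
        then show "\<exists>y. ((\<lambda>t. p1 t + 1 / (A + t)) has_real_derivative y) (at r) \<and> 0 \<le> y"
          using h[of r] r s by auto
      qed
      then show ?thesis using neg[of t] s t by linarith
    qed
    moreover have "((\<lambda>t. 1 / (A + t)) \<longlongrightarrow> 0) at_top"
      by (intro tendsto_divide_0[OF tendsto_const] filterlim_at_top_imp_at_infinity
          filterlim_tendsto_add_at_top[OF tendsto_const] filterlim_ident)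
    ultimately have "p1 s + 1 / (A + s) \<le> 0"
      using tendsto_lowerbound[of "\<lambda>t. 1 / (A + t)" 0 at_top "p1 s + 1 / (A + s)"]
        eventually_ge_at_top[of s] eventually_mono by (metis (no_types, lifting) trivial_limit_at_top_linorder)
    then show ?thesis by simp
  qed
  have log: "p t + ln (A + t) \<le> p 0 + ln (A + 0)" if t: "0 \<le> t" for t
  proof (rule DERIV_nonpos_imp_nonincreasing[OF t])
    fix r assume r: "0 \<le> r" "r \<le> t"
    have "((\<lambda>t. p t + ln (A + t)) has_real_derivative p1 r + 1 / (A + r)) (at r)"
      using A r by (auto intro!: derivative_eq_intros p)
    then show "\<exists>y. ((\<lambda>t. p t + ln (A + t)) has_real_derivative y) (at r) \<and> y \<le> 0"
      using slope[of r] r by (intro exI[of _ "p1 r + 1 / (A + r)"]) auto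
  qed
  define t where "t = exp (2 * B + \<bar>ln A\<bar> + 1)"
  have t: "0 < t" by (simp add: t_def)
  have "2 * B + \<bar>ln A\<bar> + 1 = ln t" by (simp add: t_def)
  also have "\<dots> \<le> ln (A + t)" using A t by simp
  finally show False using log[of t] bounded[of t] bounded[of 0] t by (simp add: abs_le_iff) linarith
qed

lemma open_line_preimage:
  fixes x v :: "'a::real_normed_vector"
  assumes "open S" shows "open {t. x + t *\<^sub>R v \<in> S}"
proof -
  have "continuous_on UNIV (\<lambda>t. x + t *\<^sub>R v)" by (intro continuous_intros)
  then show ?thesis using open_vimage[OF assms, of "\<lambda>t. x + t *\<^sub>R v"] by (simp add: vimage_def)
qed

section \<open>Logarithmically homogeneous barriers of a cone\<close>

text \<open>A barrier with its derivatives made explicit: \<open>G\<close> is the gradient, \<open>H\<close> the Hessian as an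
  operator, and \<open>T x h\<close> the derivative of \<open>H\<close> at \<open>x\<close> in direction \<open>h\<close>, so that the third derivative
  is \<open>T x h u \<bullet> v\<close>. The real-valued \<open>F\<close> carries meaning on the interior of \<open>K\<close> only.\<close>

locale cone_barrier =
  fixes K :: "'a::euclidean_space set" and F :: "'a \<Rightarrow> real" and \<nu> :: real
    and G :: "'a \<Rightarrow> 'a" and H :: "'a \<Rightarrow> 'a \<Rightarrow>\<^sub>L 'a" and T :: "'a \<Rightarrow> 'a \<Rightarrow> 'a \<Rightarrow>\<^sub>L 'a"
  assumes K: "closed K" "convex K" "cone K" "\<And>v. v \<in> K \<Longrightarrow> - v \<in> K \<Longrightarrow> v = 0" "interior K \<noteq> {}"
    and F_deriv: "\<And>x. x \<in> interior K \<Longrightarrow> (F has_derivative (\<lambda>h. G x \<bullet> h)) (at x)"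
    and G_deriv: "\<And>x. x \<in> interior K \<Longrightarrow> (G has_derivative blinfun_apply (H x)) (at x)"
    and H_deriv: "\<And>x. x \<in> interior K \<Longrightarrow> (H has_derivative T x) (at x)"
    and above_tangent: "\<And>x z. x \<in> interior K \<Longrightarrow> z \<in> interior K \<Longrightarrow> F x + G x \<bullet> (z - x) \<le> F z"
    and H_nonneg: "\<And>x v. x \<in> interior K \<Longrightarrow> 0 \<le> H x v \<bullet> v"
    and self_concordant: "\<And>x v. x \<in> interior K \<Longrightarrow>
          \<bar>T x v v \<bullet> v\<bar> \<le> 2 * ((H x v \<bullet> v) * sqrt (H x v \<bullet> v))"
    and barrier: "\<And>z. z \<in> frontier K \<Longrightarrow> filterlim F at_top (at z within interior K)"
    and scale_interior: "\<And>x r. x \<in> interior K \<Longrightarrow> 0 < r \<Longrightarrow> r *\<^sub>R x \<in> interior K"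
    and homogeneous: "\<And>x r. x \<in> interior K \<Longrightarrow> 0 < r \<Longrightarrow> F (r *\<^sub>R x) = F x - \<nu> * ln r"

definition riesz :: "('a::euclidean_space \<Rightarrow>\<^sub>L real) \<Rightarrow> 'a" where
  "riesz l = (\<Sum>b\<in>Basis. blinfun_apply l b *\<^sub>R b)"

lemma riesz_inner: "riesz l \<bullet> h = blinfun_apply l h"
proof -
  have "blinfun_apply l h = blinfun_apply l (\<Sum>b\<in>Basis. (h \<bullet> b) *\<^sub>R b)" by (simp add: euclidean_representation)
  also have "\<dots> = (\<Sum>b\<in>Basis. (h \<bullet> b) * blinfun_apply l b)" by (simp add: blinfun.sum_right blinfun.scaleR_right)
  finally show ?thesis by (simp add: riesz_def inner_sum_left inner_commute[of h] mult.commute)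
qed

lemma bounded_linear_riesz: "bounded_linear riesz"
  unfolding riesz_def
  by (intro bounded_linear_sum bounded_linear_compose[OF bounded_linear_scaleR_left] bounded_linear_apply_blinfun)

lemma gderiv_grad:
  assumes "((\<lambda>z. real_of_ereal (F z)) has_derivative (\<lambda>h. D \<bullet> h)) (at x)"
  shows "grad F x = D"
  unfolding grad_def gderiv_def
proof (rule the_equality)
  show "((\<lambda>z. real_of_ereal (F z)) has_derivative (\<lambda>h. h \<bullet> D)) (at x)"
    using assms by (simp add: inner_commute)
  fix D' assume "((\<lambda>z. real_of_ereal (F z)) has_derivative (\<lambda>h. h \<bullet> D')) (at x)"
  then have "(\<lambda>h. h \<bullet> D') = (\<lambda>h. D \<bullet> h)" using assms has_derivative_unique by blast
  then show "D' = D" by (metis inner_commute vector_eq_rdot)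
qed

text \<open>The derivatives supplied by the smoothness assumption are linear functionals; the Riesz map
  turns them into a gradient and operators, and restricting to lines translates the
  one-dimensional conditions into conditions on \<open>G\<close>, \<open>H\<close> and \<open>T\<close>.\<close>

lemma cone_barrierI:
  fixes K :: "'a::euclidean_space set" and f :: "'a \<Rightarrow> ereal"
  assumes K: "closed K" "convex K" "cone K" "\<And>v. v \<in> K \<Longrightarrow> - v \<in> K \<Longrightarrow> v = 0" "interior K \<noteq> {}"
    and f: "self_concordant_barrier \<nu> K f" "log_homogeneous \<nu> f"
  obtains H T where "cone_barrier K (\<lambda>x. real_of_ereal (f x)) \<nu> (grad f) H T"
    "\<And>x. x \<in> interior K \<Longrightarrow> hess f x = blinfun_apply (H x)"
proof -
  let ?F = "\<lambda>x. real_of_ereal (f x)" and ?S = "interior K"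
  have dom: "edom f = ?S" and nminf: "\<And>x. f x \<noteq> -\<infinity>" and sc: "std_self_concordant f"
    and bar: "\<And>z. z \<in> frontier K \<Longrightarrow> (f \<longlongrightarrow> \<infinity>) (at z within ?S)"
    using f(1) by (auto simp: self_concordant_barrier_def)
  have fin: "f x = ereal (?F x)" if "x \<in> ?S" for x
    using that nminf[of x] unfolding dom[symmetric] edom_def by (cases "f x") auto
  obtain D1 :: "'a \<Rightarrow> 'a \<Rightarrow>\<^sub>L real" and D2 :: "'a \<Rightarrow> 'a \<Rightarrow>\<^sub>L 'a \<Rightarrow>\<^sub>L real"
    and D3 :: "'a \<Rightarrow> 'a \<Rightarrow>\<^sub>L 'a \<Rightarrow>\<^sub>L 'a \<Rightarrow>\<^sub>L real" where D:
      "\<And>x. x \<in> ?S \<Longrightarrow> (?F has_derivative blinfun_apply (D1 x)) (at x)"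
      "\<And>x. x \<in> ?S \<Longrightarrow> (D1 has_derivative blinfun_apply (D2 x)) (at x)"
      "\<And>x. x \<in> ?S \<Longrightarrow> (D2 has_derivative blinfun_apply (D3 x)) (at x)"
    using sc unfolding std_self_concordant_def dom C3_on_def by blast
  define R where "R = Blinfun (riesz :: ('a \<Rightarrow>\<^sub>L real) \<Rightarrow> 'a)"
  have R: "blinfun_apply R = riesz" unfolding R_def using bounded_linear_riesz by (rule bounded_linear_Blinfun_apply)
  define G where "G x = riesz (D1 x)" for x
  define H where "H x = R o\<^sub>L D2 x" for x
  define T where "T x h = R o\<^sub>L blinfun_apply (D3 x) h" for x h
  have Fd: "(?F has_derivative (\<lambda>h. G x \<bullet> h)) (at x)" if "x \<in> ?S" for x
    using D(1)[OF that] by (simp add: G_def riesz_inner)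
  have Gd: "(G has_derivative blinfun_apply (H x)) (at x)" if "x \<in> ?S" for x
    using bounded_linear.has_derivative[OF bounded_linear_riesz D(2)[OF that]]
    by (simp add: G_def[abs_def] H_def R blinfun_apply_blinfun_compose[abs_def] o_def)
  have Hd: "(H has_derivative T x) (at x)" if "x \<in> ?S" for x
    using bounded_linear.has_derivative[OF bounded_bilinear.bounded_linear_right[OF bounded_bilinear_blinfun_compose] D(3)[OF that], of R]
    by (simp add: H_def[abs_def] T_def[abs_def])
  have grad: "grad f x = G x" if "x \<in> ?S" for x using gderiv_grad[OF Fd[OF that]] .
  have gradd: "(grad f has_derivative blinfun_apply (H x)) (at x)" if "x \<in> ?S" for x
    using has_derivative_transform_within_open[OF Gd[OF that] open_interior that] grad by metis
  have line: "F1 x + G x \<bullet> v \<le> F1 (x + v) \<or> x + v \<notin> ?S" "0 \<le> H x v \<bullet> v"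
    "\<bar>T x v v \<bullet> v\<bar> \<le> 2 * ((H x v \<bullet> v) * sqrt (H x v \<bullet> v))"
    if x: "x \<in> ?S" and F1: "F1 = ?F" for x v F1
  proof -
    define I where "I = {t. x + t *\<^sub>R v \<in> ?S}"
    define p where "p t = ?F (x + t *\<^sub>R v)" for t
    define p1 where "p1 t = G (x + t *\<^sub>R v) \<bullet> v" for t
    define p2 where "p2 t = H (x + t *\<^sub>R v) v \<bullet> v" for t
    define p3 where "p3 t = T (x + t *\<^sub>R v) v v \<bullet> v" for t
    have I: "open I" "0 \<in> I" using x open_line_preimage[OF open_interior] by (simp_all add: I_def)
    have line: "((\<lambda>t. x + t *\<^sub>R v) has_derivative (\<lambda>h. h *\<^sub>R v)) (at t)" for t
      by (auto intro!: derivative_eq_intros)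
    have p: "(p has_real_derivative p1 t) (at t)" if "t \<in> I" for t
      using has_derivative_compose[OF line Fd, of t] that
      by (simp add: I_def p_def[abs_def] p1_def has_real_derivative_iff_scaled)
    have p1: "(p1 has_real_derivative p2 t) (at t)" if "t \<in> I" for t
      using has_derivative_inner_left[OF has_derivative_compose[OF line Gd, of t], of v] that
      by (simp add: I_def p1_def[abs_def] p2_def has_real_derivative_iff_scaled blinfun.scaleR_right)
    have p2: "(p2 has_real_derivative p3 t) (at t)" if "t \<in> I" for t
    proof -
      have "linear (T (x + t *\<^sub>R v))" using Hd that unfolding I_def by (blast intro: has_derivative_linear)
      then show ?thesis
        using has_derivative_inner_left[OF bounded_linear.has_derivative[OF
            bounded_linear_apply_blinfun has_derivative_compose[OF line Hd, of t]], of v v] that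
        by (simp add: I_def p2_def[abs_def] p3_def has_real_derivative_iff_scaled linear_cmul
            blinfun.scaleR_left)
    qed
    have "std_self_concordant_line I p"
      using sc x unfolding std_self_concordant_def dom I_def p_def[abs_def] by blast
    then have conv: "convex_on I p" and b: "\<And>t. t \<in> I \<Longrightarrow> \<bar>(deriv ^^ 3) p t\<bar> \<le> 2 * (deriv ^^ 2) p t powr (3 / 2)"
      by (auto simp: std_self_concordant_line_def)
    have cI: "convex I" using conv by (simp add: convex_on_def)
    show nonneg: "0 \<le> H x v \<bullet> v"
      using convex_on_second_derivative_nonneg[OF I(1) cI I(2) conv p p1[OF I(2)]] by (simp add: p2_def)
    have "(H x v \<bullet> v) powr (3 / 2) = (H x v \<bullet> v) * sqrt (H x v \<bullet> v)"
      using nonneg powr_add[of "H x v \<bullet> v" 1 "1/2"] by (simp add: powr_half_sqrt)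
    then show "\<bar>T x v v \<bullet> v\<bar> \<le> 2 * ((H x v \<bullet> v) * sqrt (H x v \<bullet> v))"
      using b[OF I(2)] higher_deriv_of_derivatives[OF I p p1 p2] by (simp add: p2_def p3_def)
    show "F1 x + G x \<bullet> v \<le> F1 (x + v) \<or> x + v \<notin> ?S"
      using convex_on_imp_above_tangent[OF conv convex_connected[OF cI], of 0 1 "p1 0"] I
        has_field_derivative_at_within[OF p[OF I(2)]] unfolding F1
      by (auto simp: interior_open p1_def p_def I_def)
  qed
  have "cone_barrier K ?F \<nu> (grad f) H T"
  proof (unfold_locales; (fact K)?)
    fix x :: 'a assume x: "x \<in> ?S"
    show "(?F has_derivative (\<lambda>h. grad f x \<bullet> h)) (at x)" using Fd[OF x] grad[OF x] by simp
    show "(grad f has_derivative blinfun_apply (H x)) (at x)" by (rule gradd[OF x])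
    show "(H has_derivative T x) (at x)" by (rule Hd[OF x])
    show "?F x + grad f x \<bullet> (z - x) \<le> ?F z" if "z \<in> ?S" for z
      using line(1)[OF x refl, of "z - x"] that grad[OF x] by simp
    show "0 \<le> H x v \<bullet> v" "\<bar>T x v v \<bullet> v\<bar> \<le> 2 * ((H x v \<bullet> v) * sqrt (H x v \<bullet> v))" for v
      using line(2,3)[OF x refl] by auto
    fix r :: real assume r: "0 < r"
    have h: "f (r *\<^sub>R x) = f x - ereal (\<nu> * ln r)"
      using f(2) x r unfolding log_homogeneous_def dom by blast
    then have "f (r *\<^sub>R x) < \<infinity>" using fin[OF x] by (cases "f x") auto
    then show "r *\<^sub>R x \<in> ?S" unfolding dom[symmetric] edom_def by simp
    show "?F (r *\<^sub>R x) = ?F x - \<nu> * ln r" unfolding h using fin[OF x] by (cases "f x") auto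
  next
    fix z assume z: "z \<in> frontier K"
    show "filterlim ?F at_top (at z within ?S)" unfolding filterlim_at_top
    proof
      fix M
      have "eventually (\<lambda>x. ereal M < f x) (at z within ?S)"
        using bar[OF z] by (rule order_tendstoD) simp
      moreover have "eventually (\<lambda>x. x \<in> ?S) (at z within ?S)" by (simp add: eventually_at_filter)
      ultimately show "eventually (\<lambda>x. M \<le> ?F x) (at z within ?S)"
      proof eventually_elim
        case (elim x)
        then show ?case using fin[of x] by (metis ereal_less_eq(3) less_imp_le)
      qed
    qed
  qed
  moreover have "hess f x = blinfun_apply (H x)" if "x \<in> ?S" for x
    unfolding hess_def using frechet_derivative_at[OF gradd[OF that]] by simp
  ultimately show ?thesis by (rule that)
qed

context cone_barrier
begin

lemma H_symmetric: "x \<in> interior K \<Longrightarrow> H x u \<bullet> v = H x v \<bullet> u"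
proof -
  assume x: "x \<in> interior K"
  show ?thesis
    by (rule second_derivative_symmetric[where S = "interior K" and F = F and G = "\<lambda>z u. G z \<bullet> u"
          and B = "\<lambda>h u. H x h \<bullet> u", OF open_interior x])
      (auto intro: F_deriv has_derivative_inner_left G_deriv[OF x])
qed

lemma H_entry_deriv:
  assumes "x \<in> interior K"
  shows "((\<lambda>z. H z u \<bullet> v) has_derivative (\<lambda>h. T x h u \<bullet> v)) (at x)"
  by (intro has_derivative_inner_left bounded_linear.has_derivative[OF bounded_linear_apply_blinfun]
      H_deriv assms)

lemma T_symmetric:
  assumes x: "x \<in> interior K"
  shows "T x h u \<bullet> v = T x h v \<bullet> u" "T x h u \<bullet> v = T x u h \<bullet> v"
proof -
  have "((\<lambda>z. H z v \<bullet> u) has_derivative (\<lambda>h. T x h u \<bullet> v)) (at x)"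
    using has_derivative_transform_within_open[OF H_entry_deriv[OF x, of u v] open_interior x]
      H_symmetric by metis
  then have "(\<lambda>h. T x h u \<bullet> v) = (\<lambda>h. T x h v \<bullet> u)"
    using has_derivative_unique[OF _ H_entry_deriv[OF x, of v u]] by blast
  then show "T x h u \<bullet> v = T x h v \<bullet> u" by meson
  show "T x h u \<bullet> v = T x u h \<bullet> v"
    by (rule second_derivative_symmetric[where S = "interior K" and F = "\<lambda>z. G z \<bullet> v"
          and G = "\<lambda>z u. H z u \<bullet> v" and B = "\<lambda>h u. T x h u \<bullet> v", OF open_interior x])
      (auto intro: has_derivative_inner_left G_deriv H_entry_deriv[OF x])
qed

lemma line_deriv:
  assumes "x + t *\<^sub>R v \<in> interior K"
  shows "((\<lambda>t. F (x + t *\<^sub>R v)) has_real_derivative G (x + t *\<^sub>R v) \<bullet> v) (at t)"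
    "((\<lambda>t. G (x + t *\<^sub>R v) \<bullet> v) has_real_derivative H (x + t *\<^sub>R v) v \<bullet> v) (at t)"
    "((\<lambda>t. H (x + t *\<^sub>R v) v \<bullet> v) has_real_derivative T (x + t *\<^sub>R v) v v \<bullet> v) (at t)"
proof -
  have line: "((\<lambda>t. x + t *\<^sub>R v) has_derivative (\<lambda>h. h *\<^sub>R v)) (at t)"
    by (auto intro!: derivative_eq_intros)
  show "((\<lambda>t. F (x + t *\<^sub>R v)) has_real_derivative G (x + t *\<^sub>R v) \<bullet> v) (at t)"
    using has_derivative_compose[OF line F_deriv[OF assms]] by (simp add: has_real_derivative_iff_scaled)
  show "((\<lambda>t. G (x + t *\<^sub>R v) \<bullet> v) has_real_derivative H (x + t *\<^sub>R v) v \<bullet> v) (at t)"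
    using has_derivative_inner_left[OF has_derivative_compose[OF line G_deriv[OF assms]], of v]
    by (simp add: has_real_derivative_iff_scaled blinfun.scaleR_right)
  have "linear (T (x + t *\<^sub>R v))" using H_deriv[OF assms] by (rule has_derivative_linear)
  then show "((\<lambda>t. H (x + t *\<^sub>R v) v \<bullet> v) has_real_derivative T (x + t *\<^sub>R v) v v \<bullet> v) (at t)"
    using has_derivative_compose[OF line H_entry_deriv[OF assms, of v v]]
    by (simp add: has_real_derivative_iff_scaled linear_cmul blinfun.scaleR_left)
qed

lemma convex_line: "convex {t. x + t *\<^sub>R v \<in> interior K}"
proof (rule convexI, clarsimp)
  fix s t a b :: real assume st: "x + s *\<^sub>R v \<in> interior K" "x + t *\<^sub>R v \<in> interior K"
    and ab: "0 \<le> a" "0 \<le> b" "a + b = 1"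
  have "a *\<^sub>R (x + s *\<^sub>R v) + b *\<^sub>R (x + t *\<^sub>R v) \<in> interior K"
    using convexD[OF convex_interior[OF K(2)] st ab] .
  moreover have "a *\<^sub>R (x + s *\<^sub>R v) + b *\<^sub>R (x + t *\<^sub>R v) = (a + b) *\<^sub>R x + (a * s + b * t) *\<^sub>R v"
    by (simp add: algebra_simps)
  ultimately show "x + (a * s + b * t) *\<^sub>R v \<in> interior K" using ab by simp
qed

text \<open>Since \<open>F\<close> tends to infinity at the boundary of \<open>K\<close>, a limit of points of a sublevel set
  stays in the interior.\<close>

lemma closed_sublevel: "closed {z \<in> interior K. F z - w \<bullet> z \<le> C}"
  unfolding closed_sequential_limits
proof (intro allI impI)
  fix X l assume X: "(\<forall>n. X n \<in> {z \<in> interior K. F z - w \<bullet> z \<le> C}) \<and> X \<longlonglongrightarrow> l"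
  then have XS: "\<And>n. X n \<in> interior K" and XC: "\<And>n. F (X n) \<le> C + w \<bullet> X n" and lim: "X \<longlonglongrightarrow> l"
    by (auto simp: algebra_simps)
  have limw: "(\<lambda>n. C + w \<bullet> X n) \<longlonglongrightarrow> C + w \<bullet> l" by (intro tendsto_intros lim)
  have lK: "l \<in> K" using closed_sequentially[OF K(1) _ lim] XS interior_subset by blast
  have lS: "l \<in> interior K"
  proof (rule ccontr)
    assume l: "l \<notin> interior K"
    then have "l \<in> frontier K" using lK K(1) by (simp add: frontier_def)
    moreover have "filterlim X (at l within interior K) sequentially"
      unfolding filterlim_at using lim XS l by (metis (mono_tags, lifting) eventuallyI)
    ultimately have "filterlim (\<lambda>n. F (X n)) at_top sequentially"
      using filterlim_compose[OF barrier] by blast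
    then have "eventually (\<lambda>n. C + w \<bullet> l + 1 \<le> F (X n)) sequentially"
      by (simp add: filterlim_at_top)
    moreover have "eventually (\<lambda>n. C + w \<bullet> X n < C + w \<bullet> l + 1) sequentially"
      using limw by (rule order_tendstoD) simp
    ultimately have "eventually (\<lambda>n. False) sequentially"
      by eventually_elim (use XC in \<open>smt (verit)\<close>)
    then show False by simp
  qed
  have "isCont F l" using F_deriv[OF lS] has_derivative_continuous by blast
  then have "(\<lambda>n. F (X n)) \<longlonglongrightarrow> F l" using lim by (rule isCont_tendsto_compose)
  then have "F l \<le> C + w \<bullet> l" using limw XC by (intro LIMSEQ_le) auto
  then show "l \<in> {z \<in> interior K. F z - w \<bullet> z \<le> C}" using lS by simp
qed

lemma convex_sublevel: "convex {z \<in> interior K. F z - w \<bullet> z \<le> C}"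
proof (rule convexI)
  fix x y and a b :: real
  assume x: "x \<in> {z \<in> interior K. F z - w \<bullet> z \<le> C}" and y: "y \<in> {z \<in> interior K. F z - w \<bullet> z \<le> C}"
    and ab: "0 \<le> a" "0 \<le> b" "a + b = 1"
  let ?z = "a *\<^sub>R x + b *\<^sub>R y"
  have z: "?z \<in> interior K" using convexD[OF convex_interior[OF K(2)] _ _ ab] x y by auto
  have tx: "F ?z + G ?z \<bullet> (x - ?z) \<le> C + w \<bullet> x" and ty: "F ?z + G ?z \<bullet> (y - ?z) \<le> C + w \<bullet> y"
    using above_tangent[OF z, of x] above_tangent[OF z, of y] x y by auto
  have "a * (F ?z + G ?z \<bullet> (x - ?z)) + b * (F ?z + G ?z \<bullet> (y - ?z))
      \<le> a * (C + w \<bullet> x) + b * (C + w \<bullet> y)"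
    by (rule add_mono[OF mult_left_mono[OF tx ab(1)] mult_left_mono[OF ty ab(2)]])
  moreover have "a * (F ?z + G ?z \<bullet> (x - ?z)) + b * (F ?z + G ?z \<bullet> (y - ?z))
      = (a + b) * F ?z + G ?z \<bullet> (?z - (a + b) *\<^sub>R ?z)"
    by (simp add: algebra_simps)
  moreover have "a * (C + w \<bullet> x) + b * (C + w \<bullet> y) = (a + b) * C + w \<bullet> ?z"
    by (simp add: algebra_simps)
  ultimately show "?z \<in> {z \<in> interior K. F z - w \<bullet> z \<le> C}" using z ab by simp
qed

text \<open>If the ray stayed in \<open>K\<close>, then \<open>v\<close> would be the limit of the points \<open>(x + n v) / n\<close> of \<open>K\<close>.
  The exit time is the infimum of a closed set of parameters.\<close>

lemma line_exits:
  assumes x: "x \<in> interior K" and v: "v \<notin> K"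
  obtains t where "0 < t" "x + t *\<^sub>R v \<notin> interior K" "\<And>s. 0 \<le> s \<Longrightarrow> s < t \<Longrightarrow> x + s *\<^sub>R v \<in> interior K"
proof -
  define Z where "Z = {t. 0 \<le> t \<and> x + t *\<^sub>R v \<notin> interior K}"
  have "Z \<noteq> {}"
  proof
    assume "Z = {}"
    then have ray: "x + t *\<^sub>R v \<in> K" if "0 \<le> t" for t
      using that interior_subset unfolding Z_def by blast
    have "(1 / real (Suc n)) *\<^sub>R x + v \<in> K" for n
    proof -
      have "(1 / real (Suc n)) *\<^sub>R (x + real (Suc n) *\<^sub>R v) \<in> K"
        using K(3) ray[of "real (Suc n)"] unfolding cone_def by simp
      then show ?thesis by (simp add: scaleR_add_right)
    qed
    moreover have "(\<lambda>n. (1 / real (Suc n)) *\<^sub>R x + v) \<longlonglongrightarrow> 0 *\<^sub>R x + v"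
      using LIMSEQ_inverse_real_of_nat by (intro tendsto_intros) (simp add: inverse_eq_divide)
    ultimately have "v \<in> K" using closed_sequentially[OF K(1)] by fastforce
    then show False using v by simp
  qed
  moreover have "closed Z"
  proof -
    have "closed ({0..} \<inter> - {t. x + t *\<^sub>R v \<in> interior K})"
      using open_line_preimage[OF open_interior] by (intro closed_Int) auto
    moreover have "Z = {0..} \<inter> - {t. x + t *\<^sub>R v \<in> interior K}" by (auto simp: Z_def)
    ultimately show ?thesis by simp
  qed
  moreover have bdd: "bdd_below Z" unfolding Z_def by (rule bdd_belowI[of _ 0]) simp
  ultimately have Inf: "Inf Z \<in> Z" using closed_contains_Inf by blast
  have "Inf Z \<noteq> 0" using Inf x by (auto simp: Z_def)
  moreover have "x + s *\<^sub>R v \<in> interior K" if "0 \<le> s" "s < Inf Z" for s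
    using that cInf_lower[OF _ bdd, of s] unfolding Z_def by force
  ultimately show ?thesis using Inf that[of "Inf Z"] by (auto simp: Z_def)
qed

text \<open>If the second derivative along the line through \<open>x\<close> in direction \<open>v\<close> vanished at \<open>x\<close>, it would
  vanish on the whole line by \<open>self_concordant_line\<close>. Then \<open>F\<close> would be affine there, hence bounded
  up to the point where the line leaves the interior, against the barrier property.\<close>

lemma H_pos_exit:
  assumes x: "x \<in> interior K" and v: "v \<notin> K"
  shows "0 < H x v \<bullet> v"
proof (rule ccontr)
  assume "\<not> 0 < H x v \<bullet> v"
  then have h0: "H x v \<bullet> v = 0" using H_nonneg[OF x, of v] by simp
  obtain r where r: "0 < r" "x + r *\<^sub>R v \<notin> interior K" "\<And>s. 0 \<le> s \<Longrightarrow> s < r \<Longrightarrow> x + s *\<^sub>R v \<in> interior K"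
    using line_exits[OF x v] by blast
  let ?I = "{t. x + t *\<^sub>R v \<in> interior K}"
  have I0: "0 \<in> ?I" using x by simp
  have flat: "H (x + t *\<^sub>R v) v \<bullet> v = 0" if t: "t \<in> ?I" for t
  proof (rule ccontr)
    assume "H (x + t *\<^sub>R v) v \<bullet> v \<noteq> 0"
    then have "0 < H (x + t *\<^sub>R v) v \<bullet> v" using H_nonneg t by (metis mem_Collect_eq order_le_less)
    then have "0 < H (x + 0 *\<^sub>R v) v \<bullet> v"
      using self_concordant_line(1)[OF convex_line[of x v], of "\<lambda>t. H (x + t *\<^sub>R v) v \<bullet> v"
          "\<lambda>t. T (x + t *\<^sub>R v) v v \<bullet> v" t 0] t I0
        has_field_derivative_at_within[OF line_deriv(3)] H_nonneg self_concordant by auto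
    then show False using h0 by simp
  qed
  have slope: "G (x + t *\<^sub>R v) \<bullet> v = G x \<bullet> v" if "t \<in> ?I" for t
  proof -
    have d0: "((\<lambda>t. G (x + t *\<^sub>R v) \<bullet> v) has_real_derivative 0) (at s within ?I)" if "s \<in> ?I" for s
      using has_field_derivative_at_within[OF line_deriv(2)[of x s v], of ?I] flat[OF that] that by simp
    have "\<bar>G (x + t *\<^sub>R v) \<bullet> v - G (x + 0 *\<^sub>R v) \<bullet> v\<bar> \<le> 0 * \<bar>t - 0\<bar>"
      by (rule field_bound_convex[where I = ?I and f' = "\<lambda>_. 0", OF convex_line d0 _ I0 that]) simp_all
    then show ?thesis by simp
  qed
  define C where "C = F x + \<bar>G x \<bullet> v\<bar> * r"
  have bound: "F (x + t *\<^sub>R v) \<le> C" if t: "0 \<le> t" "t < r" for t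
  proof -
    have "\<bar>F (x + t *\<^sub>R v) - F (x + 0 *\<^sub>R v)\<bar> \<le> \<bar>G x \<bullet> v\<bar> * \<bar>t - 0\<bar>"
    proof (rule field_bound_convex[where I = ?I and f' = "\<lambda>t. G (x + t *\<^sub>R v) \<bullet> v", OF convex_line])
      fix s assume s: "s \<in> ?I"
      show "((\<lambda>t. F (x + t *\<^sub>R v)) has_real_derivative G (x + s *\<^sub>R v) \<bullet> v) (at s within ?I)"
        using line_deriv(1)[of x s v] s has_field_derivative_at_within by blast
      show "\<bar>G (x + s *\<^sub>R v) \<bullet> v\<bar> \<le> \<bar>G x \<bullet> v\<bar>" using slope[OF s] by simp
    qed (use I0 r(3)[OF t] in simp_all)
    also have "\<dots> \<le> \<bar>G x \<bullet> v\<bar> * r" using t by (intro mult_left_mono) auto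
    finally show ?thesis by (simp add: C_def)
  qed
  define X where "X n = x + (r * (1 - 1 / real (Suc n))) *\<^sub>R v" for n
  have "X n \<in> {z \<in> interior K. F z - 0 \<bullet> z \<le> C}" for n
  proof -
    have "0 \<le> r * (1 - 1 / real (Suc n))" "r * (1 - 1 / real (Suc n)) < r" using r(1) by (auto simp: field_simps)
    then show ?thesis using r(3) bound by (simp add: X_def)
  qed
  moreover have "X \<longlonglongrightarrow> x + (r * (1 - 0)) *\<^sub>R v" unfolding X_def
    using LIMSEQ_inverse_real_of_nat by (intro tendsto_intros) (simp add: inverse_eq_divide)
  ultimately have "x + (r * (1 - 0)) *\<^sub>R v \<in> {z \<in> interior K. F z - 0 \<bullet> z \<le> C}"
    using closed_sequentially[OF closed_sublevel[of 0 C]] by blast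
  then show False using r(2) by simp
qed

text \<open>Because \<open>K\<close> is pointed, \<open>v\<close> or \<open>- v\<close> lies outside \<open>K\<close>.\<close>

lemma pd_H: "x \<in> interior K \<Longrightarrow> pd_op (H x)"
proof -
  assume x: "x \<in> interior K"
  have "0 < H x v \<bullet> v" if "v \<noteq> 0" for v
  proof (cases "v \<in> K")
    case True
    then have "- v \<notin> K" using K(4) that by blast
    from H_pos_exit[OF x this] show ?thesis by (simp add: blinfun.minus_right)
  qed (rule H_pos_exit[OF x])
  then show ?thesis
    using H_symmetric[OF x] by (simp add: pd_op_def blinfun.bounded_linear_right bounded_linear.linear)
qed

text \<open>The derivative in \<open>x\<close> of the homogeneity relation.\<close>

lemma G_scale: 
  assumes x: "x \<in> interior K" and r: "0 < r"
  shows "G (r *\<^sub>R x) = (1 / r) *\<^sub>R G x"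
proof -
  have "((\<lambda>x. F (r *\<^sub>R x)) has_derivative (\<lambda>h. G (r *\<^sub>R x) \<bullet> (r *\<^sub>R h))) (at x)"
    by (rule has_derivative_compose[OF has_derivative_scaleR_right[OF has_derivative_ident]
          F_deriv[OF scale_interior[OF x r]]])
  moreover have "((\<lambda>x. F (r *\<^sub>R x)) has_derivative (\<lambda>h. G x \<bullet> h)) (at x)"
  proof (rule has_derivative_transform_within_open[OF _ open_interior x])
    show "((\<lambda>x. F x - \<nu> * ln r) has_derivative (\<lambda>h. G x \<bullet> h)) (at x)"
      using has_derivative_diff[OF F_deriv[OF x] has_derivative_const, of "\<nu> * ln r"] by simp
  qed (simp add: homogeneous r)
  ultimately have "(\<lambda>h. G (r *\<^sub>R x) \<bullet> (r *\<^sub>R h)) = (\<lambda>h. G x \<bullet> h)" by (rule has_derivative_unique)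
  then have "(r *\<^sub>R G (r *\<^sub>R x)) \<bullet> h = G x \<bullet> h" for h by (metis inner_scaleR_left inner_scaleR_right)
  then have "r *\<^sub>R G (r *\<^sub>R x) = G x" using vector_eq_rdot by blast
  then show ?thesis using r by (metis divide_self_if less_irrefl mult.commute scaleR_one scaleR_scaleR times_divide_eq_left)
qed

text \<open>The derivatives of \<open>F ((1 + t) x) = F x - \<nu> ln (1 + t)\<close> at \<open>t = 0\<close> are \<open>- \<nu>\<close>, \<open>\<nu>\<close> and \<open>- 2 \<nu>\<close>.
  The self-concordance inequality between the last two reads \<open>2 \<nu> \<le> 2 \<nu>\<^sup>3\<^sup>/\<^sup>2\<close>. The value of the
  Hessian at \<open>x\<close> comes from differentiating \<open>G_scale\<close> along the same ray.\<close>

lemma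
  assumes x: "x \<in> interior K"
  shows G_inner_self: "G x \<bullet> x = - \<nu>" and H_self: "H x x = - G x"
    and nu_ge_1: "0 < \<nu> \<Longrightarrow> 1 \<le> \<nu>"
proof -
  have inI: "x + t *\<^sub>R x \<in> interior K" if "- 1 < t" for t
    using scale_interior[OF x, of "1 + t"] that by (simp add: scaleR_add_left)
  have d1: "((\<lambda>t. F (x + t *\<^sub>R x)) has_real_derivative - \<nu> / (1 + t)) (at t)" if t: "-1 < t" for t
  proof (rule has_field_derivative_transform_within_open[of _ _ _ "{-1<..}"])
    show "((\<lambda>t. F x - \<nu> * ln (1 + t)) has_real_derivative - \<nu> / (1 + t)) (at t)"
      using t by (auto intro!: derivative_eq_intros)
    show "F x - \<nu> * ln (1 + t) = F (x + t *\<^sub>R x)" if "t \<in> {-1<..}" for t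
      using homogeneous[OF x, of "1 + t"] that by (simp add: scaleR_add_left)
  qed (use t in auto)
  have G: "G (x + t *\<^sub>R x) \<bullet> x = - \<nu> / (1 + t)" if t: "-1 < t" for t
    using DERIV_unique[OF line_deriv(1)[OF inI[OF t]] d1[OF t]] .
  have H': "H (x + t *\<^sub>R x) x \<bullet> x = \<nu> / (1 + t)\<^sup>2" if t: "-1 < t" for t
  proof -
    have "((\<lambda>t. G (x + t *\<^sub>R x) \<bullet> x) has_real_derivative \<nu> / (1 + t)\<^sup>2) (at t)"
    proof (rule has_field_derivative_transform_within_open[of _ _ _ "{-1<..}"])
      show "((\<lambda>t. - \<nu> / (1 + t)) has_real_derivative \<nu> / (1 + t)\<^sup>2) (at t)"
        using t by (auto intro!: derivative_eq_intros simp: power2_eq_square)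
    qed (use t G in auto)
    with line_deriv(2)[OF inI[OF t]] show ?thesis by (rule DERIV_unique)
  qed
  have T': "T x x x \<bullet> x = - 2 * \<nu>"
  proof -
    have "((\<lambda>t. H (x + t *\<^sub>R x) x \<bullet> x) has_real_derivative - 2 * \<nu>) (at 0)"
    proof (rule has_field_derivative_transform_within_open[of _ _ _ "{-1<..}"])
      show "((\<lambda>t. \<nu> / (1 + t)\<^sup>2) has_real_derivative - 2 * \<nu>) (at 0)"
        by (auto intro!: derivative_eq_intros)
    qed (use H' in auto)
    with line_deriv(3)[OF inI[of 0]] show ?thesis using DERIV_unique by fastforce
  qed
  show "G x \<bullet> x = - \<nu>" using G[of 0] by simp
  show "1 \<le> \<nu>" if "0 < \<nu>"
  proof -
    have "2 * \<nu> \<le> 2 * (\<nu> * sqrt \<nu>)" using self_concordant[OF x, of x] T' H'[of 0] that by simp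
    then have "1 \<le> sqrt \<nu>" using that by simp
    then show ?thesis by simp
  qed
  have "((\<lambda>t. x + t *\<^sub>R x) has_derivative (\<lambda>h. h *\<^sub>R x)) (at (0::real))"
    by (auto intro!: derivative_eq_intros)
  then have "((\<lambda>t. G (x + t *\<^sub>R x)) has_derivative (\<lambda>h. H (x + 0 *\<^sub>R x) (h *\<^sub>R x))) (at 0)"
    using G_deriv[OF inI[of 0]] by (rule has_derivative_compose) simp
  moreover have "((\<lambda>t. G (x + t *\<^sub>R x)) has_derivative (\<lambda>h. h *\<^sub>R (- G x))) (at 0)"
  proof (rule has_derivative_transform_within_open[of _ _ _ _ "{-1<..}"])
    show "((\<lambda>t. (1 / (1 + t)) *\<^sub>R G x) has_derivative (\<lambda>h. h *\<^sub>R (- G x))) (at 0)"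
      by (auto intro!: derivative_eq_intros)
    show "(1 / (1 + t)) *\<^sub>R G x = G (x + t *\<^sub>R x)" if "t \<in> {-1<..}" for t
      using G_scale[OF x, of "1 + t"] that by (simp add: scaleR_add_left)
  qed auto
  ultimately have "(\<lambda>h. H (x + 0 *\<^sub>R x) (h *\<^sub>R x)) = (\<lambda>h. h *\<^sub>R (- G x))"
    by (rule has_derivative_unique)
  from fun_cong[OF this, of 1] show "H x x = - G x" by simp
qed

lemma G_strictly_monotone:
  assumes x: "x \<in> interior K" and z: "z \<in> interior K" and xz: "x \<noteq> z"
  shows "0 < (G z - G x) \<bullet> (z - x)"
proof -
  let ?v = "z - x"
  have I: "x + t *\<^sub>R ?v \<in> interior K" if "0 \<le> t" "t \<le> 1" for t
    using convexD[OF convex_line[of x ?v], of 0 1 "1 - t" t] x z that by auto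
  obtain t where t: "0 < t" "t < 1"
    "G (x + 1 *\<^sub>R ?v) \<bullet> ?v - G (x + 0 *\<^sub>R ?v) \<bullet> ?v = (1 - 0) * (H (x + t *\<^sub>R ?v) ?v \<bullet> ?v)"
    using MVT2[of 0 1 "\<lambda>t. G (x + t *\<^sub>R ?v) \<bullet> ?v" "\<lambda>t. H (x + t *\<^sub>R ?v) ?v \<bullet> ?v"] line_deriv(2)[OF I]
    by auto
  then show ?thesis using pd_pos[OF pd_H[OF I[of t]], of ?v] xz by (simp add: inner_diff_left)
qed

lemma inj_on_G: "inj_on G (interior K)"
  using G_strictly_monotone by (fastforce simp: inj_on_def)

text \<open>It suffices that \<open>F - \<langle>w, \<cdot>\<rangle>\<close> attains its minimum, hence that a sublevel set is bounded. An
  unbounded one, being closed and convex, contains a ray, along which the function is bounded above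
  and below; \<open>no_bounded_log_ray\<close> excludes this.\<close>

lemma gradient_attained_of_bounded_below:
  assumes B: "\<And>x. x \<in> interior K \<Longrightarrow> w \<bullet> x - F x \<le> B"
  obtains x where "x \<in> interior K" "G x = w"
proof -
  obtain x0 where x0: "x0 \<in> interior K" using K(5) by blast
  define S where "S = {z \<in> interior K. F z - w \<bullet> z \<le> F x0 - w \<bullet> x0}"
  have x0S: "x0 \<in> S" using x0 by (simp add: S_def)
  have cl: "closed S" and cv: "convex S" unfolding S_def by (rule closed_sublevel convex_sublevel)+
  have "bounded S"
  proof (rule ccontr)
    assume unb: "\<not> bounded S"
    have "\<exists>z\<in>S. real n < norm (z - x0)" for n
    proof (rule ccontr)
      assume "\<not> ?thesis"
      then have "S \<subseteq> cball x0 (real n)" by (auto simp: dist_norm norm_minus_commute not_less)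
      then show False using unb bounded_subset[OF bounded_cball] by blast
    qed
    then obtain Z where Z: "\<And>n. Z n \<in> S" "\<And>n. real n < norm (Z n - x0)" by metis
    define U where "U n = (1 / norm (Z n - x0)) *\<^sub>R (Z n - x0)" for n
    have Zpos: "0 < norm (Z n - x0)" for n using Z(2)[of n] by (metis less_le_trans of_nat_0_le_iff order_le_less_trans)
    have "norm (U n) = 1" for n using Zpos[of n] by (simp add: U_def)
    then have "U n \<in> sphere 0 1" for n by simp
    then obtain v \<rho> where v: "v \<in> sphere 0 1" and \<rho>: "strict_mono (\<rho> :: nat \<Rightarrow> nat)" "(U \<circ> \<rho>) \<longlonglongrightarrow> v"
      using compact_sphere[of 0 "1::real"] unfolding compact_def by blast
    have v0: "v \<noteq> 0" using v by auto
    have ray: "x0 + t *\<^sub>R v \<in> S" if t: "0 \<le> t" for t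
    proof (rule Lim_in_closed_set[OF cl])
      show "(\<lambda>n. x0 + t *\<^sub>R (U \<circ> \<rho>) n) \<longlonglongrightarrow> x0 + t *\<^sub>R v" by (intro tendsto_intros \<rho>)
      have "x0 + t *\<^sub>R (U \<circ> \<rho>) n \<in> S" if n: "t \<le> real n" for n
      proof -
        let ?z = "Z (\<rho> n)" let ?d = "norm (?z - x0)"
        have "real n \<le> real (\<rho> n)" using seq_suble[OF \<rho>(1)] by simp
        then have td: "t \<le> ?d" using Z(2)[of "\<rho> n"] n by linarith
        have "(1 - t / ?d) *\<^sub>R x0 + (t / ?d) *\<^sub>R ?z \<in> S"
          using convexD[OF cv x0S Z(1)[of "\<rho> n"], of "1 - t / ?d" "t / ?d"] t td Zpos[of "\<rho> n"] by simp
        then show ?thesis by (simp add: U_def algebra_simps)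
      qed
      then show "eventually (\<lambda>n. x0 + t *\<^sub>R (U \<circ> \<rho>) n \<in> S) sequentially"
        using eventually_ge_at_top[of "nat \<lceil>t\<rceil>"] by (auto elim!: eventually_mono)
    qed simp
    have rayK: "x0 + t *\<^sub>R v \<in> interior K" if "0 \<le> t" for t using ray[OF that] by (simp add: S_def)
    let ?h = "\<lambda>t. H (x0 + t *\<^sub>R v) v \<bullet> v"
    define A where "A = 1 / sqrt (?h 0)"
    have h0: "0 < ?h 0" using pd_pos[OF pd_H[OF x0] v0] by simp
    then have A: "0 < A" by (simp add: A_def)
    show False
    proof (rule no_bounded_log_ray)
      fix t :: real assume t: "0 \<le> t"
      note I = rayK[OF t]
      show "((\<lambda>t. F (x0 + t *\<^sub>R v) - w \<bullet> (x0 + t *\<^sub>R v)) has_real_derivative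
          G (x0 + t *\<^sub>R v) \<bullet> v - w \<bullet> v) (at t)"
        by (intro DERIV_diff line_deriv(1)[OF I]) (auto intro!: derivative_eq_intros simp: inner_add_right)
      show "((\<lambda>t. G (x0 + t *\<^sub>R v) \<bullet> v - w \<bullet> v) has_real_derivative ?h t) (at t)"
        using DERIV_diff[OF line_deriv(2)[OF I] DERIV_const[of "w \<bullet> v"]] by simp
      have "0 < ?h t" "\<bar>1 / sqrt (?h t) - 1 / sqrt (?h 0)\<bar> \<le> \<bar>t - 0\<bar>"
        using self_concordant_line[OF convex_line[of x0 v], of ?h "\<lambda>t. T (x0 + t *\<^sub>R v) v v \<bullet> v" 0 t]
          I x0 h0 has_field_derivative_at_within[OF line_deriv(3)] H_nonneg self_concordant by auto
      then have ht: "0 < ?h t" "1 / sqrt (?h t) \<le> A + t" using t by (auto simp: A_def)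
      then have "1 / (A + t) \<le> sqrt (?h t)" using A t by (simp add: field_simps)
      then have "(1 / (A + t))\<^sup>2 \<le> (sqrt (?h t))\<^sup>2" using A t by (intro power_mono) auto
      then show "1 / (A + t)\<^sup>2 \<le> ?h t" using ht by (simp add: power_divide)
      show "\<bar>F (x0 + t *\<^sub>R v) - w \<bullet> (x0 + t *\<^sub>R v)\<bar> \<le> \<bar>B\<bar> + \<bar>F x0 - w \<bullet> x0\<bar>"
        using ray[OF t] B[OF I] unfolding S_def mem_Collect_eq by linarith
    qed (rule A)
  qed
  then have "bounded {z \<in> interior K. F z - w \<bullet> z \<le> F x0 - w \<bullet> x0}" by (simp add: S_def)
  moreover have "continuous_on (interior K) (\<lambda>z. F z - w \<bullet> z)"
    by (intro continuous_intros has_derivative_continuous_on[OF has_derivative_at_withinI[OF F_deriv]])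
  ultimately obtain x where x: "x \<in> interior K" "\<And>z. z \<in> interior K \<Longrightarrow> F x - w \<bullet> x \<le> F z - w \<bullet> z"
    using attains_min_of_bounded_sublevel[OF x0 closed_sublevel] by blast
  have "((\<lambda>z. F z - w \<bullet> z) has_derivative (\<lambda>h. G x \<bullet> h - w \<bullet> h)) (at x)"
    by (intro has_derivative_diff F_deriv x) (auto intro!: derivative_eq_intros)
  then have "(\<lambda>h. G x \<bullet> h - w \<bullet> h) = (\<lambda>h. 0)"
    using differential_zero_maxmin[OF x(1) open_interior] x(2) by blast
  then have "(G x - w) \<bullet> h = 0" for h by (metis inner_diff_left)
  then have "G x - w = 0" using inner_eq_zero_iff by blast
  then show ?thesis using that[OF x(1)] by simp
qed

end

section \<open>The conjugate of the barrier\<close>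

lemma derivative_comparison:
  fixes f g :: "real \<Rightarrow> real"
  assumes ab: "a \<le> b"
    and f: "\<And>t. a \<le> t \<Longrightarrow> t \<le> b \<Longrightarrow> (f has_real_derivative f' t) (at t)"
    and g: "\<And>t. a \<le> t \<Longrightarrow> t \<le> b \<Longrightarrow> (g has_real_derivative g' t) (at t)"
    and le: "\<And>t. a \<le> t \<Longrightarrow> t \<le> b \<Longrightarrow> \<bar>f' t\<bar> \<le> g' t"
  shows "\<bar>f b - f a\<bar> \<le> g b - g a"
proof -
  have "g a - f a \<le> g b - f b"
  proof (rule DERIV_nonneg_imp_nondecreasing[OF ab])
    fix t assume t: "a \<le> t" "t \<le> b"
    show "\<exists>y. ((\<lambda>t. g t - f t) has_real_derivative y) (at t) \<and> 0 \<le> y"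
      using DERIV_diff[OF g[OF t] f[OF t]] le[OF t] by (intro exI[of _ "g' t - f' t"]) auto
  qed
  moreover have "g a + f a \<le> g b + f b"
  proof (rule DERIV_nonneg_imp_nondecreasing[OF ab])
    fix t assume t: "a \<le> t" "t \<le> b"
    show "\<exists>y. ((\<lambda>t. g t + f t) has_real_derivative y) (at t) \<and> 0 \<le> y"
      using DERIV_add[OF g[OF t] f[OF t]] le[OF t] by (intro exI[of _ "g' t + f' t"]) auto
  qed
  ultimately show ?thesis by simp
qed

context cone_barrier
begin

text \<open>The domain of the conjugate \<open>f\<^sup>*\<close> is the range of the gradient of \<open>f\<close> (see
  \<open>grad_range_iff\<close>), and the inverse of that gradient is the gradient of \<open>f\<^sup>*\<close>.\<close>

definition grad_range :: "'a set" where "grad_range = G ` interior K"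

definition grad_inv :: "'a \<Rightarrow> 'a" where "grad_inv w = the_inv_into (interior K) G w"

definition conj_hess :: "'a \<Rightarrow> 'a \<Rightarrow> 'a" where "conj_hess w = inv (H (grad_inv w))"

definition conj_value :: "'a \<Rightarrow> real" where "conj_value w = w \<bullet> grad_inv w - F (grad_inv w)"

lemma grad_inv_G: "x \<in> interior K \<Longrightarrow> grad_inv (G x) = x"
  by (simp add: grad_inv_def the_inv_into_f_f[OF inj_on_G])

lemma grad_inv: "w \<in> grad_range \<Longrightarrow> grad_inv w \<in> interior K" "w \<in> grad_range \<Longrightarrow> G (grad_inv w) = w"
  by (auto simp: grad_range_def grad_inv_G)

lemma continuous_on_G: "continuous_on (interior K) G"
  using has_derivative_continuous_on[OF has_derivative_at_withinI[OF G_deriv]] .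

lemma open_grad_range: "open grad_range"
  unfolding grad_range_def by (rule invariance_of_domain[OF continuous_on_G open_interior inj_on_G])

lemma conj_value_upper: "w \<in> grad_range \<Longrightarrow> x \<in> interior K \<Longrightarrow> w \<bullet> x - F x \<le> conj_value w"
  using above_tangent[of "grad_inv w" x] grad_inv[of w] by (simp add: conj_value_def inner_diff_right)

lemma grad_range_iff: "w \<in> grad_range \<longleftrightarrow> (\<exists>B. \<forall>x\<in>interior K. w \<bullet> x - F x \<le> B)"
proof
  assume "\<exists>B. \<forall>x\<in>interior K. w \<bullet> x - F x \<le> B"
  then obtain B where "\<And>x. x \<in> interior K \<Longrightarrow> w \<bullet> x - F x \<le> B" by blast
  then obtain x where "x \<in> interior K" "G x = w" by (rule gradient_attained_of_bounded_below)
  then show "w \<in> grad_range" unfolding grad_range_def by blast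
qed (use conj_value_upper in blast)

lemma pd_conj_hess: "w \<in> grad_range \<Longrightarrow> pd_op (conj_hess w)"
  unfolding conj_hess_def by (intro pd_op_inv pd_H grad_inv)

lemma H_conj_hess: "w \<in> grad_range \<Longrightarrow> H (grad_inv w) (conj_hess w u) = u"
  unfolding conj_hess_def by (intro pd_inv pd_H grad_inv)

lemma op_norm_H_conj_hess:
  "w \<in> grad_range \<Longrightarrow> op_norm (H (grad_inv w)) (conj_hess w u) = op_norm (conj_hess w) u"
  using op_norm_inv[OF pd_H[OF grad_inv(1)]] by (simp add: conj_hess_def op_dual_norm_eq)

text \<open>The inverse function theorem for \<open>(x, v) \<mapsto> (G x, H x v)\<close>, a map between spaces of equal
  dimension with inverse \<open>(w, u) \<mapsto> (grad_inv w, conj_hess w u)\<close>. It yields in one step the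
  derivative of \<open>grad_inv\<close>, that is the Hessian of the conjugate, and the derivative of this
  Hessian.\<close>

lemma joint_inverse_deriv:
  assumes w: "w \<in> grad_range"
  shows "((\<lambda>z. (grad_inv (fst z), conj_hess (fst z) (snd z))) has_derivative
      (\<lambda>d. (conj_hess w (fst d), conj_hess w (snd d - T (grad_inv w) (conj_hess w (fst d)) (conj_hess w u)))))
    (at (w, u))"
proof -
  define x where "x = grad_inv w"
  define v where "v = conj_hess w u"
  have x: "x \<in> interior K" "G x = w" using grad_inv[OF w] by (auto simp: x_def)
  have Hv: "H x v = u" using H_conj_hess[OF w] by (simp add: x_def v_def)
  let ?\<Psi> = "\<lambda>z. (G (fst z), H (fst z) (snd z))"
  let ?g = "\<lambda>z. (grad_inv (fst z), conj_hess (fst z) (snd z))"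
  have d: "(?\<Psi> has_derivative (\<lambda>d. (H (fst z) (fst d), H (fst z) (snd d) + T (fst z) (fst d) (snd z)))) (at z)"
    if z: "fst z \<in> interior K" for z
  proof (rule has_derivative_Pair)
    show "((\<lambda>z. G (fst z)) has_derivative (\<lambda>d. H (fst z) (fst d))) (at z)"
      by (rule has_derivative_compose[OF has_derivative_fst[OF has_derivative_ident] G_deriv[OF z]])
    show "((\<lambda>z. H (fst z) (snd z)) has_derivative
        (\<lambda>d. H (fst z) (snd d) + T (fst z) (fst d) (snd z))) (at z)"
      by (rule bounded_bilinear.FDERIV[OF bounded_bilinear_blinfun_apply
            has_derivative_compose[OF has_derivative_fst[OF has_derivative_ident] H_deriv[OF z]]
            has_derivative_snd[OF has_derivative_ident]])
  qed
  have "(?g has_derivative (\<lambda>d. (conj_hess w (fst d), conj_hess w (snd d - T x (conj_hess w (fst d)) v))))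
      (at (?\<Psi> (x, v)))"
  proof (rule has_derivative_inverse_strong[where S = "interior K \<times> UNIV" and f = ?\<Psi> and x = "(x, v)"])
    show "open (interior K \<times> (UNIV :: 'a set))" by (intro open_Times) auto
    show "(x, v) \<in> interior K \<times> UNIV" using x by simp
    show "continuous_on (interior K \<times> UNIV) ?\<Psi>"
      by (rule has_derivative_continuous_on[OF has_derivative_at_withinI[OF d]]) auto
    show "?g (?\<Psi> z) = z" if "z \<in> interior K \<times> UNIV" for z
      using that grad_inv_G pd_inv(2)[OF pd_H] by (auto simp: conj_hess_def)
    show "(?\<Psi> has_derivative (\<lambda>d. (H x (fst d), H x (snd d) + T x (fst d) v))) (at (x, v))"
      using d[of "(x, v)"] x by simp
    show "(\<lambda>d. (H x (fst d), H x (snd d) + T x (fst d) v)) \<circ>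
        (\<lambda>d. (conj_hess w (fst d), conj_hess w (snd d - T x (conj_hess w (fst d)) v))) = id"
      using H_conj_hess[OF w] by (auto simp: fun_eq_iff x_def)
  qed
  then show ?thesis using x(2) Hv by (simp add: x_def v_def)
qed

lemma grad_inv_deriv:
  assumes w: "w \<in> grad_range"
  shows "(grad_inv has_derivative conj_hess w) (at w)"
proof -
  have "((\<lambda>w. (w, 0::'a)) has_derivative (\<lambda>d. (d, 0))) (at w)"
    by (intro has_derivative_Pair has_derivative_ident has_derivative_const)
  from has_derivative_fst[OF has_derivative_compose[OF this joint_inverse_deriv[OF w]]]
  show ?thesis by simp
qed

lemma conj_hess_deriv:
  assumes w: "w \<in> grad_range"
  shows "((\<lambda>w. conj_hess w u \<bullet> v) has_derivative
    (\<lambda>d. - (T (grad_inv w) (conj_hess w d) (conj_hess w u) \<bullet> conj_hess w v))) (at w)"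
proof -
  have lin: "linear (conj_hess w)" by (rule pd_linear[OF pd_conj_hess[OF w]])
  have "((\<lambda>w. (w, u)) has_derivative (\<lambda>d. (d, 0))) (at w)"
    by (intro has_derivative_Pair has_derivative_ident has_derivative_const)
  from has_derivative_inner_left[OF has_derivative_snd[OF has_derivative_compose[OF this joint_inverse_deriv[OF w]]], of v]
  have "((\<lambda>w. conj_hess w u \<bullet> v) has_derivative
      (\<lambda>d. conj_hess w (0 - T (grad_inv w) (conj_hess w d) (conj_hess w u)) \<bullet> v)) (at w)" by simp
  moreover have "conj_hess w (0 - z) \<bullet> v = - (z \<bullet> conj_hess w v)" for z
    using pd_sym[OF pd_conj_hess[OF w], of z v] by (simp add: linear_neg[OF lin] inner_commute)
  ultimately show ?thesis by simp
qed

text \<open>In the derivative of \<open>\<langle>w, grad_inv w\<rangle> - F (grad_inv w)\<close> the terms that contain the derivative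
  of \<open>grad_inv\<close> cancel because \<open>G (grad_inv w) = w\<close>.\<close>

lemma conj_value_deriv:
  assumes w: "w \<in> grad_range"
  shows "(conj_value has_derivative (\<lambda>d. grad_inv w \<bullet> d)) (at w)"
proof -
  have "((\<lambda>w. w \<bullet> grad_inv w - F (grad_inv w)) has_derivative
      (\<lambda>d. (w \<bullet> conj_hess w d + d \<bullet> grad_inv w) - G (grad_inv w) \<bullet> conj_hess w d)) (at w)"
    by (intro has_derivative_diff has_derivative_inner has_derivative_ident grad_inv_deriv[OF w]
        has_derivative_compose[OF grad_inv_deriv[OF w] F_deriv[OF grad_inv(1)[OF w]]])
  then show ?thesis using grad_inv(2)[OF w] by (simp add: conj_value_def[abs_def] inner_commute)
qed

lemma third_derivative_bound:
  assumes x: "x \<in> interior K"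
  shows "\<bar>T x a b \<bullet> b\<bar> \<le> 2 * op_norm (H x) a * (op_norm (H x) b)\<^sup>2"
proof (rule trilinear_bound_of_diagonal[where T = "\<lambda>a u v. T x a u \<bullet> v" and M = 2, OF pd_H[OF x]])
  have bl: "bounded_linear (T x)" using H_deriv[OF x] by (rule has_derivative_bounded_linear)
  show "linear (\<lambda>v. T x d u \<bullet> v)" for d u
    by (simp add: linear_iff inner_add_right)
  show "T x d u \<bullet> v = T x u d \<bullet> v" "T x d u \<bullet> v = T x d v \<bullet> u" for d u v
    using T_symmetric[OF x] by blast+
  show "continuous_on UNIV (\<lambda>z. T x (fst z) (snd z) \<bullet> snd z)"
    by (intro continuous_intros bounded_linear.continuous_on[OF bl])
  show "\<bar>T x v v \<bullet> v\<bar> \<le> 2 * op_norm (H x) v ^ 3" for v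
    using self_concordant[OF x, of v] H_nonneg[OF x, of v]
    by (simp add: op_norm_def power3_eq_cube)
qed

text \<open>The third derivative of the conjugate is, up to sign, that of \<open>F\<close> at the images of the
  directions under \<open>conj_hess w\<close>, and this operator is an isometry between the local norms.\<close>

lemma conj_third_derivative_bound:
  assumes w: "w \<in> grad_range"
  shows "\<bar>T (grad_inv w) (conj_hess w d) (conj_hess w u) \<bullet> conj_hess w u\<bar>
    \<le> 2 * op_norm (conj_hess w) d * (op_norm (conj_hess w) u)\<^sup>2"
  using third_derivative_bound[OF grad_inv(1)[OF w]] by (simp flip: op_norm_H_conj_hess[OF w])

lemma conj_line_deriv:
  assumes w: "w + t *\<^sub>R d \<in> grad_range"
  shows "((\<lambda>t. conj_value (w + t *\<^sub>R d)) has_real_derivative grad_inv (w + t *\<^sub>R d) \<bullet> d) (at t)"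
    "((\<lambda>t. grad_inv (w + t *\<^sub>R d) \<bullet> u) has_real_derivative conj_hess (w + t *\<^sub>R d) d \<bullet> u) (at t)"
    "((\<lambda>t. conj_hess (w + t *\<^sub>R d) u \<bullet> v) has_real_derivative
       - (T (grad_inv (w + t *\<^sub>R d)) (conj_hess (w + t *\<^sub>R d) d) (conj_hess (w + t *\<^sub>R d) u)
            \<bullet> conj_hess (w + t *\<^sub>R d) v)) (at t)"
proof -
  have line: "((\<lambda>t. w + t *\<^sub>R d) has_derivative (\<lambda>h. h *\<^sub>R d)) (at t)"
    by (auto intro!: derivative_eq_intros)
  have lin: "linear (conj_hess (w + t *\<^sub>R d))" by (rule pd_linear[OF pd_conj_hess[OF w]])
  have linT: "linear (T (grad_inv (w + t *\<^sub>R d)))"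
    using H_deriv[OF grad_inv(1)[OF w]] by (rule has_derivative_linear)
  show "((\<lambda>t. conj_value (w + t *\<^sub>R d)) has_real_derivative grad_inv (w + t *\<^sub>R d) \<bullet> d) (at t)"
    using has_derivative_compose[OF line conj_value_deriv[OF w]] by (simp add: has_real_derivative_iff_scaled)
  show "((\<lambda>t. grad_inv (w + t *\<^sub>R d) \<bullet> u) has_real_derivative conj_hess (w + t *\<^sub>R d) d \<bullet> u) (at t)"
    using has_derivative_inner_left[OF has_derivative_compose[OF line grad_inv_deriv[OF w]], of u]
    by (simp add: has_real_derivative_iff_scaled linear_cmul[OF lin])
  show "((\<lambda>t. conj_hess (w + t *\<^sub>R d) u \<bullet> v) has_real_derivative
       - (T (grad_inv (w + t *\<^sub>R d)) (conj_hess (w + t *\<^sub>R d) d) (conj_hess (w + t *\<^sub>R d) u)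
            \<bullet> conj_hess (w + t *\<^sub>R d) v)) (at t)"
    using has_derivative_compose[OF line conj_hess_deriv[OF w]]
    by (simp add: has_real_derivative_iff_scaled linear_cmul[OF lin] linear_cmul[OF linT] blinfun.scaleR_left)
qed

lemma conj_line_self_concordant:
  assumes I: "convex I" "0 \<in> I" "t \<in> I" "0 \<le> t" and w: "\<And>s. s \<in> I \<Longrightarrow> w + s *\<^sub>R d \<in> grad_range"
    and r: "op_norm (conj_hess w) d = r" "t * r < 1"
  shows "op_norm (conj_hess (w + t *\<^sub>R d)) d \<le> r / (1 - t * r)"
proof (cases "d = 0")
  case True
  then show ?thesis using r by (simp add: op_norm_def)
next
  case False
  let ?h = "\<lambda>t. conj_hess (w + t *\<^sub>R d) d \<bullet> d"
  let ?h' = "\<lambda>t. - (T (grad_inv (w + t *\<^sub>R d)) (conj_hess (w + t *\<^sub>R d) d) (conj_hess (w + t *\<^sub>R d) d)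
            \<bullet> conj_hess (w + t *\<^sub>R d) d)"
  have w0: "w \<in> grad_range" using w[OF I(2)] by simp
  have r0: "0 < r" using op_norm_pos[OF pd_conj_hess[OF w0] False] r by simp
  have h0: "0 < ?h 0" using pd_pos[OF pd_conj_hess[OF w0] False] by simp
  have sr: "sqrt (?h 0) = r" using r(1) by (simp add: op_norm_def)
  have der: "(?h has_real_derivative ?h' s) (at s within I)" if "s \<in> I" for s
    by (rule has_field_derivative_at_within[OF conj_line_deriv(3)[OF w[OF that]]])
  have nn: "0 \<le> ?h s" if "s \<in> I" for s by (rule pd_nonneg[OF pd_conj_hess[OF w[OF that]]])
  have sc: "\<bar>?h' s\<bar> \<le> 2 * (?h s * sqrt (?h s))" if "s \<in> I" for s
    using conj_third_derivative_bound[OF w[OF that], of d d] nn[OF that] by (simp add: op_norm_def mult_ac)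
  note L = self_concordant_line[OF I(1) der nn sc I(2,3) h0]
  have "1 / sqrt (?h t) \<ge> 1 / r - t" using L(2) I(4) unfolding sr by (simp add: abs_le_iff)
  then have "(1 - t * r) / r \<le> 1 / sqrt (?h t)" using r0 by (simp add: diff_divide_distrib)
  then have "sqrt (?h t) \<le> r / (1 - t * r)" using r0 r(2) L(1) by (simp add: field_simps)
  then show ?thesis by (simp add: op_norm_def)
qed

text \<open>Up to the first parameter \<open>s\<close> at which the segment leaves the domain, the second derivative
  of the conjugate along the segment is bounded by \<open>(r / (1 - r))\<^sup>2\<close>. Therefore the conjugate is
  bounded by some \<open>B\<close> on that part, and so are all affine functions below it, also at \<open>s\<close>; then the
  conjugate is finite at \<open>s\<close>.\<close>

lemma grad_range_Dikin:
  assumes w: "w \<in> grad_range" and r: "op_norm (conj_hess w) d < 1"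
  shows "w + d \<in> grad_range"
proof (rule ccontr)
  assume out: "w + d \<notin> grad_range"
  define r where "r = op_norm (conj_hess w) d"
  have r0: "0 \<le> r" "r < 1" using r op_norm_nonneg[OF pd_conj_hess[OF w]] by (auto simp: r_def)
  define Z where "Z = {t. 0 \<le> t \<and> t \<le> 1 \<and> w + t *\<^sub>R d \<notin> grad_range}"
  have Z1: "1 \<in> Z" using out by (simp add: Z_def)
  have "closed Z"
  proof -
    have "closed ({0..1} \<inter> - {t. w + t *\<^sub>R d \<in> grad_range})"
      using open_line_preimage[OF open_grad_range] by (intro closed_Int) auto
    moreover have "Z = {0..1} \<inter> - {t. w + t *\<^sub>R d \<in> grad_range}" by (auto simp: Z_def)
    ultimately show ?thesis by simp
  qed
  moreover have bdd: "bdd_below Z" unfolding Z_def by (rule bdd_belowI[of _ 0]) simp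
  ultimately have Inf: "Inf Z \<in> Z" using closed_contains_Inf Z1 by blast
  define s where "s = Inf Z"
  have s: "0 \<le> s" "s \<le> 1" "w + s *\<^sub>R d \<notin> grad_range" using Inf by (auto simp: s_def Z_def)
  have s0: "0 < s" using s w by (cases "s = 0") auto
  let ?I = "{0..<s}"
  have I: "w + t *\<^sub>R d \<in> grad_range" if "t \<in> ?I" for t
  proof (rule ccontr)
    assume "w + t *\<^sub>R d \<notin> grad_range"
    then have "t \<in> Z" using that s(2) by (simp add: Z_def)
    then show False using cInf_lower[OF _ bdd, of t] that by (simp add: s_def)
  qed
  define C where "C = (r / (1 - r))\<^sup>2"
  have C0: "0 \<le> C" by (simp add: C_def)
  have h: "\<bar>conj_hess (w + t *\<^sub>R d) d \<bullet> d\<bar> \<le> C" if t: "t \<in> ?I" for t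
  proof -
    have tr: "t * r \<le> r" using t s r0 by (simp add: mult_left_le_one_le)
    have "op_norm (conj_hess (w + t *\<^sub>R d)) d \<le> r / (1 - t * r)"
      by (rule conj_line_self_concordant[OF _ _ t _ I]) (use t s0 tr r0 in \<open>auto simp: r_def\<close>)
    also have "\<dots> \<le> r / (1 - r)" using r0 tr by (intro divide_left_mono mult_pos_pos) auto
    finally have "(op_norm (conj_hess (w + t *\<^sub>R d)) d)\<^sup>2 \<le> C"
      unfolding C_def by (intro power_mono op_norm_nonneg pd_conj_hess I t)
    then show ?thesis
      using op_norm_sq[OF pd_conj_hess[OF I[OF t]]] pd_nonneg[OF pd_conj_hess[OF I[OF t]]] by simp
  qed
  let ?k = "\<lambda>t. grad_inv (w + t *\<^sub>R d) \<bullet> d"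
  have k: "\<bar>?k t\<bar> \<le> \<bar>?k 0\<bar> + C" if t: "t \<in> ?I" for t
  proof -
    have "\<bar>?k t - ?k 0\<bar> \<le> C * \<bar>t - 0\<bar>"
      by (rule field_bound_convex[where I = ?I, OF _ has_field_derivative_at_within[OF conj_line_deriv(2)[OF I]] h])
        (use t s0 in auto)
    also have "\<dots> \<le> C * 1" using t s C0 by (intro mult_left_mono) auto
    finally show ?thesis by simp
  qed
  define B where "B = conj_value (w + 0 *\<^sub>R d) + (\<bar>?k 0\<bar> + C)"
  have B: "conj_value (w + t *\<^sub>R d) \<le> B" if t: "t \<in> ?I" for t
  proof -
    have "\<bar>conj_value (w + t *\<^sub>R d) - conj_value (w + 0 *\<^sub>R d)\<bar> \<le> (\<bar>?k 0\<bar> + C) * \<bar>t - 0\<bar>"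
      by (rule field_bound_convex[where I = ?I, OF _ has_field_derivative_at_within[OF conj_line_deriv(1)[OF I]] k])
        (use t s0 in auto)
    also have "\<dots> \<le> (\<bar>?k 0\<bar> + C) * 1" using t s C0 by (intro mult_left_mono) auto
    finally show ?thesis by (simp add: B_def)
  qed
  have "(w + s *\<^sub>R d) \<bullet> x - F x \<le> B" if x: "x \<in> interior K" for x
  proof (rule tendsto_upperbound)
    show "((\<lambda>t. (w + t *\<^sub>R d) \<bullet> x - F x) \<longlongrightarrow> (w + s *\<^sub>R d) \<bullet> x - F x) (at_left s)"
      by (intro tendsto_intros)
    show "eventually (\<lambda>t. (w + t *\<^sub>R d) \<bullet> x - F x \<le> B) (at_left s)"
    proof (rule eventually_at_leftI[OF _ s0])
      fix t assume "t \<in> {0<..<s}"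
      then have t: "t \<in> ?I" by simp
      show "(w + t *\<^sub>R d) \<bullet> x - F x \<le> B" using conj_value_upper[OF I[OF t] x] B[OF t] by linarith
    qed
  qed simp
  then have "w + s *\<^sub>R d \<in> grad_range" using grad_range_iff by blast
  then show False using s by simp
qed

context
  fixes w d r
  assumes w: "w \<in> grad_range" and r: "op_norm (conj_hess w) d = r" "r < 1"
begin

lemma radius_nonneg: "0 \<le> r"
  using op_norm_nonneg[OF pd_conj_hess[OF w]] r by blast

lemma segment_radius: "0 \<le> t \<Longrightarrow> t \<le> 1 \<Longrightarrow> 0 \<le> t * r" "0 \<le> t \<Longrightarrow> t \<le> 1 \<Longrightarrow> t * r < 1"
  using radius_nonneg r mult_left_le_one_le[of r t] by auto

lemma segment_grad_range: "0 \<le> t \<Longrightarrow> t \<le> 1 \<Longrightarrow> w + t *\<^sub>R d \<in> grad_range"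
  using segment_radius(2)[of t] r by (intro grad_range_Dikin w) (simp add: op_norm_scale[OF pd_conj_hess[OF w]])

lemma segment_direction: "0 \<le> t \<Longrightarrow> t \<le> 1 \<Longrightarrow> op_norm (conj_hess (w + t *\<^sub>R d)) d \<le> r / (1 - t * r)"
  by (rule conj_line_self_concordant[where I = "{0..1}"])
    (use segment_grad_range segment_radius r in auto)

text \<open>The squared norm \<open>n\<close> of \<open>u\<close> along the segment satisfies the differential inequality
  \<open>\<bar>n' s\<bar> * (1 - s * r) \<le> 2 * r * n s\<close>. Hence \<open>n s / (1 - s * r)\<^sup>2\<close> increases and
  \<open>n s * (1 - s * r)\<^sup>2\<close> decreases.\<close>

lemma segment_hess:
  assumes t: "0 \<le> t" "t \<le> 1"
  shows "(1 - t * r) * op_norm (conj_hess w) u \<le> op_norm (conj_hess (w + t *\<^sub>R d)) u"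
    "op_norm (conj_hess (w + t *\<^sub>R d)) u \<le> op_norm (conj_hess w) u / (1 - t * r)"
proof -
  let ?n = "\<lambda>t. conj_hess (w + t *\<^sub>R d) u \<bullet> u"
  let ?n' = "\<lambda>t. - (T (grad_inv (w + t *\<^sub>R d)) (conj_hess (w + t *\<^sub>R d) d) (conj_hess (w + t *\<^sub>R d) u)
            \<bullet> conj_hess (w + t *\<^sub>R d) u)"
  have n0: "0 \<le> ?n s" if "0 \<le> s" "s \<le> 1" for s
    by (rule pd_nonneg[OF pd_conj_hess[OF segment_grad_range[OF that]]])
  have n': "\<bar>?n' s\<bar> * (1 - s * r) \<le> 2 * r * ?n s" if s: "0 \<le> s" "s \<le> 1" for s
  proof -
    have "\<bar>?n' s\<bar> \<le> 2 * op_norm (conj_hess (w + s *\<^sub>R d)) d * ?n s"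
      using conj_third_derivative_bound[OF segment_grad_range[OF s], of d u]
      by (simp add: op_norm_sq[OF pd_conj_hess[OF segment_grad_range[OF s]]])
    also have "\<dots> \<le> 2 * (r / (1 - s * r)) * ?n s"
      using segment_direction[OF s] n0[OF s] by (intro mult_right_mono) auto
    finally show ?thesis using segment_radius(2)[OF s] by (simp add: field_simps)
  qed
  have "?n 0 / (1 - 0 * r)\<^sup>2 \<le> ?n t / (1 - t * r)\<^sup>2"
  proof (rule DERIV_nonneg_imp_nondecreasing[OF t(1)])
    fix s assume "0 \<le> s" "s \<le> t"
    then have s: "0 \<le> s" "s \<le> 1" using t by auto
    have pos: "0 < 1 - s * r" using segment_radius(2)[OF s] by simp
    have "((\<lambda>s. ?n s / (1 - s * r)\<^sup>2) has_real_derivative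
        (?n' s * (1 - s * r) + 2 * r * ?n s) / (1 - s * r) ^ 3) (at s)"
      using pos by (auto intro!: derivative_eq_intros conj_line_deriv(3)[OF segment_grad_range[OF s]]
          simp: power2_eq_square power3_eq_cube divide_simps) (simp add: algebra_simps)
    moreover have "0 \<le> ?n' s * (1 - s * r) + 2 * r * ?n s"
      using n'[OF s] abs_le_D2[of "?n' s * (1 - s * r)" "2 * r * ?n s"] pos by (simp add: abs_mult)
    ultimately show "\<exists>y. ((\<lambda>s. ?n s / (1 - s * r)\<^sup>2) has_real_derivative y) (at s) \<and> 0 \<le> y"
      using pos by (meson divide_nonneg_pos zero_less_power)
  qed
  then have "(1 - t * r)\<^sup>2 * ?n 0 \<le> ?n t" using segment_radius(2)[OF t] by (simp add: field_simps)
  then have "sqrt ((1 - t * r)\<^sup>2 * ?n 0) \<le> sqrt (?n t)" by (rule real_sqrt_le_mono)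
  then show "(1 - t * r) * op_norm (conj_hess w) u \<le> op_norm (conj_hess (w + t *\<^sub>R d)) u"
    using segment_radius(2)[OF t] by (simp add: op_norm_def real_sqrt_mult)
  have "?n t * (1 - t * r)\<^sup>2 \<le> ?n 0 * (1 - 0 * r)\<^sup>2"
  proof (rule DERIV_nonpos_imp_nonincreasing[OF t(1)])
    fix s assume "0 \<le> s" "s \<le> t"
    then have s: "0 \<le> s" "s \<le> 1" using t by auto
    have pos: "0 < 1 - s * r" using segment_radius(2)[OF s] by simp
    have "((\<lambda>s. ?n s * (1 - s * r)\<^sup>2) has_real_derivative
        (?n' s * (1 - s * r) - 2 * r * ?n s) * (1 - s * r)) (at s)"
      using pos by (auto intro!: derivative_eq_intros conj_line_deriv(3)[OF segment_grad_range[OF s]]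
          simp: power2_eq_square) (simp add: algebra_simps)
    moreover have "?n' s * (1 - s * r) - 2 * r * ?n s \<le> 0"
      using n'[OF s] abs_le_D1[of "?n' s * (1 - s * r)" "2 * r * ?n s"] pos by (simp add: abs_mult)
    ultimately show "\<exists>y. ((\<lambda>s. ?n s * (1 - s * r)\<^sup>2) has_real_derivative y) (at s) \<and> y \<le> 0"
      using pos by (meson less_imp_le mult_nonpos_nonneg)
  qed
  then have "sqrt (?n t * (1 - t * r)\<^sup>2) \<le> sqrt (?n 0)" by simp
  then show "op_norm (conj_hess (w + t *\<^sub>R d)) u \<le> op_norm (conj_hess w) u / (1 - t * r)"
    using segment_radius(2)[OF t] by (simp add: op_norm_def real_sqrt_mult field_simps)
qed

text \<open>The component of \<open>grad_inv\<close> along \<open>u\<close>, a function on the segment, is compared twice with explicit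
  functions of \<open>1 - s * r\<close>, starting from the bound \<open>2 r\<^sup>2 N / (1 - s * r)\<^sup>3\<close> on its second
  derivative; here \<open>N\<close> is the norm of \<open>u\<close> at \<open>w\<close>.\<close>

lemma segment_gradient:
  "\<bar>(grad_inv (w + d) - grad_inv w - conj_hess w d) \<bullet> u\<bar> \<le> r\<^sup>2 / (1 - r) * op_norm (conj_hess w) u"
proof -
  let ?N = "op_norm (conj_hess w) u"
  let ?k = "\<lambda>t. grad_inv (w + t *\<^sub>R d) \<bullet> u" and ?k' = "\<lambda>t. conj_hess (w + t *\<^sub>R d) d \<bullet> u"
  let ?k'' = "\<lambda>t. - (T (grad_inv (w + t *\<^sub>R d)) (conj_hess (w + t *\<^sub>R d) d) (conj_hess (w + t *\<^sub>R d) d)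
            \<bullet> conj_hess (w + t *\<^sub>R d) u)"
  have k'': "\<bar>?k'' t\<bar> \<le> 2 * r\<^sup>2 * ?N / (1 - t * r) ^ 3" if t: "0 \<le> t" "t \<le> 1" for t
  proof -
    note W = segment_grad_range[OF t]
    have pos: "0 < 1 - t * r" using segment_radius(2)[OF t] by simp
    have "\<bar>?k'' t\<bar> = \<bar>T (grad_inv (w + t *\<^sub>R d)) (conj_hess (w + t *\<^sub>R d) u) (conj_hess (w + t *\<^sub>R d) d)
            \<bullet> conj_hess (w + t *\<^sub>R d) d\<bar>"
      using T_symmetric[OF grad_inv(1)[OF W]] by (metis abs_minus_cancel)
    also have "\<dots> \<le> 2 * op_norm (conj_hess (w + t *\<^sub>R d)) u * (op_norm (conj_hess (w + t *\<^sub>R d)) d)\<^sup>2"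
      by (rule conj_third_derivative_bound[OF W])
    also have "\<dots> \<le> 2 * (?N / (1 - t * r)) * (r / (1 - t * r))\<^sup>2"
      using segment_hess(2)[OF t] segment_direction[OF t] op_norm_nonneg[OF pd_conj_hess[OF W]]
        op_norm_nonneg[OF pd_conj_hess[OF w]] pos
      by (intro mult_mono power_mono) auto
    also have "\<dots> = 2 * r\<^sup>2 * ?N / (1 - t * r) ^ 3"
      by (simp add: power_divide power2_eq_square power3_eq_cube mult_ac)
    finally show ?thesis .
  qed
  have k': "\<bar>?k' t - ?k' 0\<bar> \<le> r * ?N / (1 - t * r)\<^sup>2 - r * ?N / (1 - 0 * r)\<^sup>2" if t: "0 \<le> t" "t \<le> 1" for t
  proof (rule derivative_comparison[OF t(1)])
    fix s assume "0 \<le> s" "s \<le> t"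
    then have s: "0 \<le> s" "s \<le> 1" using t by auto
    show "(?k' has_real_derivative ?k'' s) (at s)" by (rule conj_line_deriv(3)[OF segment_grad_range[OF s]])
    show "((\<lambda>s. r * ?N / (1 - s * r)\<^sup>2) has_real_derivative 2 * r\<^sup>2 * ?N / (1 - s * r) ^ 3) (at s)"
      using segment_radius(2)[OF s]
      by (auto intro!: derivative_eq_intros simp: power2_eq_square power3_eq_cube divide_simps)
    show "\<bar>?k'' s\<bar> \<le> 2 * r\<^sup>2 * ?N / (1 - s * r) ^ 3" by (rule k''[OF s])
  qed
  have "\<bar>(?k 1 - 1 * ?k' 0) - (?k 0 - 0 * ?k' 0)\<bar> \<le>
      (?N / (1 - 1 * r) - r * ?N * 1) - (?N / (1 - 0 * r) - r * ?N * 0)"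
  proof (rule derivative_comparison)
    fix s :: real assume s: "0 \<le> s" "s \<le> 1"
    show "((\<lambda>t. ?k t - t * ?k' 0) has_real_derivative ?k' s - ?k' 0) (at s)"
      using segment_grad_range[OF s] by (auto intro!: derivative_eq_intros conj_line_deriv(2))
    show "((\<lambda>s. ?N / (1 - s * r) - r * ?N * s) has_real_derivative r * ?N / (1 - s * r)\<^sup>2 - r * ?N) (at s)"
      using segment_radius(2)[OF s] by (auto intro!: derivative_eq_intros simp: power2_eq_square)
    show "\<bar>?k' s - ?k' 0\<bar> \<le> r * ?N / (1 - s * r)\<^sup>2 - r * ?N" using k'[OF s] by simp
  qed simp
  moreover have "?N / (1 - r) - r * ?N - ?N = r\<^sup>2 / (1 - r) * ?N"
    using r(2) by (simp add: field_simps power2_eq_square)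
  ultimately show ?thesis by (simp add: inner_diff_left algebra_simps)
qed

end

end

section \<open>The dual barrier\<close>

lemma local_norm_eq: "local_norm \<phi> y u = op_norm (hess \<phi> y) u"
  by (simp add: local_norm_def op_norm_def)

lemma local_dual_norm_eq: "local_dual_norm \<phi> y v = op_dual_norm (hess \<phi> y) v"
  by (simp add: local_dual_norm_def op_dual_norm_def)

locale conic_dual = cone_barrier K F \<nu> G H T
  for K :: "'a::euclidean_space set" and F \<nu> G H T +
  fixes f :: "'a \<Rightarrow> ereal" and L :: "'a \<Rightarrow> 'b::euclidean_space" and q :: 'a
  assumes f_interior: "\<And>x. x \<in> interior K \<Longrightarrow> f x = ereal (F x)"
    and f_outside: "\<And>x. x \<notin> interior K \<Longrightarrow> f x = \<infinity>"
    and L: "linear L" "surj L"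
    and \<nu>: "0 < \<nu>"
begin

lemma conjugate_over_grad_range:
  assumes w: "w \<in> grad_range"
  shows "conjugate_over K f w = ereal (conj_value w)"
  unfolding conjugate_over_def
proof (rule antisym)
  show "(SUP x\<in>K. ereal (w \<bullet> x) - f x) \<le> ereal (conj_value w)"
  proof (rule SUP_least)
    fix x show "ereal (w \<bullet> x) - f x \<le> ereal (conj_value w)"
      using conj_value_upper[OF w, of x] f_interior[of x] f_outside[of x]
      by (cases "x \<in> interior K") auto
  qed
  have "ereal (conj_value w) = ereal (w \<bullet> grad_inv w) - f (grad_inv w)"
    using grad_inv(1)[OF w] by (simp add: conj_value_def f_interior)
  also have "\<dots> \<le> (SUP x\<in>K. ereal (w \<bullet> x) - f x)"
    using grad_inv(1)[OF w] interior_subset by (intro SUP_upper) blast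
  finally show "ereal (conj_value w) \<le> (SUP x\<in>K. ereal (w \<bullet> x) - f x)" .
qed

text \<open>Outside the interior of \<open>K\<close> the barrier is infinite, so finiteness of the supremum means that
  \<open>\<langle>w, x\<rangle> - F x\<close> is bounded above on the interior.\<close>

lemma conjugate_over_finite_iff: "conjugate_over K f w < \<infinity> \<longleftrightarrow> w \<in> grad_range"
proof
  assume fin: "conjugate_over K f w < \<infinity>"
  have le: "ereal (w \<bullet> x - F x) \<le> conjugate_over K f w" if "x \<in> interior K" for x
    using SUP_upper[of x K "\<lambda>x. ereal (w \<bullet> x) - f x"] that interior_subset f_interior[OF that]
    by (auto simp: conjugate_over_def)
  obtain x0 where "x0 \<in> interior K" using K(5) by blast
  from le[OF this] fin obtain B where "conjugate_over K f w = ereal B"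
    by (cases "conjugate_over K f w") auto
  then show "w \<in> grad_range" using le grad_range_iff by auto
qed (simp add: conjugate_over_grad_range)

lemma grad_conjugate: 
  assumes w: "w \<in> grad_range"
  shows "grad (conjugate_over K f) w = grad_inv w"
proof (rule gderiv_grad)
  show "((\<lambda>z. real_of_ereal (conjugate_over K f z)) has_derivative (\<lambda>h. grad_inv w \<bullet> h)) (at w)"
    by (rule has_derivative_transform_within_open[OF conj_value_deriv[OF w] open_grad_range w])
      (simp add: conjugate_over_grad_range)
qed

text \<open>The conjugate is again logarithmically homogeneous.\<close>

lemma grad_inv_scale:
  assumes w: "w \<in> grad_range" and r: "0 < r"
  shows "(1 / r) *\<^sub>R w \<in> grad_range" "grad_inv ((1 / r) *\<^sub>R w) = r *\<^sub>R grad_inv w"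
proof -
  have x: "r *\<^sub>R grad_inv w \<in> interior K" by (rule scale_interior[OF grad_inv(1)[OF w] r])
  have G: "G (r *\<^sub>R grad_inv w) = (1 / r) *\<^sub>R w"
    using G_scale[OF grad_inv(1)[OF w] r] grad_inv(2)[OF w] by simp
  show "(1 / r) *\<^sub>R w \<in> grad_range" using x G by (metis grad_range_def imageI)
  show "grad_inv ((1 / r) *\<^sub>R w) = r *\<^sub>R grad_inv w" using grad_inv_G[OF x] G by simp
qed

abbreviation "\<phi> \<equiv> dual_barrier K f L q"

abbreviation "slack y \<equiv> q - adjoint L y"

lemma edom_phi: "y \<in> edom \<phi> \<longleftrightarrow> slack y \<in> grad_range"
  unfolding edom_def dual_barrier_def mem_Collect_eq by (rule conjugate_over_finite_iff)

lemma slack_deriv: "(slack has_derivative (\<lambda>h. - adjoint L h)) (at y)"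
proof -
  have "bounded_linear (adjoint L)" using adjoint_linear[OF L(1)] by (simp add: linear_conv_bounded_linear)
  from has_derivative_diff[OF has_derivative_const bounded_linear_imp_has_derivative[OF this], of q]
  show ?thesis by simp
qed

lemma open_edom_phi: "open (edom \<phi>)"
proof -
  have "continuous_on UNIV slack"
    by (rule has_derivative_continuous_on[OF has_derivative_at_withinI[OF slack_deriv]])
  then have "open (slack -` grad_range)" by (intro open_vimage open_grad_range)
  moreover have "slack -` grad_range = edom \<phi>" by (auto simp: edom_phi)
  ultimately show ?thesis by simp
qed

lemma grad_phi:
  assumes y: "y \<in> edom \<phi>"
  shows "grad \<phi> y = - L (grad_inv (slack y))"
proof (rule gderiv_grad)
  have w: "slack y \<in> grad_range" using y by (simp add: edom_phi)
  have d: "((\<lambda>y. conj_value (slack y)) has_derivative (\<lambda>h. (- L (grad_inv (slack y))) \<bullet> h)) (at y)"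
    using has_derivative_compose[OF slack_deriv conj_value_deriv[OF w]]
    by (simp add: adjoint_works[OF L(1)])
  show "((\<lambda>z. real_of_ereal (\<phi> z)) has_derivative (\<lambda>h. (- L (grad_inv (slack y))) \<bullet> h)) (at y)"
    by (rule has_derivative_transform_within_open[OF d open_edom_phi y])
      (simp add: dual_barrier_def edom_phi conjugate_over_grad_range)
qed

lemma hess_phi:
  assumes y: "y \<in> edom \<phi>"
  shows "hess \<phi> y = (\<lambda>u. L (conj_hess (slack y) (adjoint L u)))"
proof -
  have w: "slack y \<in> grad_range" using y by (simp add: edom_phi)
  have bl: "bounded_linear L" using L(1) by (simp add: linear_conv_bounded_linear)
  have "((\<lambda>y. - L (grad_inv (slack y))) has_derivative (\<lambda>h. - L (conj_hess (slack y) (- adjoint L h)))) (at y)"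
    by (intro has_derivative_minus bounded_linear.has_derivative[OF bl]
        has_derivative_compose[OF slack_deriv grad_inv_deriv[OF w]])
  also have "(\<lambda>h. - L (conj_hess (slack y) (- adjoint L h))) = (\<lambda>h. L (conj_hess (slack y) (adjoint L h)))"
    by (simp add: linear_neg[OF pd_linear[OF pd_conj_hess[OF w]]] linear_neg[OF L(1)])
  finally have "(grad \<phi> has_derivative (\<lambda>h. L (conj_hess (slack y) (adjoint L h)))) (at y)"
    by (rule has_derivative_transform_within_open[OF _ open_edom_phi y]) (simp add: grad_phi)
  then show ?thesis unfolding hess_def by (metis frechet_derivative_at)
qed

lemma hess_phi_inner:
  assumes "y \<in> edom \<phi>"
  shows "hess \<phi> y u \<bullet> v = conj_hess (slack y) (adjoint L u) \<bullet> adjoint L v"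
  by (simp add: hess_phi[OF assms] adjoint_works[OF L(1)])

lemma op_norm_hess_phi:
  assumes "y \<in> edom \<phi>"
  shows "op_norm (hess \<phi> y) u = op_norm (conj_hess (slack y)) (adjoint L u)"
  by (simp add: op_norm_def hess_phi_inner[OF assms])

text \<open>Surjectivity of \<open>L\<close> makes its adjoint injective.\<close>

lemma pd_hess_phi:
  assumes y: "y \<in> edom \<phi>"
  shows "pd_op (hess \<phi> y)"
proof -
  have P: "pd_op (conj_hess (slack y))" using y by (simp add: edom_phi pd_conj_hess)
  have lin: "linear (hess \<phi> y)"
    unfolding hess_phi[OF y]
    using linear_compose[OF linear_compose[OF adjoint_linear[OF L(1)] pd_linear[OF P]] L(1)] by (simp add: o_def)
  have inj: "adjoint L u \<noteq> 0" if "u \<noteq> 0" for u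
  proof
    assume 0: "adjoint L u = 0"
    obtain x where "L x = u" using L(2) by (metis surjD)
    then have "u \<bullet> u = 0" using adjoint_works[OF L(1), of x u] 0 by simp
    then show False using that by simp
  qed
  show ?thesis
    using lin pd_sym[OF P] pd_pos[OF P] inj by (simp add: pd_op_def hess_phi_inner[OF y])
qed

lemma op_norm_H_self: "x \<in> interior K \<Longrightarrow> op_norm (H x) x = sqrt \<nu>"
  by (simp add: op_norm_def H_self G_inner_self)

text \<open>The barrier parameter of the dual barrier is \<open>\<nu>\<close>: the pairing of \<open>grad \<phi> y\<close> with \<open>u\<close> is minus
  that of \<open>adjoint L u\<close> with \<open>x = grad_inv (slack y)\<close>, and \<open>x\<close> has norm \<open>sqrt \<nu>\<close> at itself.\<close>

lemma grad_phi_bound: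
  assumes y: "y \<in> edom \<phi>"
  shows "\<bar>grad \<phi> y \<bullet> u\<bar> \<le> sqrt \<nu> * op_norm (hess \<phi> y) u"
proof -
  let ?x = "grad_inv (slack y)"
  have x: "?x \<in> interior K" using y by (simp add: edom_phi grad_inv)
  have "\<bar>grad \<phi> y \<bullet> u\<bar> = \<bar>adjoint L u \<bullet> ?x\<bar>"
    using adjoint_works[OF L(1), of ?x u] by (simp add: grad_phi[OF y] inner_commute)
  also have "\<dots> \<le> op_dual_norm (H ?x) (adjoint L u) * op_norm (H ?x) ?x"
    by (rule dual_pairing_le[OF pd_H[OF x]])
  finally show ?thesis
    by (simp add: op_norm_H_self[OF x] op_norm_hess_phi[OF y] conj_hess_def op_dual_norm_eq mult.commute)
qed

lemma dual_barrier_self_concordant: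
  assumes y: "y \<in> edom \<phi>" and r: "op_norm (hess \<phi> y) d = r" "r < 1"
  shows "y + d \<in> edom \<phi>"
    "(1 - r) * op_norm (hess \<phi> y) u \<le> op_norm (hess \<phi> (y + d)) u"
    "\<bar>(grad \<phi> (y + d) - grad \<phi> y - hess \<phi> y d) \<bullet> u\<bar> \<le> r\<^sup>2 / (1 - r) * op_norm (hess \<phi> y) u"
proof -
  let ?w = "slack y" and ?d = "- adjoint L d"
  have w: "?w \<in> grad_range" using y by (simp add: edom_phi)
  note P = pd_conj_hess[OF w]
  have rd: "op_norm (conj_hess ?w) ?d = r" using r(1) by (simp add: op_norm_hess_phi[OF y] op_norm_minus[OF P])
  have sl: "slack (y + d) = ?w + ?d" by (simp add: linear_add[OF adjoint_linear[OF L(1)]])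
  show yd: "y + d \<in> edom \<phi>" unfolding edom_phi sl using rd r(2) by (intro grad_range_Dikin w) simp
  show "(1 - r) * op_norm (hess \<phi> y) u \<le> op_norm (hess \<phi> (y + d)) u"
    using segment_hess(1)[OF w rd r(2), of 1 "adjoint L u"]
    by (simp add: op_norm_hess_phi[OF y] op_norm_hess_phi[OF yd] sl)
  have "grad \<phi> (y + d) - grad \<phi> y - hess \<phi> y d
      = - L (grad_inv (?w + ?d) - grad_inv ?w - conj_hess ?w ?d)"
    unfolding grad_phi[OF yd] grad_phi[OF y] hess_phi[OF y] sl
    by (simp add: linear_diff[OF L(1)] linear_add[OF L(1)] linear_neg[OF pd_linear[OF P]] linear_neg[OF L(1)])
  then show "\<bar>(grad \<phi> (y + d) - grad \<phi> y - hess \<phi> y d) \<bullet> u\<bar> \<le> r\<^sup>2 / (1 - r) * op_norm (hess \<phi> y) u"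
    using segment_gradient[OF w rd r(2), of "adjoint L u"]
    by (simp add: op_norm_hess_phi[OF y] adjoint_works[OF L(1)])
qed

text \<open>By homogeneity \<open>x = t * grad_inv (slack y)\<close>, and \<open>adjoint L y - q\<close> is the image of \<open>t * x\<close> under
  the Hessian at \<open>x\<close>.\<close>

lemma primal_point:
  assumes y: "y \<in> edom \<phi>" and t: "0 < t"
    and x: "x = grad (conjugate_over K f) ((1 / t) *\<^sub>R (q - adjoint L y))"
  shows "x \<in> interior K" "L x = - (t *\<^sub>R grad \<phi> y)"
    "op_dual_norm (H x) (adjoint L y - q) = sqrt \<nu> * t"
proof -
  have w: "slack y \<in> grad_range" using y by (simp add: edom_phi)
  have x': "x = t *\<^sub>R grad_inv (slack y)"
    using x grad_conjugate[OF grad_inv_scale(1)[OF w t]] grad_inv_scale(2)[OF w t] by simp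
  show xi: "x \<in> interior K" unfolding x' by (rule scale_interior[OF grad_inv(1)[OF w] t])
  show "L x = - (t *\<^sub>R grad \<phi> y)" by (simp add: x' grad_phi[OF y] linear_cmul[OF L(1)])
  have Gx: "G x = (1 / t) *\<^sub>R slack y"
    using G_scale[OF grad_inv(1)[OF w] t] grad_inv(2)[OF w] by (simp add: x')
  have "H x (t *\<^sub>R x) = adjoint L y - q" using H_self[OF xi] Gx t by (simp add: blinfun.scaleR_right)
  then have "op_dual_norm (H x) (adjoint L y - q) = op_norm (H x) (t *\<^sub>R x)"
    using op_norm_inv[OF pd_H[OF xi], of "adjoint L y - q"] pd_inv(2)[OF pd_H[OF xi], of "t *\<^sub>R x"] by simp
  then show "op_dual_norm (H x) (adjoint L y - q) = sqrt \<nu> * t"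
    using t by (simp add: op_norm_scale[OF pd_H[OF xi]] op_norm_H_self[OF xi])
qed

end

section \<open>Conjugates and subdifferentials\<close>

lemma subdiff_finite: "s \<in> subdiff F y \<Longrightarrow> \<bar>F y\<bar> \<noteq> \<infinity>"
  and subdiff_le: "s \<in> subdiff F y \<Longrightarrow> F y + ereal (s \<bullet> (z - y)) \<le> F z"
  by (auto simp: subdiff_def)

lemma subdiff_monotone:
  assumes "\<xi> \<in> subdiff F x" "\<zeta> \<in> subdiff F z"
  shows "0 \<le> (\<xi> - \<zeta>) \<bullet> (x - z)"
proof -
  obtain a b where ab: "F x = ereal a" "F z = ereal b"
    using subdiff_finite[OF assms(1)] subdiff_finite[OF assms(2)] by auto
  have "a + \<xi> \<bullet> (z - x) \<le> b" "b + \<zeta> \<bullet> (x - z) \<le> a"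
    using subdiff_le[OF assms(1), of z] subdiff_le[OF assms(2), of x] ab by auto
  then show ?thesis by (simp add: inner_diff_left inner_diff_right)
qed

lemma closed_subdiff: "closed (subdiff F y)"
proof (cases "\<bar>F y\<bar> = \<infinity>")
  case False
  have "closed {v. F y + ereal (v \<bullet> (z - y)) \<le> F z}" for z
  proof -
    obtain a where a: "F y = ereal a" using False by auto
    show ?thesis
    proof (cases "F z")
      case (real b)
      then show ?thesis using closed_halfspace_le[of "z - y" "b - a"]
        by (simp add: a inner_commute algebra_simps)
    qed (simp_all add: a)
  qed
  then have "closed (\<Inter>z. {v. F y + ereal (v \<bullet> (z - y)) \<le> F z})" by blast
  moreover have "subdiff F y = (\<Inter>z. {v. F y + ereal (v \<bullet> (z - y)) \<le> F z})"
    using False by (auto simp: subdiff_def)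
  ultimately show ?thesis by simp
qed (simp add: subdiff_def)

lemma conjugate_upper: "ereal (y \<bullet> s) - g s \<le> conjugate_over UNIV g y"
  unfolding conjugate_over_def by (rule SUP_upper) simp

lemma proper_fun_finite_point:
  assumes "proper_fun g" obtains s r where "g s = ereal r"
proof -
  obtain s where "g s < \<infinity>" using assms by (auto simp: proper_fun_def edom_def)
  then show ?thesis using that assms by (cases "g s") (auto simp: proper_fun_def)
qed

text \<open>The Fenchel--Moreau theorem at a subgradient of the conjugate. Let \<open>\<alpha> = \<langle>y, s\<rangle> - g\<^sup>* y\<close>. The
  subgradient inequality says \<open>\<langle>s, z\<rangle> - g\<^sup>* z \<le> \<alpha>\<close> for all \<open>z\<close>. If \<open>g s\<close> exceeded \<open>\<alpha>\<close>, a hyperplane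
  separating \<open>(s, \<alpha>)\<close> from the epigraph would produce a \<open>z\<close> that violates this. Hence \<open>g s \<le> \<alpha>\<close>, and
  the definition of the conjugate turns this into the claim.\<close>

lemma subdiff_conjugate_imp_subdiff:
  fixes g :: "'b::euclidean_space \<Rightarrow> ereal"
  assumes g: "proper_fun g" "closed_fun g" "convex_fun g"
    and s: "s \<in> subdiff (conjugate_over UNIV g) y"
  shows "y \<in> subdiff g s"
proof -
  let ?G = "conjugate_over UNIV g"
  obtain a where a: "?G y = ereal a" using subdiff_finite[OF s] by auto
  define \<alpha> where "\<alpha> = y \<bullet> s - a"
  have lower: "ereal (y \<bullet> z - a) \<le> g z" for z
    using conjugate_upper[of y z g] a g(1) by (cases "g z") (auto simp: proper_fun_def)
  have upper: "s \<bullet> z - r \<le> \<alpha>" if "?G z \<le> ereal r" for z r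
  proof -
    have "ereal (a + s \<bullet> (z - y)) \<le> ereal r" using order_trans[OF subdiff_le[OF s, of z] that] a by simp
    then show ?thesis by (simp add: \<alpha>_def inner_diff_right inner_commute)
  qed
  have "(s, \<alpha>) \<in> epi g"
  proof (rule ccontr)
    assume "(s, \<alpha>) \<notin> epi g"
    then have "\<exists>p \<gamma>. p \<bullet> (s, \<alpha>) < \<gamma> \<and> (\<forall>x\<in>epi g. \<gamma> < p \<bullet> x)"
      using g(2,3) unfolding closed_fun_def convex_fun_def
      by (intro separating_hyperplane_closed_point)
    then obtain p \<gamma> where p: "p \<bullet> (s, \<alpha>) < \<gamma>" "\<And>x. x \<in> epi g \<Longrightarrow> \<gamma> < p \<bullet> x" by blast
    obtain v \<rho> where vp: "p = (v, \<rho>)" by (cases p)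
    have sep: "v \<bullet> s + \<rho> * \<alpha> < \<gamma>" using p(1) by (simp add: vp inner_Pair)
    have epi: "\<gamma> < v \<bullet> z + \<rho> * r" if "g z \<le> ereal r" for z r
      using p(2)[of "(z, r)"] that by (simp add: epi_def vp inner_Pair)
    obtain z0 r0 where z0: "g z0 = ereal r0" using proper_fun_finite_point[OF g(1)] .
    have \<rho>0: "0 \<le> \<rho>"
    proof (rule ccontr)
      assume "\<not> 0 \<le> \<rho>"
      then have \<rho>: "\<rho> < 0" by simp
      define r where "r = max r0 ((\<gamma> - v \<bullet> z0) / \<rho>)"
      have "\<gamma> < v \<bullet> z0 + \<rho> * r" by (rule epi) (simp add: z0 r_def)
      moreover have "\<rho> * r \<le> \<rho> * ((\<gamma> - v \<bullet> z0) / \<rho>)" using \<rho> by (intro mult_left_mono_neg) (auto simp: r_def)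
      ultimately show False using \<rho> by simp
    qed
    show False
    proof (cases "\<rho> = 0")
      case True
      \<comment> \<open>A vertical hyperplane: tilting y away from it lowers the conjugate too fast.\<close>
      have "?G (y - v) \<le> ereal (a - \<gamma>)" unfolding conjugate_over_def
      proof (rule SUP_least)
        fix z show "ereal ((y - v) \<bullet> z) - g z \<le> ereal (a - \<gamma>)"
        proof (cases "g z")
          case (real r)
          then have "\<gamma> < v \<bullet> z" using epi[of z r] True by simp
          moreover have "y \<bullet> z - a \<le> r" using lower[of z] real by simp
          ultimately show ?thesis using real by (simp add: inner_diff_left)
        qed (use g(1) in \<open>auto simp: proper_fun_def\<close>)
      qed
      from upper[OF this] sep True show False by (simp add: \<alpha>_def inner_diff_right inner_commute)
    next
      case False
      then have \<rho>: "0 < \<rho>" using \<rho>0 by simp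
      let ?u = "(- 1 / \<rho>) *\<^sub>R v"
      have "?G ?u \<le> ereal (- (\<gamma> / \<rho>))" unfolding conjugate_over_def
      proof (rule SUP_least)
        fix z show "ereal (?u \<bullet> z) - g z \<le> ereal (- (\<gamma> / \<rho>))"
        proof (cases "g z")
          case (real r)
          then have "\<gamma> < v \<bullet> z + \<rho> * r" using epi[of z r] by simp
          then have "\<gamma> / \<rho> \<le> (v \<bullet> z + \<rho> * r) / \<rho>" using \<rho> by (intro divide_right_mono) auto
          then show ?thesis using real \<rho> by (simp add: add_divide_distrib)
        qed (use g(1) in \<open>auto simp: proper_fun_def\<close>)
      qed
      from upper[OF this] have "- (v \<bullet> s) / \<rho> + \<gamma> / \<rho> \<le> \<alpha>" by (simp add: inner_commute)
      moreover have "(v \<bullet> s + \<rho> * \<alpha>) / \<rho> < \<gamma> / \<rho>" using sep \<rho> by (intro divide_strict_right_mono)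
      ultimately show False using \<rho> by (simp add: add_divide_distrib)
    qed
  qed
  then have gs: "g s \<le> ereal \<alpha>" by (simp add: epi_def)
  have gs': "g s = ereal \<alpha>" using gs lower[of s] by (simp add: \<alpha>_def)
  have "g s + ereal (y \<bullet> (z - s)) \<le> g z" for z
    using lower[of z] by (simp add: gs' \<alpha>_def inner_diff_right)
  then show ?thesis using gs' by (simp add: subdiff_def)
qed

lemma conjugate_gt_minus_infinity:
  assumes "proper_fun g" shows "conjugate_over UNIV g y \<noteq> - \<infinity>"
proof -
  obtain s r where "g s = ereal r" using proper_fun_finite_point[OF assms] .
  then show ?thesis using conjugate_upper[of y s g] by auto
qed

lemma dual_nonsmooth_affine_minorant:
  assumes "proper_fun g" obtains a c where "\<And>u. ereal (a \<bullet> u + c) \<le> dual_nonsmooth g b u"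
proof -
  obtain s r where sr: "g s = ereal r" using proper_fun_finite_point[OF assms] .
  have "ereal ((s + b) \<bullet> u + - r) \<le> dual_nonsmooth g b u" for u
    using add_right_mono[OF conjugate_upper[of u s g], of "ereal (b \<bullet> u)"] sr
    by (simp add: dual_nonsmooth_def inner_add_left inner_commute algebra_simps)
  then show ?thesis by (rule that)
qed

lemma subdiff_dual_nonsmooth:
  assumes "proper_fun g"
  shows "\<xi> \<in> subdiff (dual_nonsmooth g b) y \<longleftrightarrow> \<xi> - b \<in> subdiff (conjugate_over UNIV g) y"
proof -
  let ?G = "conjugate_over UNIV g"
  have "(?G y + ereal (b \<bullet> y) + ereal (\<xi> \<bullet> (z - y)) \<le> ?G z + ereal (b \<bullet> z)) \<longleftrightarrow>
      (?G y + ereal ((\<xi> - b) \<bullet> (z - y)) \<le> ?G z)" for z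
    using conjugate_gt_minus_infinity[OF assms, of y] conjugate_gt_minus_infinity[OF assms, of z]
    by (cases "?G y"; cases "?G z") (auto simp: inner_diff_left inner_diff_right)
  moreover have "\<bar>?G y + ereal (b \<bullet> y)\<bar> \<noteq> \<infinity> \<longleftrightarrow> \<bar>?G y\<bar> \<noteq> \<infinity>" by (cases "?G y") auto
  ultimately show ?thesis by (simp add: subdiff_def dual_nonsmooth_def)
qed

text \<open>The epigraph is an intersection of half-spaces, one for each point of the domain of \<open>g\<close>.\<close>

lemma dual_nonsmooth_closed_convex:
  assumes g: "proper_fun g"
  shows "closed_fun (dual_nonsmooth g b)" "convex_fun (dual_nonsmooth g b)"
proof -
  let ?E = "\<lambda>s. {p. ereal (fst p \<bullet> s) - g s + ereal (b \<bullet> fst p) \<le> ereal (snd p)}"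
  have "epi (dual_nonsmooth g b) = (\<Inter>s. ?E s)"
  proof -
    have "dual_nonsmooth g b y \<le> ereal r \<longleftrightarrow> (\<forall>s. ereal (y \<bullet> s) - g s + ereal (b \<bullet> y) \<le> ereal r)" for y r
    proof -
      have "dual_nonsmooth g b y \<le> ereal r \<longleftrightarrow> conjugate_over UNIV g y \<le> ereal (r - b \<bullet> y)"
        unfolding dual_nonsmooth_def by (cases "conjugate_over UNIV g y") auto
      also have "\<dots> \<longleftrightarrow> (\<forall>s. ereal (y \<bullet> s) - g s \<le> ereal (r - b \<bullet> y))"
        by (simp add: conjugate_over_def SUP_le_iff)
      also have "\<dots> \<longleftrightarrow> (\<forall>s. ereal (y \<bullet> s) - g s + ereal (b \<bullet> y) \<le> ereal r)"
      proof (rule all_cong1)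
        fix s show "(ereal (y \<bullet> s) - g s \<le> ereal (r - b \<bullet> y)) = (ereal (y \<bullet> s) - g s + ereal (b \<bullet> y) \<le> ereal r)"
          by (cases "g s") auto
      qed
      finally show ?thesis .
    qed
    then show ?thesis by (auto simp: epi_def)
  qed
  moreover have "closed (?E s) \<and> convex (?E s)" for s
  proof (cases "g s")
    case (real r)
    then have "?E s = {p. (s + b, - 1) \<bullet> p \<le> r}"
      by (auto simp: inner_Pair inner_add_left inner_commute algebra_simps)
    then show ?thesis by (simp add: closed_halfspace_le convex_halfspace_le)
  qed (use g in \<open>auto simp: proper_fun_def\<close>)
  ultimately show "closed_fun (dual_nonsmooth g b)" "convex_fun (dual_nonsmooth g b)"
    unfolding closed_fun_def convex_fun_def by (auto intro!: closed_INT convex_INT)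
qed

section \<open>Minimizing a quadratic plus a closed convex function\<close>

context
  fixes P :: "'b::euclidean_space \<Rightarrow> 'b" and \<psi> :: "'b \<Rightarrow> ereal" and w y a :: 'b and t c :: real
  assumes P: "pd_op P" and \<psi>: "closed_fun \<psi>" "convex_fun \<psi>"
    and minorant: "\<And>u. ereal (a \<bullet> u + c) \<le> \<psi> u"
    and t: "0 < t"
begin

definition quad_model :: "'b \<Rightarrow> real" where
  "quad_model u = w \<bullet> (u - y) + 1 / 2 * (P (u - y) \<bullet> (u - y))"

definition prox_model :: "'b \<Rightarrow> ereal" where
  "prox_model u = ereal (quad_model u) + ereal (1 / t) * \<psi> u"

lemma quad_model_expand:
  "quad_model (u + e *\<^sub>R d) = quad_model u + e * ((w + P (u - y)) \<bullet> d) + e\<^sup>2 * (P d \<bullet> d / 2)"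
proof -
  have eq: "u + e *\<^sub>R d - y = (u - y) + e *\<^sub>R d" by simp
  have "quad_model (u + e *\<^sub>R d) = w \<bullet> (u - y) + e * (w \<bullet> d)
      + 1 / 2 * (P (u - y) \<bullet> (u - y) + 2 * e * (P (u - y) \<bullet> d) + e\<^sup>2 * (P d \<bullet> d))"
    unfolding quad_model_def eq pd_expand[OF P] by (simp only: inner_add_right inner_scaleR_right)
  then show ?thesis by (simp add: quad_model_def inner_add_left distrib_left)
qed

lemma prox_model_le_iff: "prox_model u \<le> ereal r \<longleftrightarrow> \<psi> u \<le> ereal (t * (r - quad_model u))"
  using t minorant[of u] by (cases "\<psi> u") (auto simp: prox_model_def field_simps)

lemma psi_cases: obtains r where "\<psi> u = ereal r" | "\<psi> u = \<infinity>"
  using minorant[of u] by (cases "\<psi> u") auto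

lemma prox_model_not_minus_infinity: "prox_model u \<noteq> - \<infinity>"
  using t by (cases rule: psi_cases[of u]) (auto simp: prox_model_def)

lemma continuous_on_quad_model: "continuous_on S quad_model"
proof -
  have "continuous_on S (\<lambda>u. P (u - y))"
    using pd_linear[OF P] by (intro linear_continuous_on_compose[of S "\<lambda>u. u - y" P] continuous_intros)
  then show ?thesis unfolding quad_model_def by (intro continuous_intros)
qed

lemma closed_prox_sublevel: "closed {u. prox_model u \<le> ereal r}"
proof -
  have "continuous_on UNIV (\<lambda>u. (u, t * (r - quad_model u)))"
    by (intro continuous_intros continuous_on_quad_model)
  then have "closed ((\<lambda>u. (u, t * (r - quad_model u))) -` epi \<psi>)"
    using \<psi>(1) by (intro closed_vimage) (auto simp: closed_fun_def)
  moreover have "(\<lambda>u. (u, t * (r - quad_model u))) -` epi \<psi> = {u. prox_model u \<le> ereal r}"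
    by (auto simp: epi_def prox_model_le_iff)
  ultimately show ?thesis by simp
qed

lemma prox_model_coercive:
  obtains k M where "\<And>u r. prox_model u \<le> ereal r \<Longrightarrow> (op_norm P (u - y))\<^sup>2 / 2 \<le> r + k * op_norm P (u - y) + M"
proof -
  define l where "l = w + (1 / t) *\<^sub>R a"
  define k where "k = op_dual_norm P l"
  define M where "M = - (a \<bullet> y + c) / t"
  have "(op_norm P (u - y))\<^sup>2 / 2 \<le> r + k * op_norm P (u - y) + M" if "prox_model u \<le> ereal r" for u r
  proof -
    have "ereal (a \<bullet> u + c) \<le> ereal (t * (r - quad_model u))"
      using minorant[of u] that unfolding prox_model_le_iff by (rule order_trans)
    then have "(a \<bullet> u + c) / t \<le> r - quad_model u" using t by (simp add: field_simps)
    moreover have "(a \<bullet> u + c) / t = ((1 / t) *\<^sub>R a) \<bullet> (u - y) - M"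
      by (simp add: M_def inner_diff_right add_divide_distrib diff_divide_distrib)
    moreover have "- (l \<bullet> (u - y)) \<le> k * op_norm P (u - y)"
      using dual_pairing_le[OF P, of l "u - y"] by (simp add: k_def abs_le_iff)
    ultimately show ?thesis
      by (simp add: quad_model_def l_def inner_add_left op_norm_sq[OF P])
  qed
  then show ?thesis by (rule that)
qed

text \<open>Sublevel sets are closed because \<open>\<psi>\<close> is, and bounded because the quadratic term dominates the
  affine minorant; the nested ones just above the infimum have a common point.\<close>

lemma prox_model_minimizer_exists:
  assumes "\<psi> u0 < \<infinity>"
  obtains u where "\<And>z. prox_model u \<le> prox_model z"
proof -
  obtain k M where kM: "\<And>u r. prox_model u \<le> ereal r \<Longrightarrow>
      (op_norm P (u - y))\<^sup>2 / 2 \<le> r + k * op_norm P (u - y) + M"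
    using prox_model_coercive by blast
  let ?S = "\<lambda>r. {u. prox_model u \<le> ereal r}"
  have bdS: "bounded (?S r)" for r
  proof (rule bounded_subset[OF op_norm_ball_bounded[OF P, of y "2 * \<bar>k\<bar> + 2 * \<bar>r + M\<bar> + 1"]], rule subsetI, rule CollectI)
    fix u assume u: "u \<in> ?S r"
    let ?n = "op_norm P (u - y)"
    show "?n \<le> 2 * \<bar>k\<bar> + 2 * \<bar>r + M\<bar> + 1"
    proof (rule ccontr)
      assume "\<not> ?thesis"
      then have big: "2 * \<bar>k\<bar> + 2 * \<bar>r + M\<bar> + 1 < ?n" by simp
      have "0 \<le> 2 * \<bar>k\<bar> + 2 * \<bar>r + M\<bar>" by simp
      with big have n1: "1 \<le> ?n" by (meson add_le_same_cancel2 le_add_same_cancel2 less_imp_le order_trans)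
      have "(2 * \<bar>k\<bar> + 2 * \<bar>r + M\<bar>) * ?n < ?n * ?n" using big n1 by (intro mult_strict_right_mono) auto
      moreover have "k * ?n \<le> \<bar>k\<bar> * ?n" using n1 by (intro mult_right_mono) auto
      moreover have "\<bar>r + M\<bar> * 1 \<le> \<bar>r + M\<bar> * ?n" using n1 by (intro mult_left_mono) auto
      ultimately show False using kM[of u r] u by (simp add: power2_eq_square distrib_right)
    qed
  qed
  define I where "I = {r. ?S r \<noteq> {}}"
  have bdd: "bdd_below I"
  proof (rule bdd_belowI)
    fix r assume "r \<in> I"
    then obtain u where "prox_model u \<le> ereal r" by (auto simp: I_def)
    from kM[OF this] have "(op_norm P (u - y))\<^sup>2 / 2 - k * op_norm P (u - y) \<le> r + M" by simp
    moreover have "(op_norm P (u - y) - k)\<^sup>2 = (op_norm P (u - y))\<^sup>2 - 2 * (k * op_norm P (u - y)) + k\<^sup>2"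
      by (simp add: power2_diff)
    moreover have "0 \<le> (op_norm P (u - y) - k)\<^sup>2" by simp
    ultimately show "- (k\<^sup>2 / 2) - M \<le> r" by linarith
  qed
  have "I \<noteq> {}"
  proof -
    obtain r where r: "\<psi> u0 = ereal r" using assms by (cases rule: psi_cases[of u0]) auto
    have "u0 \<in> ?S (quad_model u0 + r / t)" by (simp add: prox_model_def r)
    then show ?thesis unfolding I_def by blast
  qed
  define \<rho> where "\<rho> = Inf I"
  let ?C = "\<lambda>n::nat. ?S (\<rho> + 1 / real (Suc n))"
  have mono: "?S r \<subseteq> ?S r'" if "r \<le> r'" for r r' using that by (auto intro: order_trans)
  have "?C n \<noteq> {}" for n
  proof -
    obtain r where "r \<in> I" "r < \<rho> + 1 / real (Suc n)"
      using cInf_lessD[OF \<open>I \<noteq> {}\<close>, of "\<rho> + 1 / real (Suc n)"] by (auto simp: \<rho>_def)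
    then show ?thesis using mono[of r "\<rho> + 1 / real (Suc n)"] unfolding I_def by auto
  qed
  moreover have "compact (?C n)" for n using bdS closed_prox_sublevel by (simp add: compact_eq_bounded_closed)
  moreover have "?C n \<subseteq> ?C m" if "m \<le> n" for m n using that by (intro mono) (simp add: frac_le)
  ultimately have "\<Inter>(range ?C) \<noteq> {}" by (intro compact_nest) auto
  then obtain u where u: "\<And>n. prox_model u \<le> ereal (\<rho> + 1 / real (Suc n))" by auto
  have "prox_model u \<le> prox_model z" for z
  proof (cases "prox_model z")
    case (real r)
    then have "r \<in> I" by (auto simp: I_def intro!: exI[of _ z])
    then have "\<rho> \<le> r" unfolding \<rho>_def by (rule cInf_lower[OF _ bdd])
    moreover have "prox_model u \<le> ereal \<rho>"
    proof (rule tendsto_lowerbound)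
      have "(\<lambda>n. \<rho> + 1 / real (Suc n)) \<longlonglongrightarrow> \<rho> + 0"
        using LIMSEQ_inverse_real_of_nat by (intro tendsto_intros) (simp add: inverse_eq_divide)
      then show "(\<lambda>n. ereal (\<rho> + 1 / real (Suc n))) \<longlonglongrightarrow> ereal \<rho>" by simp
    qed (use u in auto)
    ultimately show ?thesis using real order_trans[of "prox_model u" "ereal \<rho>" "ereal r"] by simp
  qed (use prox_model_not_minus_infinity in auto)
  then show ?thesis by (rule that)
qed

text \<open>Moving from \<open>u\<close> towards \<open>z\<close> by a fraction \<open>e\<close> does not lower the model. Dividing by \<open>e\<close> and letting
  \<open>e\<close> tend to 0 leaves the subgradient inequality, by convexity of \<open>\<psi>\<close>.\<close>

lemma prox_model_minimizer_optimality:
  assumes fin: "\<psi> u0 < \<infinity>" and min: "\<And>z. prox_model u \<le> prox_model z"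
  shows "- (t *\<^sub>R (w + P (u - y))) \<in> subdiff \<psi> u"
proof -
  obtain r0 where r0: "\<psi> u0 = ereal r0" using fin by (cases rule: psi_cases[of u0]) auto
  obtain A where A: "\<psi> u = ereal A"
    using min[of u0] t r0 by (cases rule: psi_cases[of u]) (auto simp: prox_model_def)
  have "ereal A + ereal (- (t *\<^sub>R (w + P (u - y))) \<bullet> (z - u)) \<le> \<psi> z" for z
  proof (cases rule: psi_cases[of z])
    case (1 B)
    let ?l = "(w + P (u - y)) \<bullet> (z - u) + (B - A) / t" and ?p = "P (z - u) \<bullet> (z - u)"
    have step: "0 \<le> ?l + e * (?p / 2)" if e: "0 < e" "e < 1" for e
    proof -
      let ?v = "u + e *\<^sub>R (z - u)"
      have "(1 - e) *\<^sub>R (u, A) + e *\<^sub>R (z, B) \<in> epi \<psi>"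
        using convexD[of "epi \<psi>" "(u, A)" "(z, B)" "1 - e" e] \<psi>(2) e 1 A by (auto simp: convex_fun_def epi_def)
      then have "\<psi> ?v \<le> ereal ((1 - e) * A + e * B)" by (simp add: epi_def algebra_simps)
      then have v: "prox_model ?v \<le> ereal (quad_model ?v + ((1 - e) * A + e * B) / t)"
        using t by (simp add: prox_model_le_iff)
      have "prox_model u = ereal (quad_model u + A / t)" by (simp add: prox_model_def A)
      with order_trans[OF min[of ?v] v]
      have "quad_model u + A / t \<le> quad_model ?v + ((1 - e) * A + e * B) / t" by simp
      moreover have "quad_model ?v = quad_model u + e * ((w + P (u - y)) \<bullet> (z - u)) + e\<^sup>2 * (?p / 2)"
        by (rule quad_model_expand)
      moreover have "((1 - e) * A + e * B) / t = A / t + e * ((B - A) / t)"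
        by (simp add: add_divide_distrib diff_divide_distrib algebra_simps)
      ultimately have "0 \<le> e * (?l + e * (?p / 2))" by (simp add: power2_eq_square distrib_left mult.assoc)
      then show ?thesis using e by (simp add: zero_le_mult_iff)
    qed
    have "0 \<le> ?l"
    proof (rule tendsto_lowerbound)
      have "((\<lambda>e. ?l + e * (?p / 2)) \<longlongrightarrow> ?l + 0 * (?p / 2)) (at_right 0)" by (intro tendsto_intros)
      then show "((\<lambda>e. ?l + e * (?p / 2)) \<longlongrightarrow> ?l) (at_right 0)" by simp
      show "eventually (\<lambda>e. 0 \<le> ?l + e * (?p / 2)) (at_right 0)"
        using step by (intro eventually_at_rightI[of 0 1]) auto
    qed simp
    then have "0 \<le> t * ?l" using t by simp
    then show ?thesis using 1 t by (simp add: distrib_left)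
  qed simp
  then show ?thesis using A by (simp add: subdiff_def)
qed

end

section \<open>The path-following scheme\<close>

locale dual_path_following = conic_dual K F \<nu> G H T f L q
  for K :: "'a::euclidean_space set" and F \<nu> G H T and f :: "'a \<Rightarrow> ereal"
    and L :: "'a \<Rightarrow> 'b::euclidean_space" and q +
  fixes g :: "'b \<Rightarrow> ereal" and b :: 'b
  assumes g: "proper_fun g" "closed_fun g" "convex_fun g"
begin

abbreviation "\<psi> \<equiv> dual_nonsmooth g b"

text \<open>The defining choice of a minimizer of the model is meaningful because one exists.\<close>

lemma newton_decrement_point:
  assumes y: "y \<in> edom \<phi>" and t: "0 < t" and sub: "subdiff \<psi> y \<noteq> {}"
  obtains u where "newton_decrement \<phi> \<psi> t y = op_norm (hess \<phi> y) (y - u)"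
    "- (t *\<^sub>R (grad \<phi> y + hess \<phi> y (u - y))) \<in> subdiff \<psi> u"
proof -
  have fin: "\<psi> y < \<infinity>" using sub subdiff_finite by fastforce
  obtain a c where minorant: "\<And>u. ereal (a \<bullet> u + c) \<le> \<psi> u"
    using dual_nonsmooth_affine_minorant[OF g(1)] by blast
  note prox = pd_hess_phi[OF y] dual_nonsmooth_closed_convex[OF g(1)] minorant t
  have model: "prox_newton_model \<phi> \<psi> t y = prox_model (hess \<phi> y) \<psi> (grad \<phi> y) y t"
    by (rule ext) (simp add: prox_newton_model_def prox_model_def[OF prox] quad_model_def[OF prox])
  define u where "u = (ARG_MIN (prox_newton_model \<phi> \<psi> t y) u. True)"
  obtain v where "\<And>z. prox_newton_model \<phi> \<psi> t y v \<le> prox_newton_model \<phi> \<psi> t y z"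
    unfolding model using prox_model_minimizer_exists[OF prox fin] by blast
  then have "is_arg_min (prox_newton_model \<phi> \<psi> t y) (\<lambda>_. True) v" by (simp add: is_arg_min_def not_less)
  then have "is_arg_min (prox_newton_model \<phi> \<psi> t y) (\<lambda>_. True) u"
    unfolding u_def arg_min_def by (rule someI)
  then have min: "prox_newton_model \<phi> \<psi> t y u \<le> prox_newton_model \<phi> \<psi> t y z" for z
    by (simp add: is_arg_min_def not_less)
  show ?thesis
  proof (rule that)
    show "newton_decrement \<phi> \<psi> t y = op_norm (hess \<phi> y) (y - u)"
      by (simp add: newton_decrement_def local_norm_eq u_def)
    show "- (t *\<^sub>R (grad \<phi> y + hess \<phi> y (u - y))) \<in> subdiff \<psi> u"
      using prox_model_minimizer_optimality[OF prox fin] min unfolding model by blast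
  qed
qed

lemma inexact_newton_step_nonempty:
  assumes "inexact_newton_step \<phi> \<psi> t w \<delta> y y'"
  shows "subdiff \<psi> y' \<noteq> {}"
proof
  assume "subdiff \<psi> y' = {}"
  then show False
    using assms by (simp add: inexact_newton_step_def local_dist_def newton_residuals_def top_ereal_def)
qed

lemma inexact_newton_step_residual:
  assumes y: "y \<in> edom \<phi>" and step: "inexact_newton_step \<phi> \<psi> t w \<delta> y y'"
  obtains \<xi> where "\<xi> \<in> subdiff \<psi> y'"
    "op_dual_norm (hess \<phi> y) (t *\<^sub>R (w + hess \<phi> y (y' - y)) + \<xi>) \<le> t * \<delta>"
proof -
  let ?m = "t *\<^sub>R (w + hess \<phi> y (y' - y))"
  note P = pd_op_inv[OF pd_hess_phi[OF y]]
  obtain \<xi> where \<xi>: "\<xi> \<in> subdiff \<psi> y'"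
    "\<And>\<zeta>. \<zeta> \<in> subdiff \<psi> y' \<Longrightarrow> op_norm (inv (hess \<phi> y)) (- ?m - \<xi>) \<le> op_norm (inv (hess \<phi> y)) (- ?m - \<zeta>)"
    using op_norm_projection_exists[OF P closed_subdiff inexact_newton_step_nonempty[OF step]] by blast
  have sw: "op_norm (inv (hess \<phi> y)) (- ?m - \<zeta>) = op_dual_norm (hess \<phi> y) (?m + \<zeta>)" for \<zeta>
    using op_norm_minus[OF P, of "?m + \<zeta>"] by (simp add: op_dual_norm_eq)
  have "ereal (op_dual_norm (hess \<phi> y) (?m + \<xi>)) \<le> local_dist \<phi> y (newton_residuals \<phi> \<psi> t w y y')"
    unfolding local_dist_def newton_residuals_def
    using \<xi>(2) unfolding sw by (intro INF_greatest) (auto simp: local_dual_norm_eq)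
  also have "\<dots> \<le> ereal (t * \<delta>)" using step by (simp add: inexact_newton_step_def)
  finally show ?thesis using that[OF \<xi>(1)] by simp
qed

text \<open>Let \<open>u\<close> and \<open>u'\<close> be the exact proximal Newton points for \<open>t\<close> and \<open>(1 - \<sigma>) * t\<close>, and \<open>z = u' - u\<close>.
  Monotonicity of the subdifferential between them bounds the norm of \<open>z\<close> by \<open>\<sigma> / (1 - \<sigma>)\<close> times the
  dual norm of \<open>grad \<phi> y + hess \<phi> y (u - y)\<close>, which is at most \<open>sqrt \<nu> + \<beta>\<close>.\<close>

lemma predictor_bound:
  assumes y: "y \<in> edom \<phi>" and t: "0 < t" and \<sigma>: "0 < \<sigma>" "\<sigma> < 1" and sub: "subdiff \<psi> y \<noteq> {}"
    and dec: "newton_decrement \<phi> \<psi> t y \<le> \<beta>"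
  shows "newton_decrement \<phi> \<psi> ((1 - \<sigma>) * t) y \<le> \<beta> + \<sigma> / (1 - \<sigma>) * (sqrt \<nu> + \<beta>)"
proof -
  let ?P = "hess \<phi> y" and ?N = "op_norm (hess \<phi> y)" and ?t' = "(1 - \<sigma>) * t"
  note P = pd_hess_phi[OF y]
  have t': "0 < ?t'" using t \<sigma> by simp
  obtain u where u: "newton_decrement \<phi> \<psi> t y = ?N (y - u)"
    "- (t *\<^sub>R (grad \<phi> y + ?P (u - y))) \<in> subdiff \<psi> u" using newton_decrement_point[OF y t sub] .
  obtain u' where u': "newton_decrement \<phi> \<psi> ?t' y = ?N (y - u')"
    "- (?t' *\<^sub>R (grad \<phi> y + ?P (u' - y))) \<in> subdiff \<psi> u'" using newton_decrement_point[OF y t' sub] .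
  define z where "z = u' - u"
  define m where "m = grad \<phi> y + ?P (u - y)"
  have Pz: "grad \<phi> y + ?P (u' - y) = m + ?P z"
    using linear_add[OF pd_linear[OF P], of "u - y" z] by (simp add: m_def z_def add.assoc)
  have "0 \<le> (- (?t' *\<^sub>R (m + ?P z)) - - (t *\<^sub>R m)) \<bullet> z"
    using subdiff_monotone[OF u'(2) u(2)] unfolding Pz m_def[symmetric] z_def .
  then have "t * ((1 - \<sigma>) * (?N z)\<^sup>2) \<le> t * (\<sigma> * (m \<bullet> z))"
    by (simp add: inner_diff_left inner_add_left op_norm_sq[OF P] algebra_simps)
  then have "(1 - \<sigma>) * (?N z)\<^sup>2 \<le> \<sigma> * (m \<bullet> z)" using t by simp
  also have "m \<bullet> z \<le> (sqrt \<nu> + \<beta>) * ?N z"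
  proof -
    have "m \<bullet> z \<le> sqrt \<nu> * ?N z + ?N (u - y) * ?N z"
      using grad_phi_bound[OF y, of z] pd_Cauchy_Schwarz[OF P, of "u - y" z]
      by (simp add: m_def inner_add_left abs_le_iff)
    also have "\<dots> \<le> sqrt \<nu> * ?N z + \<beta> * ?N z"
      using dec u(1) op_norm_minus_commute[OF P, of u y] op_norm_nonneg[OF P, of z]
      by (intro add_left_mono mult_right_mono) auto
    finally show ?thesis by (simp add: distrib_right)
  qed
  finally have "((1 - \<sigma>) * ?N z) * ?N z \<le> (\<sigma> * (sqrt \<nu> + \<beta>)) * ?N z"
    using \<sigma> by (simp add: power2_eq_square mult.assoc)
  moreover have "0 \<le> \<beta>" using dec u(1) op_norm_nonneg[OF P, of "y - u"] by simp
  ultimately have "(1 - \<sigma>) * ?N z \<le> \<sigma> * (sqrt \<nu> + \<beta>)"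
    using op_norm_nonneg[OF P, of z] \<sigma> \<nu> by (cases "?N z = 0") (auto simp: mult_le_cancel_right)
  then have "?N z \<le> \<sigma> / (1 - \<sigma>) * (sqrt \<nu> + \<beta>)" using \<sigma> by (simp add: field_simps)
  moreover have "?N (y - u') \<le> ?N (y - u) + ?N z"
    using op_norm_triangle[OF P, of "y - u" "- z"] op_norm_minus[OF P, of z] by (simp add: z_def)
  ultimately show ?thesis using dec u(1) u'(1) by simp
qed

text \<open>The model is strongly convex with modulus 1 in the local norm, and its optimality condition
  appears here multiplied by \<open>t\<close>; a residual of size \<open>t * \<delta>\<close> therefore moves the minimizer by at most
  \<open>\<delta>\<close>.\<close>

lemma inexact_step_radius:
  assumes y: "y \<in> edom \<phi>" and t: "0 < t" and sub: "subdiff \<psi> y \<noteq> {}" and \<delta>: "0 \<le> \<delta>"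
    and \<xi>: "\<xi> \<in> subdiff \<psi> y'"
    and res: "op_dual_norm (hess \<phi> y) (t *\<^sub>R (grad \<phi> y + hess \<phi> y (y' - y)) + \<xi>) \<le> t * \<delta>"
  shows "op_norm (hess \<phi> y) (y' - y) \<le> newton_decrement \<phi> \<psi> t y + \<delta>"
proof -
  let ?P = "hess \<phi> y" and ?N = "op_norm (hess \<phi> y)"
  note P = pd_hess_phi[OF y]
  obtain u where u: "newton_decrement \<phi> \<psi> t y = ?N (y - u)"
    "- (t *\<^sub>R (grad \<phi> y + ?P (u - y))) \<in> subdiff \<psi> u" using newton_decrement_point[OF y t sub] .
  define z where "z = y' - u"
  define e where "e = t *\<^sub>R (grad \<phi> y + ?P (y' - y)) + \<xi>"
  have Pz: "?P (y' - y) = ?P (u - y) + ?P z"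
    using linear_add[OF pd_linear[OF P], of "u - y" z] by (simp add: z_def)
  have "0 \<le> (\<xi> - - (t *\<^sub>R (grad \<phi> y + ?P (u - y)))) \<bullet> z"
    using subdiff_monotone[OF \<xi> u(2)] unfolding z_def .
  also have "\<xi> - - (t *\<^sub>R (grad \<phi> y + ?P (u - y))) = e - t *\<^sub>R ?P z"
    unfolding e_def Pz by (simp add: algebra_simps)
  finally have "t * (?N z)\<^sup>2 \<le> e \<bullet> z" by (simp add: inner_diff_left op_norm_sq[OF P])
  also have "\<dots> \<le> (t * \<delta>) * ?N z"
    using dual_pairing_le[OF P, of e z] mult_right_mono[OF res op_norm_nonneg[OF P, of z]]
    by (simp add: e_def)
  finally have "?N z * ?N z \<le> \<delta> * ?N z" using t by (simp add: power2_eq_square mult.assoc)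
  then have "?N z \<le> \<delta>"
    using op_norm_nonneg[OF P, of z] \<delta> by (cases "?N z = 0") (auto simp: mult_le_cancel_right)
  moreover have "?N (y' - y) \<le> ?N (y - u) + ?N z"
    using op_norm_triangle[OF P, of "u - y" z] op_norm_minus_commute[OF P, of u y] by (simp add: z_def)
  ultimately show ?thesis using u(1) by simp
qed

text \<open>The residual at the new point is the old residual plus \<open>t\<close> times the error of linearizing the
  gradient. Both are measured at \<open>y\<close>; passing to the dual norm at \<open>y'\<close> costs a factor \<open>1 / (1 - r)\<close>.\<close>

lemma inexact_step_optimality:
  assumes y: "y \<in> edom \<phi>" and t: "0 < t" and \<delta>: "0 \<le> \<delta>" "\<delta> \<le> \<delta>'"
    and r: "op_norm (hess \<phi> y) (y' - y) \<le> r" "r < 1"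
    and res: "op_dual_norm (hess \<phi> y) (t *\<^sub>R (grad \<phi> y + hess \<phi> y (y' - y)) + \<xi>) \<le> t * \<delta>"
  shows "y' \<in> edom \<phi>"
    "op_dual_norm (hess \<phi> y') (t *\<^sub>R grad \<phi> y' + \<xi>) \<le> t * (\<delta>' / (1 - r) + (r / (1 - r))\<^sup>2)"
proof -
  let ?P = "hess \<phi> y" and ?N = "op_norm (hess \<phi> y)"
  note P = pd_hess_phi[OF y]
  define d where "d = y' - y"
  define r0 where "r0 = ?N d"
  have y': "y' = y + d" by (simp add: d_def)
  have r0: "0 \<le> r0" "r0 \<le> r" "r0 < 1" using r op_norm_nonneg[OF P] by (auto simp: r0_def d_def)
  note SC = dual_barrier_self_concordant[OF y r0_def[symmetric] r0(3), folded y']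
  show yd: "y' \<in> edom \<phi>" by (rule SC(1))
  define e where "e = t *\<^sub>R (grad \<phi> y + ?P d) + \<xi>"
  define C where "C = \<delta>' / (1 - r) + (r / (1 - r))\<^sup>2"
  have C: "(r\<^sup>2 / (1 - r) + \<delta>') = C * (1 - r)"
  proof -
    have "(r / (1 - r))\<^sup>2 * (1 - r) = r\<^sup>2 / (1 - r)" using r(2) by (simp add: power2_eq_square)
    then show ?thesis using r(2) by (simp add: C_def distrib_right)
  qed
  have C0: "0 \<le> C" using \<delta> r(2) by (simp add: C_def)
  show "op_dual_norm (hess \<phi> y') (t *\<^sub>R grad \<phi> y' + \<xi>) \<le> t * (\<delta>' / (1 - r) + (r / (1 - r))\<^sup>2)"
    unfolding C_def[symmetric]
  proof (rule op_dual_norm_leI[OF pd_hess_phi[OF yd]])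
    fix u
    have N0: "0 \<le> ?N u" by (rule op_norm_nonneg[OF P])
    have split: "t *\<^sub>R grad \<phi> y' + \<xi> = t *\<^sub>R (grad \<phi> y' - grad \<phi> y - ?P d) + e"
      by (simp add: e_def algebra_simps)
    have "\<bar>(t *\<^sub>R grad \<phi> y' + \<xi>) \<bullet> u\<bar> \<le> t * \<bar>(grad \<phi> y' - grad \<phi> y - ?P d) \<bullet> u\<bar> + \<bar>e \<bullet> u\<bar>"
      using t abs_triangle_ineq[of "t * ((grad \<phi> y' - grad \<phi> y - ?P d) \<bullet> u)" "e \<bullet> u"]
      unfolding split inner_add_left inner_scaleR_left abs_mult by simp
    also have "\<dots> \<le> t * (r0\<^sup>2 / (1 - r0) * ?N u) + t * \<delta> * ?N u"
      using SC(3)[of u] t dual_pairing_le[OF P, of e u] mult_right_mono[OF res N0]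
      by (intro add_mono mult_left_mono) (auto simp: e_def d_def)
    also have "\<dots> = t * ((r0\<^sup>2 / (1 - r0) + \<delta>) * ?N u)" by (simp add: algebra_simps)
    also have "\<dots> \<le> t * ((r\<^sup>2 / (1 - r) + \<delta>') * ?N u)"
      using r0 r(2) \<delta> t N0 by (intro mult_left_mono mult_right_mono add_mono frac_le power_mono) auto
    also have "\<dots> = t * (C * ((1 - r) * ?N u))" unfolding C by (simp add: mult.assoc)
    also have "\<dots> \<le> t * (C * ((1 - r0) * ?N u))"
      using t C0 N0 r0 by (intro mult_left_mono mult_right_mono) auto
    also have "\<dots> \<le> t * (C * op_norm (hess \<phi> y') u)"
      using t C0 SC(2)[of u] by (intro mult_left_mono) auto
    finally show "\<bar>(t *\<^sub>R grad \<phi> y' + \<xi>) \<bullet> u\<bar> \<le> t * C * op_norm (hess \<phi> y') u" by (simp add: mult.assoc)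
  qed (use t C0 in simp)
qed

text \<open>The strong convexity argument again, now for the model at \<open>y\<close> itself with \<open>y\<close> as approximate
  minimizer.\<close>

lemma newton_decrement_le_residual:
  assumes y: "y \<in> edom \<phi>" and t: "0 < t" and \<xi>: "\<xi> \<in> subdiff \<psi> y"
    and res: "op_dual_norm (hess \<phi> y) (t *\<^sub>R grad \<phi> y + \<xi>) \<le> t * C" and C: "0 \<le> C"
  shows "newton_decrement \<phi> \<psi> t y \<le> C"
proof -
  let ?P = "hess \<phi> y" and ?N = "op_norm (hess \<phi> y)"
  note P = pd_hess_phi[OF y]
  obtain u where u: "newton_decrement \<phi> \<psi> t y = ?N (y - u)"
    "- (t *\<^sub>R (grad \<phi> y + ?P (u - y))) \<in> subdiff \<psi> u"
    using newton_decrement_point[OF y t] \<xi> by blast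
  define z where "z = y - u"
  have Pz: "?P (u - y) = - ?P z" using linear_neg[OF pd_linear[OF P], of z] by (simp add: z_def)
  have "0 \<le> (\<xi> - - (t *\<^sub>R (grad \<phi> y + ?P (u - y)))) \<bullet> z"
    using subdiff_monotone[OF \<xi> u(2)] unfolding z_def .
  also have "\<xi> - - (t *\<^sub>R (grad \<phi> y + ?P (u - y))) = (t *\<^sub>R grad \<phi> y + \<xi>) - t *\<^sub>R ?P z"
    unfolding Pz by (simp add: algebra_simps)
  finally have "t * (?N z)\<^sup>2 \<le> (t *\<^sub>R grad \<phi> y + \<xi>) \<bullet> z"
    by (simp add: inner_diff_left op_norm_sq[OF P])
  also have "\<dots> \<le> (t * C) * ?N z"
    using dual_pairing_le[OF P, of "t *\<^sub>R grad \<phi> y + \<xi>" z] mult_right_mono[OF res op_norm_nonneg[OF P, of z]]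
    by linarith
  finally have "?N z * ?N z \<le> C * ?N z" using t by (simp add: power2_eq_square mult.assoc)
  then have "?N z \<le> C"
    using op_norm_nonneg[OF P, of z] C by (cases "?N z = 0") (auto simp: mult_le_cancel_right)
  then show ?thesis using u(1) by (simp add: z_def)
qed

text \<open>One cycle of the induction: the decrement at \<open>y\<close> is at most \<open>\<beta>\<close> for \<open>t\<close>, at most
  \<open>c * sqrt \<beta> / (1 + c * sqrt \<beta>)\<close> for the reduced parameter, and at the new point again at most
  \<open>\<theta> c \<beta> \<le> \<beta>\<close>.\<close>

lemma path_following_step:
  assumes c: "0 < c" "c \<le> 1" and \<beta>: "0 < \<beta>" "\<beta> < 0.5 * (1 + 2 * c\<^sup>2 - sqrt (1 + 4 * c\<^sup>2))"
    and \<nu>1: "1 \<le> \<nu>" and \<sigma>: "0 < \<sigma>" "\<sigma> \<le> \<sigma>_bound \<nu> c \<beta>" and \<delta>: "0 \<le> \<delta>" "\<delta> \<le> \<delta>_bound c \<beta>"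
    and y: "y \<in> edom \<phi>" and t: "0 < t" and sub: "subdiff \<psi> y \<noteq> {}"
    and dec: "newton_decrement \<phi> \<psi> t y \<le> \<beta>"
    and step: "inexact_newton_step \<phi> \<psi> ((1 - \<sigma>) * t) (grad \<phi> y) \<delta> y y'"
  obtains \<xi> where "y' \<in> edom \<phi>" "\<xi> \<in> subdiff \<psi> y'"
    "op_dual_norm (hess \<phi> y') (((1 - \<sigma>) * t) *\<^sub>R grad \<phi> y' + \<xi>) \<le> ((1 - \<sigma>) * t) * \<theta> c \<beta>"
    "newton_decrement \<phi> \<psi> ((1 - \<sigma>) * t) y' \<le> \<beta>"
proof -
  note S = sigma_bound_step[OF c \<beta> \<nu>1 \<sigma>] and r1 = step_radius_less_1[OF c \<beta>]
    and \<theta>_eq = theta_step_radius[OF c \<beta>]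
  let ?t = "(1 - \<sigma>) * t" and ?r = "step_radius c \<beta>"
  have t': "0 < ?t" using t S(1) by simp
  obtain \<xi> where \<xi>: "\<xi> \<in> subdiff \<psi> y'"
    "op_dual_norm (hess \<phi> y) (?t *\<^sub>R (grad \<phi> y + hess \<phi> y (y' - y)) + \<xi>) \<le> ?t * \<delta>"
    using inexact_newton_step_residual[OF y step] .
  have "op_norm (hess \<phi> y) (y' - y) \<le> newton_decrement \<phi> \<psi> ?t y + \<delta>"
    by (rule inexact_step_radius[OF y t' sub \<delta>(1) \<xi>])
  also have "\<dots> \<le> ?r"
    using predictor_bound[OF y t \<sigma>(1) S(1) sub dec] S(2) \<delta>(2) by (simp add: step_radius_def)
  finally have r: "op_norm (hess \<phi> y) (y' - y) \<le> ?r" .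
  note O = inexact_step_optimality[OF y t' \<delta> r r1 \<xi>(2), folded \<theta>_eq]
  have \<theta>0: "0 \<le> \<theta> c \<beta>" unfolding \<theta>_eq using r1 delta_bound_nonneg[OF c \<beta>] by simp
  have "newton_decrement \<phi> \<psi> ?t y' \<le> \<theta> c \<beta>"
    by (rule newton_decrement_le_residual[OF O(1) t' \<xi>(1) O(2) \<theta>0])
  then show ?thesis using that[OF O(1) \<xi>(1) O(2)] theta_le_beta[OF c \<beta>] by simp
qed

lemma phase1_output_facts:
  assumes "phase1_output \<phi> \<psi> Y t0 \<beta> y0"
  shows "y0 \<in> edom \<phi>" "subdiff \<psi> y0 \<noteq> {}" "newton_decrement \<phi> \<psi> t0 y0 \<le> \<beta>"
proof -
  obtain m z \<tau> \<eta> \<xi> \<zeta> where z: "\<xi> \<in> subdiff \<psi> (z 0)" "y0 = z m" "y0 \<in> edom \<phi>" "newton_decrement \<phi> \<psi> t0 y0 \<le> \<beta>"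
    and step: "\<And>j. j < (m::nat) \<Longrightarrow>
       inexact_newton_step \<phi> \<psi> t0 (grad \<phi> (z j) - \<tau> (Suc j) *\<^sub>R \<zeta>) (\<eta> j) (z j) (z (Suc j))"
    using assms unfolding phase1_output_def by blast
  show "y0 \<in> edom \<phi>" "newton_decrement \<phi> \<psi> t0 y0 \<le> \<beta>" using z by auto
  show "subdiff \<psi> y0 \<noteq> {}"
  proof (cases m)
    case 0
    then show ?thesis using z by auto
  next
    case (Suc j)
    then show ?thesis using inexact_newton_step_nonempty[OF step[of j]] z(2) by simp
  qed
qed

text \<open>The starting point is only known to have a small decrement, so the residual bound is available
  from the first step of the second phase on.\<close>

lemma scheme_invariant:
  assumes c: "0 < c" "c \<le> 1" and \<beta>: "0 < \<beta>" "\<beta> < 0.5 * (1 + 2 * c\<^sup>2 - sqrt (1 + 4 * c\<^sup>2))"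
    and \<nu>1: "1 \<le> \<nu>" and scheme: "two_phase_scheme \<phi> \<psi> Y \<nu> c \<beta> \<sigma> \<delta> t y"
  shows "0 < t k \<and> y k \<in> edom \<phi> \<and> newton_decrement \<phi> \<psi> (t k) (y k) \<le> \<beta> \<and>
    (\<exists>\<xi>\<in>subdiff \<psi> (y k). 1 \<le> k \<longrightarrow>
        op_dual_norm (hess \<phi> (y k)) (t k *\<^sub>R grad \<phi> (y k) + \<xi>) \<le> t k * \<theta> c \<beta>)"
proof (induction k)
  case 0
  have "phase1_output \<phi> \<psi> Y (t 0) \<beta> (y 0)" "0 < t 0" using scheme by (auto simp: two_phase_scheme_def)
  then show ?case using phase1_output_facts[of Y "t 0" \<beta> "y 0"] by auto
next
  case (Suc k)
  then have IH: "0 < t k" "y k \<in> edom \<phi>" "newton_decrement \<phi> \<psi> (t k) (y k) \<le> \<beta>" "subdiff \<psi> (y k) \<noteq> {}"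
    by auto
  have \<sigma>: "0 < \<sigma>" "\<sigma> \<le> \<sigma>_bound \<nu> c \<beta>" and \<delta>: "0 \<le> \<delta> k" "\<delta> k \<le> \<delta>_bound c \<beta>"
    and tS: "t (Suc k) = (1 - \<sigma>) * t k"
    and stepS: "inexact_newton_step \<phi> \<psi> (t (Suc k)) (grad \<phi> (y k)) (\<delta> k) (y k) (y (Suc k))"
    using scheme unfolding two_phase_scheme_def by blast+
  note step = stepS[unfolded tS]
  have "0 < t (Suc k)" using IH(1) sigma_bound_step(1)[OF c \<beta> \<nu>1 \<sigma>] by (simp add: tS)
  moreover obtain \<xi> where "y (Suc k) \<in> edom \<phi>" "\<xi> \<in> subdiff \<psi> (y (Suc k))"
    "op_dual_norm (hess \<phi> (y (Suc k))) (((1 - \<sigma>) * t k) *\<^sub>R grad \<phi> (y (Suc k)) + \<xi>) \<le> ((1 - \<sigma>) * t k) * \<theta> c \<beta>"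
    "newton_decrement \<phi> \<psi> ((1 - \<sigma>) * t k) (y (Suc k)) \<le> \<beta>"
    using path_following_step[OF c \<beta> \<nu>1 \<sigma> \<delta> IH(2,1,4,3) step] .
  ultimately show ?case unfolding tS by blast
qed

lemma local_proj_subdiff:
  assumes y: "y \<in> edom \<phi>" and sub: "subdiff \<psi> y \<noteq> {}"
    and s: "s = local_proj \<phi> y (subdiff (conjugate_over UNIV g) y) v"
  shows "s \<in> subdiff (conjugate_over UNIV g) y"
    "\<xi> \<in> subdiff \<psi> y \<Longrightarrow> op_dual_norm (hess \<phi> y) (v - s) \<le> op_dual_norm (hess \<phi> y) (v - (\<xi> - b))"
proof -
  let ?S = "subdiff (conjugate_over UNIV g) y"
  have "?S \<noteq> {}" using sub subdiff_dual_nonsmooth[OF g(1)] by blast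
  then obtain p where "p \<in> ?S" "\<And>z. z \<in> ?S \<Longrightarrow>
      op_norm (inv (hess \<phi> y)) (v - p) \<le> op_norm (inv (hess \<phi> y)) (v - z)"
    using op_norm_projection_exists[OF pd_op_inv[OF pd_hess_phi[OF y]] closed_subdiff] by blast
  then have "is_arg_min (\<lambda>s. local_dual_norm \<phi> y (v - s)) (\<lambda>x. x \<in> ?S) p"
    by (auto simp: is_arg_min_def local_dual_norm_eq op_dual_norm_eq not_less)
  then have "is_arg_min (\<lambda>s. local_dual_norm \<phi> y (v - s)) (\<lambda>x. x \<in> ?S) s"
    unfolding s local_proj_def arg_min_on_def arg_min_def by (rule someI)
  then show "s \<in> ?S"
    "\<xi> \<in> subdiff \<psi> y \<Longrightarrow> op_dual_norm (hess \<phi> y) (v - s) \<le> op_dual_norm (hess \<phi> y) (v - (\<xi> - b))"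
    using subdiff_dual_nonsmooth[OF g(1)] by (auto simp: is_arg_min_def local_dual_norm_eq not_less)
qed

end

theorem theorem7:
  fixes K :: "'a::euclidean_space set" and f :: "'a \<Rightarrow> ereal"
    and g :: "'b::euclidean_space \<Rightarrow> ereal" and L :: "'a \<Rightarrow> 'b"
    and q :: 'a and b :: 'b and \<nu> c \<beta> \<sigma> :: real
    and \<delta> t :: "nat \<Rightarrow> real" and y s :: "nat \<Rightarrow> 'b" and x :: "nat \<Rightarrow> 'a"
    and \<phi> \<psi> :: "'b \<Rightarrow> ereal"
  assumes K: "K \<noteq> {}" "closed K" "convex K" "cone K" "\<forall>v. v \<in> K \<and> - v \<in> K \<longrightarrow> v = 0"
      "interior K \<noteq> {}"
    and f: "self_concordant_barrier \<nu> K f" "log_homogeneous \<nu> f" "closure (edom f) = K"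
    and L: "linear L" "dim (range L) = DIM('b)"
    and g: "proper_fun g" "closed_fun g" "convex_fun g"
    and slater: "slater K g L b"
    and primal: "primal_solutions K g L b q \<noteq> {}"
    and c: "0 < c" "c \<le> 1"
    and \<beta>: "0 < \<beta>" "\<beta> < 0.5 * (1 + 2 * c\<^sup>2 - sqrt (1 + 4 * c\<^sup>2))"
    and \<phi>: "\<phi> = dual_barrier K f L q"
    and \<psi>: "\<psi> = dual_nonsmooth g b"
    and scheme: "two_phase_scheme \<phi> \<psi> (dual_feasible K L q) \<nu> c \<beta> \<sigma> \<delta> t y"
    and x: "\<forall>k. x k = grad (conjugate_over K f) ((1 / t k) *\<^sub>R (q - adjoint L (y k)))"
    and s: "\<forall>k. s k = local_proj \<phi> (y k) (subdiff (conjugate_over UNIV g) (y k)) (L (x k) - b)"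
  shows "(\<forall>k. x k \<in> interior K \<and> y k \<in> edom \<phi> \<and> y k \<in> subdiff g (s k) \<and>
              local_dual_norm f (x k) (adjoint L (y k) - q) \<le> sqrt \<nu> * t k)
       \<and> (\<forall>k\<ge>1. local_dual_norm \<phi> (y k) (L (x k) - s k - b) \<le> \<theta> c \<beta> * t k)
       \<and> \<theta> c \<beta> \<le> 1
       \<and> (\<forall>k. max (sqrt \<nu>) (\<theta> c \<beta>) * t k = sqrt \<nu> * t k)
       \<and> (\<forall>\<epsilon>>0. \<forall>k\<ge>1. max (sqrt \<nu>) (\<theta> c \<beta>) * t k \<le> \<epsilon> \<longrightarrow>
              eps_solution K f \<phi> g L b q \<epsilon> (x k, s k) (y k))"
proof -
  let ?F = "\<lambda>x. real_of_ereal (f x)"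
  obtain H T where CB: "cone_barrier K ?F \<nu> (grad f) H T"
    and hess: "\<And>x. x \<in> interior K \<Longrightarrow> hess f x = blinfun_apply (H x)"
    using cone_barrierI[OF K(2-4) _ K(6) f(1,2)] K(5) by blast
  have \<nu>: "0 < \<nu>" and dom: "edom f = interior K" and nminf: "\<And>x. f x \<noteq> - \<infinity>"
    using f(1) by (auto simp: self_concordant_barrier_def)
  have "span (range L) = UNIV" using L(2) dim_eq_full by blast
  then have "surj L"
    using linear_subspace_image[OF L(1) subspace_UNIV] by (metis span_eq_iff)
  then have "dual_path_following K ?F \<nu> (grad f) H T f L g"
    using CB L(1) g \<nu> nminf dom
    unfolding dual_path_following_def conic_dual_def conic_dual_axioms_def dual_path_following_axioms_def edom_def
    by (auto simp: ereal_real)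
  then interpret D: dual_path_following K ?F \<nu> "grad f" H T f L q g b .
  obtain x0 where x0: "x0 \<in> interior K" using K(6) by blast
  have \<nu>1: "1 \<le> \<nu>" using D.nu_ge_1[OF x0 \<nu>] .
  have \<theta>1: "\<theta> c \<beta> \<le> 1" using theta_le_beta[OF c \<beta>] beta_less_1[OF c \<beta>] by simp
  have "\<theta> c \<beta> \<le> sqrt \<nu>" using \<theta>1 \<nu>1 by (meson order_trans real_sqrt_ge_1_iff)
  then have max: "max (sqrt \<nu>) (\<theta> c \<beta>) = sqrt \<nu>" by simp
  note inv = D.scheme_invariant[OF c \<beta> \<nu>1 scheme[unfolded \<phi> \<psi>], folded \<phi> \<psi>]
  have A: "x k \<in> interior K \<and> y k \<in> edom \<phi> \<and> y k \<in> subdiff g (s k) \<and>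
      local_dual_norm f (x k) (adjoint L (y k) - q) \<le> sqrt \<nu> * t k" for k
  proof -
    have tk: "0 < t k" and yk: "y k \<in> edom \<phi>" and sub: "subdiff \<psi> (y k) \<noteq> {}" using inv[of k] by auto
    note X = D.primal_point[OF yk[unfolded \<phi>] tk x[rule_format, of k]]
    have "s k \<in> subdiff (conjugate_over UNIV g) (y k)"
      using D.local_proj_subdiff(1)[of "y k"] yk sub s by (simp add: \<phi> \<psi>)
    then have "y k \<in> subdiff g (s k)" by (rule subdiff_conjugate_imp_subdiff[OF g])
    then show ?thesis using X yk hess[OF X(1)] by (simp add: local_dual_norm_eq)
  qed
  have B: "local_dual_norm \<phi> (y k) (L (x k) - s k - b) \<le> \<theta> c \<beta> * t k" if k: "1 \<le> k" for k
  proof -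
    have tk: "0 < t k" and yk: "y k \<in> edom \<phi>" using inv[of k] by auto
    obtain \<xi> where \<xi>: "\<xi> \<in> subdiff \<psi> (y k)"
      "op_dual_norm (hess \<phi> (y k)) (t k *\<^sub>R grad \<phi> (y k) + \<xi>) \<le> t k * \<theta> c \<beta>" using inv[of k] k by blast
    note X = D.primal_point[OF yk[unfolded \<phi>] tk x[rule_format, of k], folded \<phi>]
    have "L (x k) - b - (\<xi> - b) = - (t k *\<^sub>R grad \<phi> (y k) + \<xi>)" by (simp add: X(2))
    moreover have "op_dual_norm (hess \<phi> (y k)) (L (x k) - b - s k)
        \<le> op_dual_norm (hess \<phi> (y k)) (L (x k) - b - (\<xi> - b))"
      using D.local_proj_subdiff(2)[of "y k" "s k" "L (x k) - b" \<xi>] yk \<xi>(1) s by (auto simp: \<phi> \<psi>)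
    moreover have "op_dual_norm (hess \<phi> (y k)) (- v) = op_dual_norm (hess \<phi> (y k)) v" for v
      using op_norm_minus[OF pd_op_inv[OF D.pd_hess_phi[of "y k"]]] yk by (simp add: \<phi> op_dual_norm_eq)
    moreover have "L (x k) - s k - b = L (x k) - b - s k" by simp
    ultimately show ?thesis using \<xi>(2) unfolding local_dual_norm_eq by (metis mult.commute order_trans)
  qed
  have C: "eps_solution K f \<phi> g L b q \<epsilon> (x k, s k) (y k)"
    if k: "1 \<le> k" and e: "max (sqrt \<nu>) (\<theta> c \<beta>) * t k \<le> \<epsilon>" for k \<epsilon>
  proof -
    have tk: "0 < t k" using inv[of k] by auto
    have "\<theta> c \<beta> * t k \<le> max (sqrt \<nu>) (\<theta> c \<beta>) * t k" "sqrt \<nu> * t k \<le> max (sqrt \<nu>) (\<theta> c \<beta>) * t k"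
      using tk by (auto intro: mult_right_mono)
    then show ?thesis using A[of k] B[OF k] e by (auto simp: eps_solution_def)
  qed
  show ?thesis using A B C \<theta>1 max by simp
qed

end
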